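(* Let $k\ge 100$ and $n>2k$ be integers. Then $c(n,k,3)=|\mathcal C_3(n,k)|$; that is, every intersecting family $\mathcal F\subset\binom{[n]}{k}$ with covering number $\tau(\mathcal F)\ge 3$ satisfies $|\mathcal F|\le |\mathcal C_3(n,k)|$, and this bound is attained (by $\mathcal C_3(n,k)$). Moreover, if $\mathcal F\subset\binom{[n]}{k}$ is intersecting with $\tau(\mathcal F)\ge 3$ and $|\mathcal F|=|\mathcal C_3(n,k)|$, then $\mathcal F$ is isomorphic to $\mathcal C_3(n,k)$.
   Context: Notation: $[a,b]=\{a,a+1,\ldots,b\}$, $[n]=[1,n]$, and $\binom{X}{k}$ is the collection of all $k$-element subsets of $X$. A family (a collection of sets) is intersecting if any two of its sets have non-empty intersection. The covering number $\tau(\mathcal F)$ of a family $\mathcal F$ is the size of the smallest set $X$ such that $X\cap F\ne\emptyset$ for all $F\in\mathcal F$. Two families of subsets of $[n]$ are isomorphic if one is obtained from the other by a permutation of the ground set $[n]$. For integers $n,k,t$, $c(n,k,t)$ denotes the maximum size of an intersecting family $\mathcal F\subset\binom{[n]}{k}$ with $\tau(\mathcal F)\ge t$. Let $\mathcal T_2(k)=\big\{[k],\ \{1\}\cup[k+1,2k-1],\ \{2\}\cup[k+1,2k-1]\big\}$. The family $\mathcal C_3(n,k)\subset\binom{[n]}{k}$ is the maximal intersecting family in which the subfamily of sets not containing the element $1$ is isomorphic to $\mathcal T_2(k)$ (a copy of it on the ground set $[2,n]$). Explicitly (up to isomorphism), with $A_1=[2,k+1]$, $A_2=\{2\}\cup[k+2,2k]$,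 $A_3=\{3\}\cup[k+2,2k]$, $$\mathcal C_3(n,k)=\{A_1,A_2,A_3\}\cup\Big\{F\in\tbinom{[n]}{k}: 1\in F,\ F\cap A_i\neq\emptyset \text{ for } i=1,2,3\Big\}.$$ *)

theory Defs
  imports "HOL-Library.Ramsey" "HOL-Library.Extended_Nat" "HOL-Combinatorics.Permutations"
begin

definition intersecting :: "'a set set \<Rightarrow> bool" where
  "intersecting \<F> \<longleftrightarrow> (\<forall>A\<in>\<F>. \<forall>B\<in>\<F>. A \<inter> B \<noteq> {})"

text \<open>
  Only finite covers are admitted, since \<^const>\<open>card\<close> is 0 on infinite sets.  The values lie in
  \<^typ>\<open>enat\<close> so that a family without a finite cover (for example one containing the empty set)
  has covering number infinity.
\<close>

definition covering_number :: "'a set set \<Rightarrow> enat" where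
  "covering_number \<F> = (INF X \<in> {X. finite X \<and> (\<forall>F\<in>\<F>. X \<inter> F \<noteq> {})}. enat (card X))"

definition admissible :: "nat \<Rightarrow> nat \<Rightarrow> nat \<Rightarrow> nat set set \<Rightarrow> bool" where
  "admissible n k t \<F> \<longleftrightarrow>
     \<F> \<subseteq> nsets {1..n} k \<and> intersecting \<F> \<and> covering_number \<F> \<ge> enat t"

text \<open>This is the quantity written c(n,k,t); the \<^const>\<open>Max\<close> is meaningful only if some family is admissible.\<close>

definition max_size :: "nat \<Rightarrow> nat \<Rightarrow> nat \<Rightarrow> nat" where
  "max_size n k t = Max {card \<F> | \<F>. admissible n k t \<F>}"

definition isomorphic_families :: "nat \<Rightarrow> nat set set \<Rightarrow> nat set set \<Rightarrow> bool" where
  "isomorphic_families n \<F> \<G> \<longleftrightarrow> (\<exists>\<pi>. \<pi> permutes {1..n} \<and> \<G> = (\<lambda>F. \<pi> ` F) ` \<F>)"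

definition T2 :: "nat \<Rightarrow> nat set set" where
  "T2 k = {{1..k}, {1} \<union> {k+1..2*k-1}, {2} \<union> {k+1..2*k-1}}"

text \<open>The copy of \<^term>\<open>T2 k\<close> on \<^term>\<open>{2..n}\<close> is obtained by shifting every element by one.\<close>

definition T2_shifted :: "nat \<Rightarrow> nat set set" where
  "T2_shifted k = (\<lambda>A. Suc ` A) ` T2 k"

definition C3 :: "nat \<Rightarrow> nat \<Rightarrow> nat set set" where
  "C3 n k = T2_shifted k \<union> {F \<in> nsets {1..n} k. 1 \<in> F \<and> (\<forall>A\<in>T2_shifted k. F \<inter> A \<noteq> {})}"

lemma T2_shifted_explicit:
  assumes "k \<ge> 1"
  shows "T2_shifted k = {{2..k+1}, {2} \<union> {k+2..2*k}, {3} \<union> {k+2..2*k}}"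
  using assms by (simp add: T2_shifted_def T2_def image_Un numeral_2_eq_2 numeral_3_eq_3)

end

theory Submission
  imports Defs Complex_Main
begin

text \<open>Fix a vertex \<open>v\<close>, put \<open>m = n - 1\<close>, and let \<open>B\<close> be the subfamily of the members of an intersecting family
\<open>F\<close> that avoid \<open>v\<close>.  Removing \<open>v\<close> from the other members leaves \<open>(k - 1)\<close>-sets on \<open>m\<close> points, none of
which is disjoint from a member of \<open>B\<close>.  If \<open>D\<close> denotes the collection of the \<open>(k - 1)\<close>-sets that are disjoint
from some member of \<open>B\<close>, then \<open>|F| \<le> C(m, k - 1) - |D| + |B|\<close>, with equality for the extremal family
and \<open>v = 1\<close>, where \<open>|B| = 3\<close> and \<open>|D| = d = 3 C(m - k, k - 1) - C(m - k - 1, k - 1) - C(m - 2 k + 1, k - 1)\<close>.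
So it suffices to show \<open>|D| - |B| \<ge> d - 3\<close> for a suitable \<open>v\<close> and to settle the case of equality.

The heart of the argument is \<open>card_D_ge_extremal\<close>.  Covering number at least 3 means that \<open>B\<close> has no
common point.  Take any two members \<open>M\<^sub>1\<close>, \<open>M\<^sub>2\<close> of \<open>B\<close>, let \<open>I\<close> be their intersection and \<open>i = |I|\<close>.
Sets disjoint from \<open>M\<^sub>1\<close>, sets disjoint from \<open>M\<^sub>2\<close>, and sets that meet \<open>I\<close>, with first point \<open>x\<close> say, and are
disjoint from a member of \<open>B\<close> that misses \<open>x\<close>, all belong to \<open>D\<close>.  Counting them gives
\<open>|D| \<ge> 3 C(m - k, k - 1) - C(m - k - i, k - 1) - C(m - 2 k + i, k - 1)\<close>, and convexity in \<open>i\<close> makes \<open>i = 1\<close>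
and \<open>i = k - 1\<close> the worst cases, where the right side is \<open>d\<close>.  Unless \<open>B\<close> consists of three sets with
empty intersection, the count can be improved by \<open>C(m - k - 3, k - 4)\<close>, which pays for all of \<open>B\<close> as long as
\<open>|B|\<close> does not exceed this binomial by more than 2.  For three sets, equality forces the pattern of \<open>T2\<close>.

It remains to find, in a family at least as large as the extremal one, a vertex that only few members avoid.
The tool is the Kruskal-Katona theorem in Lovasz's form, with a real parameter \<open>x\<close>: if the deficit
\<open>h = C(m, k - 1) - deg v\<close> is at most \<open>C(x, k - 1)\<close>, then \<open>|B| \<le> h C(x, m - k) / C(x, k - 1)\<close>.
Since \<open>h - |B| \<le> d\<close> in a large family, a bound on \<open>h\<close> with the quotient away from 1 improves itself until
\<open>|B|\<close> is as small as required.  What starts this bootstrap depends on the length of the ground set.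

For \<open>n \<le> 6 k\<close> a vertex of maximum degree has a deficit slightly below \<open>C(m - 1, k - 1)\<close>, the deficit
of the non-central vertices of a full star, and the extremal family is so close to a full star that this is enough (\<open>regime_near\<close>).  For
\<open>6 k \<le> n \<le> 10 k\<^sup>2\<close> the Kruskal-Katona bound produces a gap: every degree is either below
\<open>2 C(n - 2, k - 2)\<close> or above \<open>4 C(n - 2, k - 2)\<close>.  A shift at most doubles the maximum degree, so a
family without heavy vertex stays so under shifting, whereas a completely shifted family of this size is dominated by the
first vertex (\<open>exists_heavy_vertex\<close>).  For \<open>n \<ge> 10 k\<^sup>2\<close>, branching over successive missed members bounds
pair degrees, then the covering number of the family, then that of the link of a heavy vertex, and
finally the number of members avoiding that vertex (\<open>regime_far\<close>).\<close>

section \<open>A Kruskal-Katona bound for cross-intersecting families\<close>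


lemma gchoose_Suc_real: "(x gchoose Suc q) = (x gchoose q) * (x - real q) / real (Suc q)"
  for x :: real
  using gbinomial_mult_1[of x q] by (simp add: field_simps)

lemma gchoose_absorb_real: "(x gchoose Suc q) = x / real (Suc q) * ((x - 1) gchoose q)"
  for x :: real
  using gbinomial_absorption[of q x] by (simp add: field_simps)

lemma sum_card_incidence:
  assumes "finite V" "finite H" "\<And>S. S \<in> H \<Longrightarrow> S \<subseteq> V \<and> card S = r"
  shows "(\<Sum>v\<in>V. card {S \<in> H. v \<in> S}) = r * card H"
proof -
  have "(\<Sum>v\<in>V. card {S \<in> H. v \<in> S}) = (\<Sum>S\<in>H. card {v \<in> V. v \<in> S})"
    using assms(1,2) by (simp add: sum_multicount_gen[of V H "\<lambda>v S. v \<in> S" "\<lambda>S. card {v \<in> V. v \<in> S}"])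
  also have "\<dots> = (\<Sum>S\<in>H. r)"
  proof (rule sum.cong)
    fix S assume "S \<in> H"
    then have "{v \<in> V. v \<in> S} = S" "card S = r" using assms(3) by auto
    then show "card {v \<in> V. v \<in> S} = r" by simp
  qed simp
  finally show ?thesis by (simp add: mult.commute)
qed

lemma inj_on_minus_point: "inj_on (\<lambda>S. S - {v}) {S \<in> H. v \<in> S}"
  by (rule inj_onI) (metis (no_types, lifting) insert_Diff mem_Collect_eq)

text \<open>The Kruskal-Katona theorem in Lovasz's form, stated multiplicatively and for real \<open>x\<close>, after Keevash.  The
members of \<open>G\<close> are cliques of the \<open>r\<close>-graph \<open>H\<close>.  Double counting reduces the claim to one inequality per
vertex \<open>v\<close> between the number of cliques at \<open>v\<close> and the degree of \<open>v\<close>.  If the degree is at most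
\<open>C(x - 1, r - 1)\<close>, that inequality is the induction hypothesis for the link of \<open>v\<close>; if it is larger, then so few
edges avoid \<open>v\<close> that the map \<open>T \<mapsto> T - {v}\<close> into them is good enough.\<close>

lemma clique_bound_lovasz:
  fixes x :: real
  assumes "finite H" "finite G" "1 \<le> r"
    and "\<And>S. S \<in> H \<Longrightarrow> finite S \<and> card S = r"
    and "\<And>T. T \<in> G \<Longrightarrow> finite T \<and> card T = Suc r"
    and "\<And>T v. T \<in> G \<Longrightarrow> v \<in> T \<Longrightarrow> T - {v} \<in> H"
    and "real r \<le> x" "real (card H) \<le> (x gchoose r)"
  shows "real (Suc r) * real (card G) \<le> (x - real r) * real (card H)"
  using assms(3,1,2,4-)
proof (induction r arbitrary: H G x rule: dec_induct)
  case base
  define V where "V = \<Union>H"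
  have sing: "\<exists>v. S = {v}" if "S \<in> H" for S using base(3) that by (metis One_nat_def card_1_singletonE)
  have H: "H = (\<lambda>v. {v}) ` V"
  proof
    show "H \<subseteq> (\<lambda>v. {v}) ` V" unfolding V_def using sing by fastforce
    show "(\<lambda>v. {v}) ` V \<subseteq> H" unfolding V_def using sing by auto
  qed
  have cH: "card H = card V" unfolding H by (rule card_image) simp
  have fV: "finite V" unfolding V_def using base(1,3) by auto
  have "G \<subseteq> {T. T \<subseteq> V \<and> card T = 2}"
  proof
    fix T assume T: "T \<in> G"
    have c: "card T = 2" using base(4)[OF T] by simp
    have "T \<subseteq> V"
    proof
      fix v assume v: "v \<in> T"
      obtain w where w: "w \<in> T" "w \<noteq> v" using c v
        by (metis card_2_iff')
      have "T - {w} \<in> H" using base(5)[OF T w(1)] .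
      moreover have "v \<in> T - {w}" using v w by simp
      ultimately show "v \<in> V" unfolding V_def by (rule UnionI)
    qed
    then show "T \<in> {T. T \<subseteq> V \<and> card T = 2}" using c by simp
  qed
  then have "card G \<le> card V choose 2"
    using card_mono[of "{T. T \<subseteq> V \<and> card T = 2}" G] fV n_subsets[OF fV, of 2] by simp
  then have "2 * card G \<le> card V * (card V - 1)"
    by (simp add: choose_two, linarith?)
  then have "2 * real (card G) \<le> real (card V * (card V - 1))"
    by linarith
  also have "\<dots> = real (card V) * (real (card V) - 1)"
    by (cases "card V") (auto simp: algebra_simps)
  also have "\<dots> \<le> real (card V) * (x - 1)"
    by (rule mult_left_mono) (use base(7) cH in auto)
  finally show ?case using cH by (simp add: mult.commute)
next
  case (step r)
  have fS: "finite S" "card S = Suc r" if "S \<in> H" for S using step.prems(3) that by auto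
  have fT: "finite T" "card T = Suc (Suc r)" if "T \<in> G" for T using step.prems(4) that by auto
  define V where "V = \<Union>H \<union> \<Union>G"
  have fV: "finite V" unfolding V_def using step.prems(1,2) fS fT by auto
  define d where "d v = card {S \<in> H. v \<in> S}" for v
  define K where "K v = card {T \<in> G. v \<in> T}" for v
  have key: "real (Suc r) * real (K v) \<le> (x - real (Suc r)) * real (d v)" for v
  proof (cases "real (d v) \<le> ((x - 1) gchoose r)")
    case True
    define Hv where "Hv = (\<lambda>S. S - {v}) ` {S \<in> H. v \<in> S}"
    define Gv where "Gv = (\<lambda>S. S - {v}) ` {S \<in> G. v \<in> S}"
    have cHv: "card Hv = d v" "card Gv = K v" unfolding Hv_def Gv_def d_def K_def
      by (intro card_image inj_on_minus_point)+
    have "real (Suc r) * real (card Gv) \<le> ((x - 1) - real r) * real (card Hv)"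
    proof (rule step.IH)
      show "finite Hv" "finite Gv" unfolding Hv_def Gv_def using step.prems(1,2) by auto
      show "finite S \<and> card S = r" if "S \<in> Hv" for S using that fS unfolding Hv_def by auto
      show "finite S \<and> card S = Suc r" if "S \<in> Gv" for S using that fT unfolding Gv_def by auto
      show "T - {u} \<in> Hv" if T: "T \<in> Gv" "u \<in> T" for T u
      proof -
        obtain T' where T': "T' \<in> G" "v \<in> T'" "T = T' - {v}" using T unfolding Gv_def by auto
        then have "T' - {u} \<in> H" "v \<in> T' - {u}" using step.prems(5) T by auto
        moreover have "T - {u} = (T' - {u}) - {v}" using T' by auto
        ultimately show ?thesis unfolding Hv_def by blast
      qed
      show "real r \<le> x - 1" using step.prems(6) by simp
      show "real (card Hv) \<le> x - 1 gchoose r" using True cHv by simp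
    qed
    moreover have "(x - 1) - real r = x - real (Suc r)" by simp
    ultimately show ?thesis using cHv by simp
  next
    case False
    have "(\<lambda>S. S - {v}) ` {T \<in> G. v \<in> T} \<subseteq> {S \<in> H. v \<notin> S}" using step.prems(5) by auto
    then have "card ((\<lambda>S. S - {v}) ` {T \<in> G. v \<in> T}) \<le> card {S \<in> H. v \<notin> S}"
      using step.prems(1) by (intro card_mono) auto
    then have "K v \<le> card {S \<in> H. v \<notin> S}" unfolding K_def
      by (simp add: card_image[OF inj_on_minus_point])
    moreover have "card H = d v + card {S \<in> H. v \<notin> S}"
    proof -
      have "H = {S \<in> H. v \<in> S} \<union> {S \<in> H. v \<notin> S}" by auto
      then have "card H = card ({S \<in> H. v \<in> S} \<union> {S \<in> H. v \<notin> S})" by simp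
      also have "\<dots> = card {S \<in> H. v \<in> S} + card {S \<in> H. v \<notin> S}"
        by (rule card_Un_disjoint) (use step.prems(1) in auto)
      finally show ?thesis unfolding d_def .
    qed
    ultimately have "real (K v) \<le> real (card H) - real (d v)" by simp
    also have "\<dots> \<le> x / real (Suc r) * ((x - 1) gchoose r) - real (d v)"
      using step.prems(7) gchoose_absorb_real[of x r] by simp
    also have "\<dots> \<le> x / real (Suc r) * real (d v) - real (d v)"
      using False step.prems(6) by (intro diff_right_mono mult_left_mono) auto
    finally have "real (Suc r) * real (K v) \<le> real (Suc r) * (x / real (Suc r) * real (d v) - real (d v))"
      by (intro mult_left_mono) auto
    also have "\<dots> = (x - real (Suc r)) * real (d v)" by (simp add: field_simps)
    finally show ?thesis .
  qed
  have "real (Suc r) * (\<Sum>v\<in>V. real (K v)) \<le> (x - real (Suc r)) * (\<Sum>v\<in>V. real (d v))"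
    unfolding sum_distrib_left by (intro sum_mono key)
  moreover have "(\<Sum>v\<in>V. K v) = Suc (Suc r) * card G" unfolding K_def
    by (rule sum_card_incidence[OF fV step.prems(2)]) (use fT V_def in auto)
  moreover have "(\<Sum>v\<in>V. d v) = Suc r * card H" unfolding d_def
    by (rule sum_card_incidence[OF fV step.prems(1)]) (use fS V_def in auto)
  ultimately have "real (Suc r) * real (Suc (Suc r) * card G) \<le> (x - real (Suc r)) * real (Suc r * card H)"
    by (simp only: of_nat_sum[symmetric])
  then have "real (Suc r) * (real (Suc (Suc r)) * real (card G)) \<le> real (Suc r) * ((x - real (Suc r)) * real (card H))"
    by (simp only: of_nat_mult mult.left_commute)
  then show ?case by (simp only: mult_le_cancel_left_pos[of "real (Suc r)"] of_nat_0_less_iff zero_less_Suc)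
qed

definition disjoint_sets_in :: "'a set \<Rightarrow> nat \<Rightarrow> 'a set set \<Rightarrow> 'a set set" where
  "disjoint_sets_in X q \<B> = {S \<in> nsets X q. \<exists>B\<in>\<B>. S \<inter> B = {}}"

lemma finite_nsets: "finite X \<Longrightarrow> finite (nsets X q)"
  by (simp add: finite_imp_finite_nsets)

lemma finite_disjoint_sets_in: "finite X \<Longrightarrow> finite (disjoint_sets_in X q \<B>)"
  by (simp add: disjoint_sets_in_def finite_nsets)

text \<open>For every \<open>q\<close> let \<open>L q\<close> be the collection of \<open>q\<close>-sets disjoint from a member of the family.  Removing a point
from a member of \<open>L (q + 1)\<close> gives a member of \<open>L q\<close>, so \<open>clique_bound_lovasz\<close> applies at every level from
\<open>k - 1\<close> up to \<open>m - k\<close>, where \<open>L (m - k)\<close> consists of the complements of the members.\<close>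

lemma cross_intersecting_bound:
  fixes x :: real
  assumes "finite X" "card X = m" "2 \<le> k" "2 * k \<le> m"
    and "\<B> \<subseteq> nsets X k"
    and "real (m - k) \<le> x"
    and h: "real (card (disjoint_sets_in X (k - 1) \<B>)) \<le> h" "h \<le> (x gchoose (k - 1))"
  shows "real (card \<B>) \<le> h * (\<Prod>q = k - 1..<m - k. (x - real q) / real (Suc q))"
proof -
  define L where "L q = disjoint_sets_in X q \<B>" for q
  have finL: "finite (L q)" for q unfolding L_def by (rule finite_disjoint_sets_in[OF assms(1)])
  have grow: "real (Suc q) * real (card (L (Suc q))) \<le> (x - real q) * real (card (L q))"
    if q: "1 \<le> q" "q < m - k" "real (card (L q)) \<le> (x gchoose q)" for q
  proof (rule clique_bound_lovasz[OF finL finL q(1) _ _ _ _ q(3)])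
    show "finite S \<and> card S = q" if "S \<in> L q" for S using that by (auto simp: L_def disjoint_sets_in_def nsets_def)
    show "finite S \<and> card S = Suc q" if "S \<in> L (Suc q)" for S
      using that by (auto simp: L_def disjoint_sets_in_def nsets_def)
    show "T - {v} \<in> L q" if "T \<in> L (Suc q)" "v \<in> T" for T v
      using that by (auto simp: L_def disjoint_sets_in_def nsets_def)
    show "real q \<le> x" using q(2) assms(6) by simp
  qed
  have "real (card (L q)) \<le> h * (\<Prod>j = k - 1..<q. (x - real j) / real (Suc j)) \<and>
      h * (\<Prod>j = k - 1..<q. (x - real j) / real (Suc j)) \<le> (x gchoose q)"
    if "k - 1 \<le> q" "q \<le> m - k" for q
    using that
  proof (induction q rule: dec_induct)
    case base
    then show ?case using h L_def by simp
  next
    case (step q)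
    let ?P = "\<lambda>q. (\<Prod>j = k - 1..<q. (x - real j) / real (Suc j))"
    have IH: "real (card (L q)) \<le> h * ?P q" "h * ?P q \<le> (x gchoose q)" using step by auto
    have xq: "0 \<le> x - real q" using step.prems assms(6) by simp
    have P: "?P (Suc q) = ?P q * ((x - real q) / real (Suc q))" using step.hyps by simp
    have "real (Suc q) * real (card (L (Suc q))) \<le> (x - real q) * real (card (L q))"
      using grow[of q]
        step IH assms(3) by simp
    then have "real (card (L (Suc q))) \<le> real (card (L q)) * ((x - real q) / real (Suc q))"
      by (simp add: field_simps)
    also have "\<dots> \<le> (h * ?P q) * ((x - real q) / real (Suc q))"
      by (rule mult_right_mono[OF IH(1)]) (use xq in simp)
    finally have 1: "real (card (L (Suc q))) \<le> h * ?P (Suc q)" using P by simp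
    have "h * ?P (Suc q) = (h * ?P q) * ((x - real q) / real (Suc q))" using P by simp
    also have "\<dots> \<le> (x gchoose q) * ((x - real q) / real (Suc q))"
      by (rule mult_right_mono[OF IH(2)]) (use xq in simp)
    also have "\<dots> = (x gchoose Suc q)" using gchoose_Suc_real[of x q] by simp
    finally show ?case using 1 by simp
  qed
  from this[of "m - k"] have "real (card (L (m - k))) \<le> h * (\<Prod>q = k - 1..<m - k. (x - real q) / real (Suc q))"
    using assms(3,4) by simp
  moreover have "card \<B> \<le> card (L (m - k))"
  proof (rule card_inj_on_le[of "\<lambda>B. X - B"])
    show "inj_on (\<lambda>B. X - B) \<B>"
    proof (rule inj_onI)
      fix B C assume "B \<in> \<B>" "C \<in> \<B>" and eq: "X - B = X - C"
      then have "B \<subseteq> X" "C \<subseteq> X" using assms(5) by (auto simp: nsets_def)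
      then show "B = C" using eq by blast
    qed
    show "(\<lambda>B. X - B) ` \<B> \<subseteq> L (m - k)"
    proof
      fix S assume "S \<in> (\<lambda>B. X - B) ` \<B>"
      then obtain B where B: "B \<in> \<B>" "S = X - B" by auto
      then have "B \<subseteq> X" "card B = k" "finite B" using assms(5) by (auto simp: nsets_def)
      then have "card S = m - k" "S \<subseteq> X" "S \<inter> B = {}" using B assms(1,2) by (auto simp: card_Diff_subset)
      then show "S \<in> L (m - k)" using B assms(1) finite_subset unfolding L_def disjoint_sets_in_def nsets_def by auto
    qed
  qed (rule finL)
  ultimately show ?thesis by (smt (verit) of_nat_le_iff)
qed



section \<open>Intersecting families without a common point\<close>

lemma card_nsets_between:
  assumes "finite X" "P \<subseteq> X" "Q \<subseteq> X" "P \<inter> Q = {}" "card P \<le> q"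
  shows "card {S \<in> nsets X q. P \<subseteq> S \<and> S \<inter> Q = {}} = (card X - card P - card Q) choose (q - card P)"
proof -
  have fP: "finite P" "finite Q" using finite_subset[OF _ assms(1)] assms(2,3) by auto
  have "bij_betw (\<lambda>T. T \<union> P) (nsets (X - P - Q) (q - card P)) {S \<in> nsets X q. P \<subseteq> S \<and> S \<inter> Q = {}}"
  proof (rule bij_betwI[where g = "\<lambda>S. S - P"])
    show "(\<lambda>T. T \<union> P) \<in> nsets (X - P - Q) (q - card P) \<rightarrow> {S \<in> nsets X q. P \<subseteq> S \<and> S \<inter> Q = {}}"
    proof
      fix T assume "T \<in> nsets (X - P - Q) (q - card P)"
      then have T: "T \<subseteq> X - P - Q" "finite T" "card T = q - card P" by (auto simp: nsets_def)
      then have "card (T \<union> P) = card T + card P" using fP by (intro card_Un_disjoint) auto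
      then show "T \<union> P \<in> {S \<in> nsets X q. P \<subseteq> S \<and> S \<inter> Q = {}}"
        using T assms fP by (auto simp: nsets_def)
    qed
    show "(\<lambda>S. S - P) \<in> {S \<in> nsets X q. P \<subseteq> S \<and> S \<inter> Q = {}} \<rightarrow> nsets (X - P - Q) (q - card P)"
      using fP by (auto simp: nsets_def card_Diff_subset)
  qed (auto simp: nsets_def)
  then have "card {S \<in> nsets X q. P \<subseteq> S \<and> S \<inter> Q = {}} = card (nsets (X - P - Q) (q - card P))"
    by (rule bij_betw_same_card[symmetric])
  also have "\<dots> = card (X - P - Q) choose (q - card P)" by (rule card_nsets)
  also have "X - P - Q = X - (P \<union> Q)" by auto
  also have "card (X - (P \<union> Q)) = card X - card P - card Q"
    using assms fP by (simp add: card_Diff_subset card_Un_disjoint)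
  finally show ?thesis .
qed

lemma card_nsets_avoiding:
  assumes "finite X" "Q \<subseteq> X"
  shows "card {S \<in> nsets X q. S \<inter> Q = {}} = (card X - card Q) choose q"
  using card_nsets_between[of X "{}" Q q] assms by simp

lemma choose_mono_left: "a \<le> b \<Longrightarrow> a choose q \<le> b choose q"
  by (rule binomial_right_mono)

lemma choose_diff_mono:
  assumes "b \<le> (a :: nat)" "1 \<le> q"
  shows "(a choose q) + ((b + t) choose q) \<le> ((a + t) choose q) + (b choose q)"
proof (induction t)
  case (Suc t)
  obtain p where q: "q = Suc p" using assms(2) by (cases q) auto
  have "(b + t) choose p \<le> (a + t) choose p" using assms(1) by (intro choose_mono_left) simp
  then show ?case using Suc q by simp
qed simp

lemma choose_diff_strict_mono:
  assumes "b < (a :: nat)" "2 \<le> q" "q \<le> a + t" "1 \<le> t"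
  shows "(a choose q) + ((b + t) choose q) < ((a + t) choose q) + (b choose q)"
proof -
  obtain s where t: "t = Suc s" using assms(4) by (cases t) auto
  obtain p where q: "q = Suc (Suc p)" using assms(2) by (metis add_2_eq_Suc le_Suc_ex)
  have "(a choose q) + ((b + s) choose q) \<le> ((a + s) choose q) + (b choose q)"
    using assms by (intro choose_diff_mono) auto
  moreover have "(b + s) choose Suc p < (a + s) choose Suc p"
  proof -
    have "(b + s) choose Suc p \<le> (a + s - 1) choose Suc p" using assms by (intro choose_mono_left) simp
    moreover have "(a + s) choose Suc p = ((a + s - 1) choose p) + ((a + s - 1) choose Suc p)"
      using assms(1) by (metis Suc_diff_1 add_gr_0 binomial_Suc_Suc gr_implies_not_zero not_gr_zero)
    moreover have "0 < (a + s - 1) choose p" using assms t q by (intro zero_less_binomial) simp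
    ultimately show ?thesis by linarith
  qed
  ultimately show ?thesis using t q by simp
qed

lemma choose_le_Suc_Suc: "a choose b \<le> Suc a choose Suc b"
  by simp

lemma choose_pascal_pred:
  assumes "1 \<le> a" "1 \<le> q"
  shows "(a choose q) = ((a - 1) choose q) + ((a - 1) choose (q - 1))"
  using assms by (cases a; cases q) auto

text \<open>The ambient set \<open>X\<close> stands for the ground set without one vertex, and the family for the members that avoid this vertex.\<close>

locale uniform_family =
  fixes X :: "'a set" and m k :: nat and \<B> :: "'a set set"
  assumes fin_X: "finite X" and card_X: "card X = m" and k_ge: "4 \<le> k" and m_ge: "2 * k \<le> m"
    and unif: "\<B> \<subseteq> nsets X k"
begin

abbreviation "D \<equiv> disjoint_sets_in X (k - 1) \<B>"
abbreviation "Ch a \<equiv> a choose (k - 1)"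

lemma finite_D: "finite D"
  by (rule finite_disjoint_sets_in[OF fin_X])

lemma member: "B \<in> \<B> \<Longrightarrow> B \<subseteq> X \<and> finite B \<and> card B = k"
  using unif by (auto simp: nsets_def)

text \<open>Inside \<open>D\<close>, the sets that meet \<open>I\<close> are counted by their first point in an enumeration of \<open>I\<close>.  The order is
free, which is what \<open>hitting_bonus\<close> exploits.\<close>

definition hitting :: "'a set \<Rightarrow> 'a set set" where
  "hitting I = {S \<in> D. S \<inter> I \<noteq> {}}"

lemma finite_hitting: "finite (hitting I)"
  unfolding hitting_def using finite_D by simp

text \<open>The new sets contain \<open>x\<close>, avoid \<open>I\<close> and avoid \<open>B\<close>.  They are most numerous if \<open>B\<close> overlaps \<open>I\<close>, which is the
source of every gain over the extremal count.\<close>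

lemma hitting_insert:
  assumes "insert x I \<subseteq> X" "x \<notin> I" "B \<in> \<B>" "x \<notin> B"
  shows "card (hitting I) + ((m - 1 - card (I \<union> B)) choose (k - 2)) \<le> card (hitting (insert x I))"
proof -
  let ?N = "{S \<in> nsets X (k - 1). {x} \<subseteq> S \<and> S \<inter> (I \<union> B) = {}}"
  have "card ?N = (card X - card {x} - card (I \<union> B)) choose (k - 1 - card {x})"
    using fin_X assms member[OF assms(3)] k_ge by (intro card_nsets_between) auto
  then have N: "card ?N = (m - 1 - card (I \<union> B)) choose (k - 2)" using card_X k_ge
    by (simp add: numeral_2_eq_2)
  have fN: "finite ?N" using finite_nsets[OF fin_X] by simp
  have "hitting I \<union> ?N \<subseteq> hitting (insert x I)"
    using assms(3) unfolding hitting_def disjoint_sets_in_def by blast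
  moreover have "hitting I \<inter> ?N = {}" unfolding hitting_def by blast
  ultimately show ?thesis using N fN finite_hitting
    by (metis (no_types, lifting) card_Un_disjoint card_mono)
qed

text \<open>The contributions \<open>C(m - k - j, k - 2)\<close> for \<open>j = 1, ..., |I|\<close> telescope to \<open>C(m - k, k - 1) - C(m - k - |I|, k - 1)\<close>.
The parameter \<open>e\<close> carries a surplus obtained from the first points \<open>I0\<close> of the enumeration through to the end.\<close>

lemma hitting_extend:
  assumes "finite J" "I0 \<union> J \<subseteq> X" "\<And>x. x \<in> J \<Longrightarrow> \<exists>B\<in>\<B>. x \<notin> B" "card (I0 \<union> J) < k" "finite I0"
    and "Ch (m - k) + e \<le> card (hitting I0) + Ch (m - k - card I0)"
  shows "Ch (m - k) + e \<le> card (hitting (I0 \<union> J)) + Ch (m - k - card (I0 \<union> J))"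
  using assms(1-4)
proof (induction J rule: finite_induct)
  case empty
  then show ?case using assms(6) by simp
next
  case (insert x J)
  let ?I = "I0 \<union> J"
  have fI: "finite ?I" using insert assms(5) by simp
  have cI: "card ?I \<le> card (insert x ?I)" using fI by (intro card_mono) auto
  have IH: "Ch (m - k) + e \<le> card (hitting ?I) + Ch (m - k - card ?I)"
    using insert cI by (intro insert.IH) auto
  show ?case
  proof (cases "x \<in> I0")
    case True
    then have "I0 \<union> insert x J = I0 \<union> J" by auto
    then show ?thesis using IH by simp
  next
    case False
    then have x: "x \<notin> ?I" using insert by simp
    have c: "card (I0 \<union> insert x J) = Suc (card ?I)" using x fI by simp
    obtain B where B: "B \<in> \<B>" "x \<notin> B" using insert.prems(2) by auto
    have "card (hitting ?I) + ((m - 1 - card (?I \<union> B)) choose (k - 2)) \<le> card (hitting (insert x ?I))"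
      using insert x B by (intro hitting_insert) auto
    moreover have "(m - k - card ?I - 1) choose (k - 2) \<le> (m - 1 - card (?I \<union> B)) choose (k - 2)"
      using card_Un_le[of ?I B] member[OF B(1)] by (intro choose_mono_left) simp
    moreover have "Ch (m - k - card ?I) = Ch (m - k - card ?I - 1) + ((m - k - card ?I - 1) choose (k - 2))"
      using choose_pascal_pred[of "m - k - card ?I" "k - 1"] insert.prems(3) c m_ge k_ge
      by (simp add: numeral_2_eq_2)
    ultimately show ?thesis using IH c by simp
  qed
qed

text \<open>Three disjoint parts of \<open>D\<close> are added up: the sets meeting \<open>I\<close>, the sets avoiding \<open>M1\<close> or \<open>M2\<close>, counted by inclusion
and exclusion, and a part \<open>E\<close> for additional finds.\<close>

lemma card_D_ge:
  assumes "M1 \<in> \<B>" "M2 \<in> \<B>" "I = M1 \<inter> M2"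
    and "Ch (m - k) + e \<le> card (hitting I) + Ch (m - k - card I)"
    and "finite E" "E \<subseteq> D" "\<And>S. S \<in> E \<Longrightarrow> S \<inter> I = {} \<and> S \<inter> M1 \<noteq> {} \<and> S \<inter> M2 \<noteq> {}"
  shows "3 * Ch (m - k) + e + card E \<le> card D + Ch (m - k - card I) + Ch (m - 2 * k + card I)"
proof -
  let ?A = "\<lambda>M. {S \<in> nsets X (k - 1). S \<inter> M = {}}"
  have M: "M1 \<subseteq> X" "M2 \<subseteq> X" "card M1 = k" "card M2 = k" "finite M1" "finite M2"
    using member assms(1,2) by auto
  have cA: "card (?A M1) = Ch (m - k)" "card (?A M2) = Ch (m - k)"
    using card_nsets_avoiding[OF fin_X, of _ "k - 1"] M card_X by auto
  have U: "card (M1 \<union> M2) + card I = 2 * k" using card_Un_Int[of M1 M2] M assms(3) by simp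
  have "?A M1 \<inter> ?A M2 = ?A (M1 \<union> M2)" by blast
  then have cI: "card (?A M1 \<inter> ?A M2) = Ch (m - 2 * k + card I)"
  proof -
    have "m - card (M1 \<union> M2) = m - 2 * k + card I" using U m_ge by arith
    then show ?thesis using card_nsets_avoiding[OF fin_X, of "M1 \<union> M2" "k - 1"] M card_X
      \<open>?A M1 \<inter> ?A M2 = ?A (M1 \<union> M2)\<close> by simp
  qed
  have fA: "finite (?A M)" for M using finite_nsets[OF fin_X] by simp
  have cU: "card (?A M1 \<union> ?A M2) + Ch (m - 2 * k + card I) = 2 * Ch (m - k)"
    using card_Un_Int[OF fA fA, of M1 M2] cA cI by simp
  have "hitting I \<union> (?A M1 \<union> ?A M2) \<union> E \<subseteq> D"
    using assms(1,2,6) unfolding hitting_def disjoint_sets_in_def by blast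
  then have "card (hitting I \<union> (?A M1 \<union> ?A M2) \<union> E) \<le> card D" by (rule card_mono[OF finite_D])
  moreover have "card (hitting I \<union> (?A M1 \<union> ?A M2) \<union> E) = card (hitting I \<union> (?A M1 \<union> ?A M2)) + card E"
    by (rule card_Un_disjoint) (use assms(5,7) fA finite_hitting hitting_def in auto)
  moreover have "card (hitting I \<union> (?A M1 \<union> ?A M2)) = card (hitting I) + card (?A M1 \<union> ?A M2)"
    by (rule card_Un_disjoint) (use assms(3) fA finite_hitting hitting_def in auto)
  ultimately show ?thesis using cU assms(4) by simp
qed

end

text \<open>The isomorphism type of \<open>T2\<close>, in terms of its atoms: the two points \<open>a\<close>, \<open>b\<close> where the first set meets
the other two, the common part \<open>Q\<close> of those two, and the rest \<open>R\<close> of the first set.\<close>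

definition T2_pattern :: "nat \<Rightarrow> 'a set set \<Rightarrow> bool" where
  "T2_pattern k \<B> \<longleftrightarrow> (\<exists>a b Q R. a \<noteq> b \<and> a \<notin> Q \<union> R \<and> b \<notin> Q \<union> R \<and> Q \<inter> R = {} \<and> finite Q \<and> finite R
     \<and> card Q = k - 1 \<and> card R = k - 2 \<and> \<B> = {insert a (insert b R), insert a Q, insert b Q})"

lemma T2_patternI:
  assumes "card M1 = k" "card M2 = k" "card M3 = k" "2 \<le> k" "card (M1 \<inter> M2) = k - 1"
    and "M1 \<inter> M2 \<inter> M3 = {}" "M1 \<inter> M3 \<noteq> {}" "M2 \<inter> M3 \<noteq> {}"
  shows "T2_pattern k {M1, M2, M3}"
proof -
  let ?Q = "M1 \<inter> M2"
  have fin: "finite M1" "finite M2" "finite M3" using assms card_ge_0_finite by force+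
  have "card (M1 - ?Q) = 1" "card (M2 - ?Q) = 1"
    using assms fin by (simp_all add: card_Diff_subset)
  then obtain a b where a: "M1 - ?Q = {a}" and b: "M2 - ?Q = {b}" by (meson card_1_singletonE)
  have M1: "M1 = insert a ?Q" and M2: "M2 = insert b ?Q" using a b by blast+
  have ab: "a \<in> M3" "b \<in> M3" using assms(6-8) M1 M2 by auto
  have nQ: "a \<notin> ?Q" "b \<notin> ?Q" using a b by auto
  have "a \<noteq> b" using a b by auto
  define R where "R = M3 - {a, b}"
  have M3: "M3 = insert a (insert b R)" using ab R_def by auto
  have "card R = k - 2" using \<open>a \<noteq> b\<close> ab fin assms R_def by (simp add: card_Diff_subset)
  moreover have "?Q \<inter> R = {}" using assms(6) R_def by auto
  moreover have "{M1, M2, M3} = {insert a (insert b R), insert a ?Q, insert b ?Q}"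
    using M1 M2 M3 by auto
  moreover have "a \<notin> ?Q \<union> R" "b \<notin> ?Q \<union> R" using nQ R_def by auto
  ultimately show ?thesis unfolding T2_pattern_def using \<open>a \<noteq> b\<close> fin assms(5) R_def
    by (metis finite_Diff finite_Int)
qed

context uniform_family
begin

abbreviation "slack \<equiv> (m - k - 3) choose (k - 4)"

text \<open>With the sum of the two upper arguments fixed, the sum of the binomials is largest when these are farthest apart.\<close>

lemma pair_sum_le:
  assumes "1 \<le> i" "i < k"
  shows "Ch (m - k - i) + Ch (m - 2 * k + i) \<le> Ch (m - k - 1) + Ch (m - 2 * k + 1)"
proof -
  have "m - 2 * k + 1 + (i - 1) = m - 2 * k + i" "m - k - i + (i - 1) = m - k - 1"
    using assms m_ge by auto
  then show ?thesis
    using choose_diff_mono[of "m - 2 * k + 1" "m - k - i" "k - 1" "i - 1"] assms k_ge m_ge by force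
qed

lemma pair_sum_less:
  assumes "1 < i" "i < k - 1"
  shows "Ch (m - k - i) + Ch (m - 2 * k + i) < Ch (m - k - 1) + Ch (m - 2 * k + 1)"
proof -
  have "m - 2 * k + 1 + (i - 1) = m - 2 * k + i" "m - k - i + (i - 1) = m - k - 1"
    using assms m_ge by auto
  then show ?thesis
    using choose_diff_strict_mono[of "m - 2 * k + 1" "m - k - i" "k - 1" "i - 1"] assms k_ge m_ge by force
qed

lemma hitting_start: "Ch (m - k) + 0 \<le> card (hitting {}) + Ch (m - k - card {})"
  by simp

text \<open>A member \<open>M3\<close> that misses \<open>x\<close> but contains another point \<open>z\<close> of \<open>I\<close> yields a surplus.  If \<open>z\<close> comes first
and \<open>x\<close> second in the enumeration, then sets with first point \<open>x\<close> avoid \<open>z\<close> anyway, so that avoiding \<open>M3\<close>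
forbids only \<open>k - 1\<close> further points instead of \<open>k\<close>.\<close>

lemma hitting_bonus:
  assumes "z \<noteq> x" "z \<in> X" "x \<in> X" "M3 \<in> \<B>" "z \<in> M3" "x \<notin> M3" "M4 \<in> \<B>" "z \<notin> M4"
  shows "Ch (m - k) + slack \<le> card (hitting {z, x}) + Ch (m - k - card {z, x})"
proof -
  obtain l where k: "k = l + 4" using k_ge le_iff_add[of 4 k] by (auto simp: add.commute)
  have "4 \<le> m - k" using k_ge m_ge by linarith
  then obtain a where mk: "m - k = a + 4" using le_iff_add[of 4 "m - k"] by (auto simp: add.commute)
  have 1: "card (hitting {}) + ((m - 1 - card ({} \<union> M4)) choose (k - 2)) \<le> card (hitting {z})"
    using assms by (intro hitting_insert) auto
  have 2: "card (hitting {z}) + ((m - 1 - card ({z} \<union> M3)) choose (k - 2)) \<le> card (hitting {x, z})"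
    using assms by (intro hitting_insert) auto
  have c: "card ({} \<union> M4) = k" "card ({z} \<union> M3) = k" using member assms by (auto simp: insert_absorb)
  have mm: "m - 1 - k = a + 3" using mk by simp
  have "2 * ((a + 3) choose (l + 2)) \<le> card (hitting {z, x})"
    using 1 2 c mm k by (simp add: insert_commute)
  moreover have "slack = (a + 1) choose l" using mk k by simp
  moreover have "(a + 1) choose l \<le> (a + 2) choose (l + 1)" by simp
  ultimately show ?thesis using mk k assms(1) by (simp add: numeral_eq_Suc)
qed

text \<open>If a member missing a point of \<open>I\<close> meets \<open>I\<close>, then \<open>hitting_bonus\<close> supplies the surplus \<open>slack\<close>.
Otherwise some \<open>M3\<close> is disjoint from \<open>I\<close>, and the three sets \<open>M1\<close>, \<open>M2\<close>, \<open>M3\<close> alone account for the extremal value.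
A fourth member \<open>B\<close> then contributes the sets that avoid \<open>B\<close> but contain a point of each \<open>M\<^sub>i - B\<close>, again at
least \<open>slack\<close> many.  When there are just three members, equality first leaves \<open>|I| = 1\<close> or \<open>|I| = k - 1\<close> by
strict convexity, and \<open>|I| = 1\<close> survives only if \<open>M3\<close> contains \<open>M1 - I\<close> or \<open>M2 - I\<close>, which puts another pair
of the three sets into the case \<open>k - 1\<close>.\<close>

theorem card_D_ge_extremal:
  assumes ne: "\<B> \<noteq> {}" and int: "intersecting \<B>" and nc: "\<And>x. \<exists>B\<in>\<B>. x \<notin> B"
    and small: "card \<B> \<le> slack + 2"
  shows "3 * Ch (m - k) + card \<B> \<le> card D + Ch (m - k - 1) + Ch (m - 2 * k + 1) + 3"
    and "3 * Ch (m - k) + card \<B> = card D + Ch (m - k - 1) + Ch (m - 2 * k + 1) + 3 \<Longrightarrow>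
      T2_pattern k \<B>"
proof -
  obtain M1 where M1: "M1 \<in> \<B>" using ne by blast
  have "M1 \<noteq> {}" using member[OF M1] k_ge by auto
  then obtain u where u: "u \<in> M1" by blast
  obtain M2 where M2: "M2 \<in> \<B>" "u \<notin> M2" using nc by blast
  define I where "I = M1 \<inter> M2"
  have I_ne: "I \<noteq> {}" using int M1 M2 unfolding intersecting_def I_def by blast
  have fI: "finite I" using member[OF M1] I_def by simp
  have IX: "I \<subseteq> X" using member[OF M1] I_def by auto
  have "I \<subset> M1" using u M2 I_def by blast
  then have iub: "card I < k" using member[OF M1] by (metis psubset_card_mono)
  have ilb: "1 \<le> card I" using I_ne fI by (simp add: Suc_leI card_gt_0_iff)
  have hit0: "Ch (m - k) + 0 \<le> card (hitting I) + Ch (m - k - card I)"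
    using hitting_extend[of I "{}" 0] hitting_start fI IX nc iub by simp
  have le: "Ch (m - k - card I) + Ch (m - 2 * k + card I) \<le> Ch (m - k - 1) + Ch (m - 2 * k + 1)"
    by (rule pair_sum_le[OF ilb iub])
  have "(3 * Ch (m - k) + card \<B> \<le> card D + Ch (m - k - 1) + Ch (m - 2 * k + 1) + 3) \<and>
    (3 * Ch (m - k) + card \<B> = card D + Ch (m - k - 1) + Ch (m - 2 * k + 1) + 3 \<longrightarrow> T2_pattern k \<B>)"
  proof (cases "3 * Ch (m - k) + slack \<le> card D + Ch (m - k - card I) + Ch (m - 2 * k + card I)")
    case True
    then show ?thesis using small le by linarith
  next
    case False
    have triple: "M3 \<inter> I = {}" if "M3 \<in> \<B>" "x \<in> I" "x \<notin> M3" for M3 x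
    proof (rule ccontr)
      assume "M3 \<inter> I \<noteq> {}"
      then obtain z where z: "z \<in> M3" "z \<in> I" by blast
      obtain M4 where M4: "M4 \<in> \<B>" "z \<notin> M4" using nc by blast
      have "Ch (m - k) + slack \<le> card (hitting {z, x}) + Ch (m - k - card {z, x})"
        using z that M4 IX by (intro hitting_bonus[of z x M3 M4]) auto
      moreover have I: "{z, x} \<union> I = I" using z that by auto
      ultimately have "Ch (m - k) + slack \<le> card (hitting I) + Ch (m - k - card I)"
        using hitting_extend[of I "{z, x}" slack] fI IX nc iub by simp
      from card_D_ge[OF M1 M2(1) I_def this, of "{}"] show False using False by simp
    qed
    obtain x where x: "x \<in> I" using I_ne by blast
    obtain M3 where M3: "M3 \<in> \<B>" "x \<notin> M3" using nc by blast
    have M3I: "M3 \<inter> I = {}" using triple[OF M3(1) x M3(2)] .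
    have int3: "M1 \<inter> M3 \<noteq> {}" "M2 \<inter> M3 \<noteq> {}" using int M1 M2 M3 unfolding intersecting_def by blast+
    interpret T: uniform_family X m k "{M1, M2, M3}"
      using M1 M2 M3 unif fin_X card_X k_ge m_ge by unfold_locales auto
    have nc3: "\<exists>B\<in>{M1, M2, M3}. y \<notin> B" for y using M3I I_def by auto
    have hit3: "Ch (m - k) + 0 \<le> card (T.hitting I) + Ch (m - k - card I)"
      using T.hitting_extend[of I "{}" 0] T.hitting_start fI IX nc3 iub by simp
    have B3: "\<B> = {M1, M2, M3}"
    proof (rule ccontr)
      assume "\<B> \<noteq> {M1, M2, M3}"
      then obtain B where B: "B \<in> \<B>" "B \<noteq> M1" "B \<noteq> M2" "B \<noteq> M3" using M1 M2 M3 by blast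
      have sub: "M - B \<noteq> {}" if "M \<in> {M1, M2, M3}" for M
      proof
        assume "M - B = {}"
        moreover have "card M = card B" "finite B" "M \<noteq> B" using that member M1 M2 M3 B by auto
        ultimately show False by (metis Diff_eq_empty_iff card_subset_eq)
      qed
      have "M1 - B \<noteq> {}" "M2 - B \<noteq> {}" "M3 - B \<noteq> {}" by (rule sub, simp)+
      then obtain y1 y2 y3 where y: "y1 \<in> M1 - B" "y2 \<in> M2 - B" "y3 \<in> M3 - B"
        by (metis all_not_in_conv)
      let ?P = "{y1, y2, y3}"
      let ?E = "{S \<in> nsets X (k - 1). ?P \<subseteq> S \<and> S \<inter> B = {}}"
      \<comment> \<open>The three points may coincide; a smaller P only enlarges the count.\<close>
      have cP: "card ?P \<le> 3" by (simp add: card_insert_if)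
      have "card ?E = (m - card ?P - k) choose (k - 1 - card ?P)"
      proof -
        have "?P \<subseteq> X" "?P \<inter> B = {}" "B \<subseteq> X" "card B = k"
          using y member[OF M1] member[OF M2(1)] member[OF M3(1)] member[OF B(1)] by blast+
        moreover have "card ?P \<le> k - 1" using cP k_ge by linarith
        ultimately show ?thesis using card_nsets_between[OF fin_X, of ?P B "k - 1"] card_X by metis
      qed
      moreover have "slack \<le> (m - c - k) choose (k - 1 - c)" if "c \<le> 3" for c
      proof -
        have pas: "(a - Suc t) choose (b - Suc t) \<le> (a - t) choose (b - t)" if "t < b" "t < a" for a b t :: nat
          using that choose_le_Suc_Suc[of "a - Suc t" "b - Suc t"] by (simp add: Suc_diff_Suc)
        have "(m - k - 3) choose (k - 1 - 3) \<le> (m - k - c) choose (k - 1 - c)"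
          using that
        proof (induction rule: inc_induct)
          case (step t)
          then show ?case
            using pas[of t "k - 1" "m - k"] k_ge m_ge by linarith
        qed simp
        then show ?thesis by (simp add: add.commute)
      qed
      ultimately have cE: "slack \<le> card ?E" using cP by auto
      have "T.D \<union> ?E \<subseteq> D" using M1 M2 M3 B unfolding disjoint_sets_in_def by blast
      then have "card (T.D \<union> ?E) \<le> card D" by (rule card_mono[OF finite_D])
      moreover have "card (T.D \<union> ?E) = card T.D + card ?E"
      proof (rule card_Un_disjoint)
        show "finite T.D" by (rule T.finite_D)
        show "finite ?E" using finite_nsets[OF fin_X] by simp
        show "T.D \<inter> ?E = {}" using y unfolding disjoint_sets_in_def by blast
      qed
      moreover have "3 * Ch (m - k) \<le> card T.D + Ch (m - k - card I) + Ch (m - 2 * k + card I)"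
        using T.card_D_ge[OF _ _ I_def hit3, of "{}"] by simp
      ultimately show False using cE False by linarith
    qed
    have neq: "M1 \<noteq> M2" "M1 \<noteq> M3" "M2 \<noteq> M3" using u M2 M3 x I_def by auto
    have c3: "card \<B> = 3" using B3 neq by simp
    have base: "3 * Ch (m - k) \<le> card D + Ch (m - k - card I) + Ch (m - 2 * k + card I)"
      using card_D_ge[OF M1 M2(1) I_def hit0, of "{}"] by simp
    have cards: "card M1 = k" "card M2 = k" "card M3 = k" using member M1 M2 M3 by auto
    have "T2_pattern k \<B>" if eq: "3 * Ch (m - k) + card \<B> = card D + Ch (m - k - 1) + Ch (m - 2 * k + 1) + 3"
    proof -
      have "\<not> (1 < card I \<and> card I < k - 1)" using pair_sum_less[of "card I"] base eq c3 by linarith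
      then consider "card I = k - 1" | "card I = 1" using ilb iub by linarith
      then show ?thesis
      proof cases
        case 1
        then show ?thesis unfolding B3
          using cards k_ge M3I int3 by (intro T2_patternI) (auto simp: I_def)
      next
        case 2
        then have Ix: "I = {x}" using x by (metis card_1_singletonE singletonD)
        consider "M1 - I \<subseteq> M3" | "M2 - I \<subseteq> M3" | "\<not> M1 - I \<subseteq> M3" "\<not> M2 - I \<subseteq> M3" by blast
        then show ?thesis
        proof cases
          case 1
          then have "M1 \<inter> M3 = M1 - I" using M3I by auto
          then have "card (M1 \<inter> M3) = k - 1" using 2 cards fI I_def by (simp add: card_Diff_subset)
          then have "T2_pattern k {M1, M3, M2}"
            using cards k_ge M3I int3 I_ne by (intro T2_patternI) (auto simp: I_def)
          then show ?thesis unfolding B3 by (simp add: insert_commute)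
        next
          case 2
          then have "M2 \<inter> M3 = M2 - I" using M3I by auto
          then have "card (M2 \<inter> M3) = k - 1" using \<open>card I = 1\<close> cards fI I_def by (simp add: card_Diff_subset)
          then have "T2_pattern k {M2, M3, M1}"
            using cards k_ge M3I int3 I_ne by (intro T2_patternI) (auto simp: I_def)
          then show ?thesis unfolding B3 by (simp add: insert_commute)
        next
          case 3
          \<comment> \<open>Sets containing r and q but avoiding x and M3 meet M1 and M2 outside I, so they were not counted yet.\<close>
          then obtain r q where r: "r \<in> M1 - I" "r \<notin> M3" and q: "q \<in> M2 - I" "q \<notin> M3" by blast
          have rq: "r \<noteq> q" using r q I_def by auto
          let ?E = "{S \<in> nsets X (k - 1). {r, q} \<subseteq> S \<and> S \<inter> insert x M3 = {}}"
          have "card ?E = (m - card {r, q} - card (insert x M3)) choose (k - 1 - card {r, q})"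
          proof -
            have "{r, q} \<subseteq> X" "{r, q} \<inter> insert x M3 = {}" "insert x M3 \<subseteq> X"
              using r q Ix x IX member[OF M1] member[OF M2(1)] member[OF M3(1)] by blast+
            moreover have "card {r, q} \<le> k - 1" using rq k_ge by simp
            ultimately show ?thesis
              using card_nsets_between[OF fin_X, of "{r, q}" "insert x M3" "k - 1"] card_X by metis
          qed
          also have "\<dots> = (m - 2 - (k + 1)) choose (k - 3)"
            using rq M3(2) member[OF M3(1)] by (simp add: card_insert_if numeral_3_eq_3 numeral_2_eq_2)
          also have "0 < \<dots>" using m_ge k_ge by (intro zero_less_binomial) simp
          finally have pos: "0 < card ?E" .
          have "3 * Ch (m - k) + 0 + card ?E \<le> card D + Ch (m - k - card I) + Ch (m - 2 * k + card I)"
          proof (rule card_D_ge[OF M1 M2(1) I_def hit0])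
            show "finite ?E" using finite_nsets[OF fin_X] by simp
            show "?E \<subseteq> D" using M3(1) unfolding disjoint_sets_in_def by blast
            show "S \<inter> I = {} \<and> S \<inter> M1 \<noteq> {} \<and> S \<inter> M2 \<noteq> {}" if "S \<in> ?E" for S
              using that r q Ix by blast
          qed
          then show ?thesis using pos eq c3 le by linarith
        qed
      qed
    qed
    then show ?thesis using base le c3 by linarith
  qed
  then show "3 * Ch (m - k) + card \<B> \<le> card D + Ch (m - k - 1) + Ch (m - 2 * k + 1) + 3"
    "3 * Ch (m - k) + card \<B> = card D + Ch (m - k - 1) + Ch (m - 2 * k + 1) + 3 \<Longrightarrow> T2_pattern k \<B>"
    by blast+
qed

text \<open>Inclusion and exclusion.  A set that avoids the first member and one of the other two avoids all \<open>2 k - 1\<close> points of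
the union, so the two mixed intersections coincide.\<close>

lemma card_D_T2_pattern:
  assumes "T2_pattern k \<B>"
  shows "card D + Ch (m - k - 1) + Ch (m - 2 * k + 1) = 3 * Ch (m - k)"
proof -
  obtain a b Q R where ab: "a \<noteq> b" "a \<notin> Q \<union> R" "b \<notin> Q \<union> R" "Q \<inter> R = {}" "finite Q" "finite R"
    "card Q = k - 1" "card R = k - 2" "\<B> = {insert a (insert b R), insert a Q, insert b Q}"
    using assms unfolding T2_pattern_def by blast
  let ?A = "\<lambda>M. {S \<in> nsets X (k - 1). S \<inter> M = {}}"
  let ?M1 = "insert a (insert b R)" and ?M2 = "insert a Q" and ?M3 = "insert b Q"
  have sub: "?M1 \<subseteq> X" "?M2 \<subseteq> X" "?M3 \<subseteq> X" using member ab(9) by auto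
  have fA: "finite (?A M)" for M using finite_nsets[OF fin_X] by simp
  have cA: "M \<subseteq> X \<Longrightarrow> card (?A M) = Ch (m - card M)" for M
    using card_nsets_avoiding[OF fin_X] card_X by simp
  have c1: "card (?A ?M1) = Ch (m - k)" "card (?A ?M2) = Ch (m - k)" "card (?A ?M3) = Ch (m - k)"
  proof -
    have "card ?M1 = k" "card ?M2 = k" "card ?M3 = k" using member ab(9) by auto
    then show "card (?A ?M1) = Ch (m - k)" "card (?A ?M2) = Ch (m - k)" "card (?A ?M3) = Ch (m - k)"
      using cA[OF sub(1)] cA[OF sub(2)] cA[OF sub(3)] by metis+
  qed
  have "card (insert a (insert b Q)) = k + 1" using ab k_ge by (simp add: card_insert_if)
  moreover have "?A ?M2 \<inter> ?A ?M3 = ?A (insert a (insert b Q))" by blast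
  moreover have "insert a (insert b Q) \<subseteq> X" using sub by blast
  ultimately have c2: "card (?A ?M2 \<inter> ?A ?M3) = Ch (m - k - 1)"
    using cA[of "insert a (insert b Q)"] by (metis diff_diff_left)
  have "card (insert a (insert b (Q \<union> R))) = 2 * k - 1"
    using ab k_ge by (simp add: card_insert_if card_Un_disjoint)
  moreover have "?A ?M1 \<inter> (?A ?M2 \<union> ?A ?M3) = ?A (insert a (insert b (Q \<union> R)))" by blast
  moreover have "insert a (insert b (Q \<union> R)) \<subseteq> X" using sub by blast
  moreover have "m - (2 * k - 1) = m - 2 * k + 1" using m_ge k_ge by linarith
  ultimately have c3: "card (?A ?M1 \<inter> (?A ?M2 \<union> ?A ?M3)) = Ch (m - 2 * k + 1)"
    using cA[of "insert a (insert b (Q \<union> R))"] by metis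
  have D: "D = ?A ?M1 \<union> (?A ?M2 \<union> ?A ?M3)" unfolding disjoint_sets_in_def ab(9) by blast
  have "card (?A ?M2 \<union> ?A ?M3) + Ch (m - k - 1) = 2 * Ch (m - k)"
    using card_Un_Int[OF fA fA, of ?M2 ?M3] c1 c2 by simp
  moreover have "card D + Ch (m - 2 * k + 1) = Ch (m - k) + card (?A ?M2 \<union> ?A ?M3)"
    using card_Un_Int[OF fA finite_UnI[OF fA fA], of ?M1 ?M2 ?M3] c1 c3 D by simp
  ultimately show ?thesis by simp
qed

end



section \<open>Links of a vertex and the extremal family\<close>

lemma covering_number_ge_iff:
  "enat t \<le> covering_number \<F> \<longleftrightarrow> (\<forall>Y. finite Y \<and> (\<forall>F\<in>\<F>. Y \<inter> F \<noteq> {}) \<longrightarrow> t \<le> card Y)"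
  unfolding covering_number_def le_INF_iff by auto

lemma covering_ge3_missed:
  assumes "3 \<le> covering_number \<F>" "finite Y" "card Y \<le> 2"
  shows "\<exists>F\<in>\<F>. Y \<inter> F = {}"
proof (rule ccontr)
  assume "\<not> (\<exists>F\<in>\<F>. Y \<inter> F = {})"
  moreover have "enat 3 \<le> covering_number \<F>" using assms(1) by (simp add: numeral_eq_enat)
  ultimately have "3 \<le> card Y" using covering_number_ge_iff[of 3 \<F>] assms(2) by blast
  then show False using assms(3) by simp
qed

definition away :: "'a \<Rightarrow> 'a set set \<Rightarrow> 'a set set" where
  "away v \<F> = {F \<in> \<F>. v \<notin> F}"

text \<open>Degrees of arbitrary sets of vertices are needed, since branching proceeds through pairs.\<close>

definition degree :: "'a set set \<Rightarrow> 'a set \<Rightarrow> nat" where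
  "degree \<F> R = card {F \<in> \<F>. R \<subseteq> F}"

lemma card_split_degree: "finite \<F> \<Longrightarrow> card \<F> = degree \<F> {v} + card (away v \<F>)"
proof -
  assume fin: "finite \<F>"
  have "\<F> = {F \<in> \<F>. {v} \<subseteq> F} \<union> away v \<F>" unfolding away_def by auto
  then have "card \<F> = card ({F \<in> \<F>. {v} \<subseteq> F} \<union> away v \<F>)" by simp
  also have "\<dots> = card {F \<in> \<F>. {v} \<subseteq> F} + card (away v \<F>)"
    by (rule card_Un_disjoint) (auto simp: fin away_def)
  finally show ?thesis unfolding degree_def .
qed

abbreviation lost :: "nat \<Rightarrow> nat \<Rightarrow> nat \<Rightarrow> nat set set \<Rightarrow> nat set set" where
  "lost n k v \<F> \<equiv> disjoint_sets_in ({1..n} - {v}) (k - 1) (away v \<F>)"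

lemma bij_betw_star_link:
  assumes "v \<in> {1..n}" "1 \<le> k"
  shows "bij_betw (\<lambda>F. F - {v}) {F \<in> nsets {1..n} k. v \<in> F} (nsets ({1..n} - {v}) (k - 1))"
proof (rule bij_betwI[where g = "insert v"])
  show "(\<lambda>F. F - {v}) \<in> {F \<in> nsets {1..n} k. v \<in> F} \<rightarrow> nsets ({1..n} - {v}) (k - 1)"
    by (auto simp: nsets_def)
  show "insert v \<in> nsets ({1..n} - {v}) (k - 1) \<rightarrow> {F \<in> nsets {1..n} k. v \<in> F}"
    using assms by (auto simp: nsets_def card_insert_if)
qed (auto simp: nsets_def)

lemma star_meets_iff_not_lost:
  assumes "v \<in> {1..n}" "1 \<le> k" "F \<in> nsets {1..n} k" "v \<in> F"
  shows "F - {v} \<in> lost n k v \<F> \<longleftrightarrow> \<not> (\<forall>B \<in> away v \<F>. F \<inter> B \<noteq> {})"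
proof -
  have "F - {v} \<in> nsets ({1..n} - {v}) (k - 1)" using assms by (auto simp: nsets_def)
  then show ?thesis unfolding disjoint_sets_in_def away_def using assms by auto
qed

text \<open>The largest star at \<open>v\<close> that is compatible with the family \<open>B\<close> of sets avoiding \<open>v\<close>.\<close>

definition completion :: "nat \<Rightarrow> nat \<Rightarrow> nat \<Rightarrow> nat set set \<Rightarrow> nat set set" where
  "completion n k v \<B> = {F \<in> nsets {1..n} k. v \<in> F \<and> (\<forall>B\<in>\<B>. F \<inter> B \<noteq> {})}"

text \<open>Deleting \<open>v\<close> matches the members of the completion with the \<open>(k - 1)\<close>-sets that are not lost.\<close>

lemma card_completion:
  assumes "v \<in> {1..n}" "1 \<le> k"
  shows "card (completion n k v (away v \<F>)) + card (lost n k v \<F>) = (n - 1) choose (k - 1)"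
proof -
  let ?X = "{1..n} - {v}"
  let ?f = "\<lambda>F. F - {v}"
  have bij: "bij_betw ?f {F \<in> nsets {1..n} k. v \<in> F} (nsets ?X (k - 1))"
    using bij_betw_star_link[OF assms] .
  have inj: "inj_on ?f {F \<in> nsets {1..n} k. v \<in> F}" using bij bij_betw_imp_inj_on by blast
  have surj: "?f ` {F \<in> nsets {1..n} k. v \<in> F} = nsets ?X (k - 1)" using bij bij_betw_imp_surj_on by blast
  have "?f ` completion n k v (away v \<F>) = nsets ?X (k - 1) - lost n k v \<F>"
  proof
    show "?f ` completion n k v (away v \<F>) \<subseteq> nsets ?X (k - 1) - lost n k v \<F>"
    proof
      fix S assume "S \<in> ?f ` completion n k v (away v \<F>)"
      then obtain F where F: "F \<in> nsets {1..n} k" "v \<in> F" "\<forall>B\<in>away v \<F>. F \<inter> B \<noteq> {}" "S = ?f F"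
        unfolding completion_def by blast
      then show "S \<in> nsets ?X (k - 1) - lost n k v \<F>"
        using star_meets_iff_not_lost[OF assms F(1,2)] surj by blast
    qed
    show "nsets ?X (k - 1) - lost n k v \<F> \<subseteq> ?f ` completion n k v (away v \<F>)"
    proof
      fix S assume S: "S \<in> nsets ?X (k - 1) - lost n k v \<F>"
      then obtain F where F: "F \<in> nsets {1..n} k" "v \<in> F" "S = ?f F" using surj by blast
      then have "F \<in> completion n k v (away v \<F>)"
        using star_meets_iff_not_lost[OF assms F(1,2), of \<F>] S unfolding completion_def by blast
      then show "S \<in> ?f ` completion n k v (away v \<F>)" using F by blast
    qed
  qed
  moreover have "inj_on ?f (completion n k v (away v \<F>))"
    by (rule inj_on_subset[OF inj]) (auto simp: completion_def)
  ultimately have "card (completion n k v (away v \<F>)) = card (nsets ?X (k - 1) - lost n k v \<F>)"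
    using card_image by metis
  moreover have "lost n k v \<F> \<subseteq> nsets ?X (k - 1)" by (auto simp: disjoint_sets_in_def)
  moreover have "card (nsets ?X (k - 1)) = (n - 1) choose (k - 1)" using assms by (simp add: card_nsets)
  moreover have "finite (nsets ?X (k - 1))" by (rule finite_nsets) simp
  ultimately show ?thesis by (metis card_Diff_subset card_mono finite_subset le_add_diff_inverse2)
qed

lemma finite_uniform: "\<F> \<subseteq> nsets {1..n::nat} k \<Longrightarrow> finite \<F>"
  by (rule finite_subset[OF _ finite_nsets]) auto

lemma star_subset_completion:
  assumes "\<F> \<subseteq> nsets {1..n} k" "intersecting \<F>"
  shows "{F \<in> \<F>. {v} \<subseteq> F} \<subseteq> completion n k v (away v \<F>)"
  using assms unfolding completion_def away_def intersecting_def by blast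

lemma finite_completion: "finite (completion n k v \<B>)"
  unfolding completion_def using finite_nsets[of "{1..n}" k] by simp

lemma degree_plus_lost:
  assumes "\<F> \<subseteq> nsets {1..n} k" "intersecting \<F>" "v \<in> {1..n}" "1 \<le> k"
  shows "degree \<F> {v} + card (lost n k v \<F>) \<le> (n - 1) choose (k - 1)"
  using card_mono[OF finite_completion star_subset_completion[OF assms(1,2), of v]] card_completion[OF assms(3,4), of \<F>]
  unfolding degree_def by simp

lemma T2_shifted_pattern:
  assumes "4 \<le> k"
  shows "T2_pattern k (T2_shifted k)"
proof -
  have 1: "{2..k+1} = insert 2 (insert 3 {4..k+1})" "{2..k+1} = {2, 3} \<union> {4..k+1}" using assms by auto
  have "T2_shifted k = {insert 2 (insert 3 {4..k+1}), insert 2 {k+2..2*k}, insert 3 {k+2..2*k}}"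
    using T2_shifted_explicit[of k] assms 1 by simp
  moreover have "(2::nat) \<notin> {k+2..2*k} \<union> {4..k+1}" "(3::nat) \<notin> {k+2..2*k} \<union> {4..k+1}"
    "{k+2..2*k} \<inter> {4..k+1} = {}" "finite {k+2..2*k}" "finite {4..k+1}" "(2::nat) \<noteq> 3"
    "card {k+2..2*k} = k - 1" "card {4..k+1} = k - 2"
    using assms by auto
  ultimately show ?thesis unfolding T2_pattern_def by metis
qed

lemma T2_shifted_unif:
  assumes "4 \<le> k" "2 * k < n"
  shows "T2_shifted k \<subseteq> nsets ({1..n} - {1}) k"
  using T2_shifted_explicit[of k] assms by (auto simp: nsets_def card_insert_if)

lemma T2_pattern_card:
  assumes "T2_pattern k \<B>" "4 \<le> k"
  shows "card \<B> = 3"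
proof -
  obtain a b Q R where ab: "a \<noteq> b" "a \<notin> Q \<union> R" "b \<notin> Q \<union> R" "Q \<inter> R = {}"
    "card R = k - 2" "\<B> = {insert a (insert b R), insert a Q, insert b Q}"
    using assms unfolding T2_pattern_def by blast
  have "a \<notin> insert b Q" "b \<notin> insert a Q" using ab(1-3) by auto
  then have "insert a Q \<noteq> insert b Q" "insert a (insert b R) \<noteq> insert a Q" "insert a (insert b R) \<noteq> insert b Q"
    by blast+
  then show ?thesis using ab(6) by simp
qed

lemma T2_pattern_intersecting:
  assumes "T2_pattern k \<B>" "4 \<le> k"
  shows "intersecting \<B>"
proof -
  obtain a b Q R where ab: "card Q = k - 1" "\<B> = {insert a (insert b R), insert a Q, insert b Q}"
    using assms unfolding T2_pattern_def by blast
  have "Q \<noteq> {}" using ab(1) assms(2) by auto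
  then show ?thesis unfolding ab(2) intersecting_def by auto
qed

lemma C3_eq: "C3 n k = T2_shifted k \<union> completion n k 1 (T2_shifted k)"
  unfolding C3_def completion_def ..

lemma away_C3:
  assumes "4 \<le> k" "2 * k < n"
  shows "away 1 (C3 n k) = T2_shifted k"
  using T2_shifted_unif[OF assms] unfolding away_def C3_def nsets_def by auto

lemma C3_intersecting:
  assumes "4 \<le> k" "2 * k < n"
  shows "intersecting (C3 n k)"
proof -
  have "A \<inter> B \<noteq> {}" if "A \<in> T2_shifted k" "B \<in> T2_shifted k" for A B
    using T2_pattern_intersecting[OF T2_shifted_pattern] that assms unfolding intersecting_def by simp
  then show ?thesis unfolding intersecting_def C3_def by blast
qed

lemma C3_unif:
  assumes "4 \<le> k" "2 * k < n"
  shows "C3 n k \<subseteq> nsets {1..n} k"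
  using T2_shifted_unif[OF assms] nsets_mono[of "{1..n} - {1}" "{1..n}" k] unfolding C3_def by blast

text \<open>A cover \<open>Y\<close> of size 2 that contains 1 would need a second point common to the three sets of \<open>T2\<close>.  If it does
not contain 1, then one point \<open>q\<close> of the common block and one point \<open>r\<close> of the first set lie outside \<open>Y\<close>, and
\<open>{1, q, r}\<close> extends to a member disjoint from \<open>Y\<close>.\<close>

lemma C3_covering:
  assumes "4 \<le> k" "2 * k < n"
  shows "3 \<le> covering_number (C3 n k)"
proof -
  have "3 \<le> card Y" if Y: "finite Y" "\<forall>F\<in>C3 n k. Y \<inter> F \<noteq> {}" for Y
  proof (rule ccontr)
    assume "\<not> 3 \<le> card Y"
    then have cY: "card Y \<le> 2" by simp
    have exp: "T2_shifted k = {{2..k+1}, insert 2 {k+2..2*k}, insert 3 {k+2..2*k}}"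
      using T2_shifted_explicit[of k] assms by simp
    show False
    proof (cases "1 \<in> Y")
      case True
      then have "card (Y - {1}) \<le> 1" using cY Y by simp
      then have one: "y = z" if "y \<in> Y - {1}" "z \<in> Y - {1}" for y z
        using that Y(1) card_le_Suc0_iff_eq[of "Y - {1}"] by auto
      have "Y \<inter> {2..k+1} \<noteq> {}" "Y \<inter> insert 2 {k+2..2*k} \<noteq> {}" "Y \<inter> insert 3 {k+2..2*k} \<noteq> {}"
        using Y(2) exp unfolding C3_def by auto
      then obtain y1 y2 y3 where y: "y1 \<in> Y" "y1 \<in> {2..k+1}" "y2 \<in> Y" "y2 \<in> insert 2 {k+2..2*k}"
        "y3 \<in> Y" "y3 \<in> insert 3 {k+2..2*k}" by blast
      then have "y1 = y2" "y2 = y3" using one[of y1 y2] one[of y2 y3] assms by auto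
      then show False using y by auto
    next
      case False
      have fin: "finite ({k+2..2*k} - Y)" "finite ({2..k+1} - Y)" by auto
      have "card ({k+2..2*k} - Y) \<ge> (k - 1) - 2" "card ({2..k+1} - Y) \<ge> k - 2"
        using diff_card_le_card_Diff[OF Y(1), of "{k+2..2*k}"] diff_card_le_card_Diff[OF Y(1), of "{2..k+1}"] cY by auto
      then have "card ({k+2..2*k} - Y) > 0" "card ({2..k+1} - Y) > 0" using assms by auto
      then obtain q r where q: "q \<in> {k+2..2*k}" "q \<notin> Y" and r: "r \<in> {2..k+1}" "r \<notin> Y"
        by (metis Diff_iff card.empty ex_in_conv less_nat_zero_code)
      let ?Z = "{1..n} - Y - {1, q, r}"
      have cZ0: "card {1, q, r} = 3" using q r assms by auto
      have "{1, q, r} \<subseteq> {1..n} - Y" using q r False assms by auto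
      then have "card ?Z = card ({1..n} - Y) - 3" using cZ0 by (simp add: card_Diff_subset)
      moreover have "card ({1..n} - Y) \<ge> n - 2" using diff_card_le_card_Diff[OF Y(1), of "{1..n}"] cY by simp
      ultimately have "k - 3 \<le> card ?Z" using assms by linarith
      then obtain S where S: "S \<subseteq> ?Z" "card S = k - 3" "finite S"
        by (metis obtain_subset_with_card_n)
      let ?F = "{1, q, r} \<union> S"
      have "card ?F = card {1, q, r} + card S" using S by (intro card_Un_disjoint) auto
      then have "?F \<in> nsets {1..n} k" using S cZ0 assms q r unfolding nsets_def by auto
      moreover have "\<forall>A\<in>T2_shifted k. ?F \<inter> A \<noteq> {}" unfolding exp using q r by blast
      ultimately have "?F \<in> C3 n k" unfolding C3_def by blast
      moreover have "Y \<inter> ?F = {}" using q r False S by auto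
      ultimately show False using Y by blast
    qed
  qed
  then have "enat 3 \<le> covering_number (C3 n k)" using covering_number_ge_iff[of 3 "C3 n k"] by blast
  then show ?thesis by (simp add: numeral_eq_enat)
qed

lemma uniform_family_away:
  assumes "\<F> \<subseteq> nsets {1..n} k" "4 \<le> k" "2 * k < n" "v \<in> {1..n}"
  shows "uniform_family ({1..n} - {v}) (n - 1) k (away v \<F>)"
proof
  show "away v \<F> \<subseteq> nsets ({1..n} - {v}) k" using assms(1) unfolding away_def nsets_def by blast
qed (use assms in auto)

lemma card_C3:
  assumes "4 \<le> k" "2 * k < n"
  shows "card (C3 n k) + 3 * ((n - 1 - k) choose (k - 1)) =
    ((n - 1) choose (k - 1)) + ((n - 1 - k - 1) choose (k - 1)) + ((n - 1 - 2 * k + 1) choose (k - 1)) + 3"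
proof -
  interpret uniform_family "{1..n} - {1}" "n - 1" k "T2_shifted k"
    using uniform_family_away[OF C3_unif[OF assms] assms, of 1] away_C3[OF assms] assms by simp
  have "completion n k 1 (T2_shifted k) \<inter> T2_shifted k = {}"
    using T2_shifted_unif[OF assms] unfolding completion_def nsets_def by blast
  moreover have "finite (T2_shifted k)" unfolding T2_shifted_def T2_def by simp
  ultimately have "card (C3 n k) = 3 + card (completion n k 1 (T2_shifted k))"
    unfolding C3_eq using finite_completion T2_pattern_card[OF T2_shifted_pattern] assms
    by (subst card_Un_disjoint) auto
  moreover have "card (completion n k 1 (T2_shifted k)) + card D = (n - 1) choose (k - 1)"
    using card_completion[of 1 n k "C3 n k"] away_C3[OF assms] assms by simp
  ultimately show ?thesis using card_D_T2_pattern[OF T2_shifted_pattern[OF assms(1)]] by linarith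
qed

lemma completion_image:
  assumes \<pi>: "\<pi> permutes {1..n}"
  shows "(\<lambda>F. \<pi> ` F) ` completion n k v \<B> = completion n k (\<pi> v) ((\<lambda>B. \<pi> ` B) ` \<B>)"
proof -
  have inj: "inj \<pi>" using permutes_inj[OF \<pi>] .
  have one: "\<rho> ` F \<in> completion n k (\<rho> u) ((\<lambda>B. \<rho> ` B) ` \<C>)"
    if "\<rho> permutes {1..n}" "F \<in> completion n k u \<C>" for \<rho> F u \<C>
  proof -
    have i: "inj \<rho>" using permutes_inj[OF that(1)] .
    have "\<rho> ` F \<subseteq> {1..n}" "card (\<rho> ` F) = k" "finite (\<rho> ` F)"
      using that permutes_image[OF that(1)] card_image[OF inj_on_subset[OF i], of F]
      unfolding completion_def nsets_def by blast+
    moreover have "\<rho> ` F \<inter> \<rho> ` B \<noteq> {}" if "B \<in> \<C>" for B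
      using that \<open>F \<in> completion n k u \<C>\<close> unfolding completion_def by blast
    ultimately show ?thesis using that(2) unfolding completion_def nsets_def by auto
  qed
  show ?thesis
  proof
    show "(\<lambda>F. \<pi> ` F) ` completion n k v \<B> \<subseteq> completion n k (\<pi> v) ((\<lambda>B. \<pi> ` B) ` \<B>)"
      using one[OF \<pi>] by blast
    show "completion n k (\<pi> v) ((\<lambda>B. \<pi> ` B) ` \<B>) \<subseteq> (\<lambda>F. \<pi> ` F) ` completion n k v \<B>"
    proof
      fix F assume F: "F \<in> completion n k (\<pi> v) ((\<lambda>B. \<pi> ` B) ` \<B>)"
      let ?\<rho> = "inv \<pi>"
      have "?\<rho> ` F \<in> completion n k (?\<rho> (\<pi> v)) ((\<lambda>B. ?\<rho> ` B) ` (\<lambda>B. \<pi> ` B) ` \<B>)"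
        by (rule one[OF permutes_inv[OF \<pi>] F])
      moreover have "?\<rho> (\<pi> v) = v" "(\<lambda>B. ?\<rho> ` B) ` (\<lambda>B. \<pi> ` B) ` \<B> = \<B>"
        using inj by (simp_all add: image_image image_inv_f_f)
      moreover have "\<pi> ` ?\<rho> ` F = F" using permutes_surj[OF \<pi>] by (simp add: image_f_inv_f)
      ultimately show "F \<in> (\<lambda>F. \<pi> ` F) ` completion n k v \<B>" by (metis image_eqI)
    qed
  qed
qed

text \<open>The bijection is glued together from bijections of the atoms of the two patterns and of the remaining points.\<close>

lemma T2_pattern_transport:
  assumes "T2_pattern k \<B>" "T2_pattern k \<C>" "\<Union>\<B> \<subseteq> V - {v}" "\<Union>\<C> \<subseteq> V - {w}" "v \<in> V" "w \<in> V" "finite V"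
  shows "\<exists>\<pi>. \<pi> permutes V \<and> \<pi> v = w \<and> (\<lambda>B. \<pi> ` B) ` \<B> = \<C>"
proof -
  obtain a b Q R where ab: "a \<noteq> b" "a \<notin> Q \<union> R" "b \<notin> Q \<union> R" "Q \<inter> R = {}" "finite Q" "finite R"
    "card Q = k - 1" "card R = k - 2" "\<B> = {insert a (insert b R), insert a Q, insert b Q}"
    using assms(1) unfolding T2_pattern_def by blast
  obtain c d P S where cd: "c \<noteq> d" "c \<notin> P \<union> S" "d \<notin> P \<union> S" "P \<inter> S = {}" "finite P" "finite S"
    "card P = k - 1" "card S = k - 2" "\<C> = {insert c (insert d S), insert c P, insert d P}"
    using assms(2) unfolding T2_pattern_def by blast
  have inB: "a \<in> V - {v}" "b \<in> V - {v}" "Q \<subseteq> V - {v}" "R \<subseteq> V - {v}" using assms(3) ab(9) by auto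
  have inC: "c \<in> V - {w}" "d \<in> V - {w}" "P \<subseteq> V - {w}" "S \<subseteq> V - {w}" using assms(4) cd(9) by auto
  obtain g where g: "bij_betw g Q P" using finite_same_card_bij[of Q P] ab cd by auto
  obtain h where h: "bij_betw h R S" using finite_same_card_bij[of R S] ab cd by auto
  define f1 where "f1 x = (if x \<in> Q then g x else h x)" for x
  define f2 where "f2 x = (if x \<in> Q \<union> R then f1 x else if x = a then c else if x = b then d else w)" for x
  have b1: "bij_betw f1 (Q \<union> R) (P \<union> S)" unfolding f1_def
    by (rule bij_betw_disjoint_Un[OF g h]) (use ab cd in auto)
  have b3: "bij_betw (\<lambda>x. if x = a then c else if x = b then d else w) {a, b, v} {c, d, w}"
    unfolding bij_betw_def inj_on_def using ab(1) cd(1) inB inC by auto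
  have b2: "bij_betw f2 ((Q \<union> R) \<union> {a, b, v}) ((P \<union> S) \<union> {c, d, w})" unfolding f2_def
    by (rule bij_betw_disjoint_Un[OF b1 b3]) (use ab cd inB inC in auto)
  let ?U = "(Q \<union> R) \<union> {a, b, v}" and ?W = "(P \<union> S) \<union> {c, d, w}"
  have UW: "?U \<subseteq> V" "?W \<subseteq> V" using inB inC assms(5,6) by auto
  then have "card (V - ?U) = card (V - ?W)" using bij_betw_same_card[OF b2] assms(7)
    by (metis card_Diff_subset finite_subset)
  then obtain e where e: "bij_betw e (V - ?U) (V - ?W)"
    using finite_same_card_bij[of "V - ?U" "V - ?W"] assms(7) by auto
  define f3 where "f3 x = (if x \<in> ?U then f2 x else e x)" for x
  have "bij_betw f3 (?U \<union> (V - ?U)) (?W \<union> (V - ?W))" unfolding f3_def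
    by (rule bij_betw_disjoint_Un[OF b2 e]) auto
  moreover have "?U \<union> (V - ?U) = V" "?W \<union> (V - ?W) = V" using UW by blast+
  ultimately have b4: "bij_betw f3 V V" by metis
  define \<pi> where "\<pi> x = (if x \<in> V then f3 x else x)" for x
  have "bij_betw \<pi> V V" using b4 by (rule bij_betw_cong[THEN iffD1, rotated]) (simp add: \<pi>_def)
  then have perm: "\<pi> permutes V" by (rule bij_imp_permutes) (simp add: \<pi>_def)
  have f: "\<pi> v = w" "\<pi> a = c" "\<pi> b = d" "\<And>x. x \<in> Q \<Longrightarrow> \<pi> x = g x" "\<And>x. x \<in> R \<Longrightarrow> \<pi> x = h x"
    unfolding \<pi>_def f3_def f2_def f1_def using inB ab assms(5) by auto
  have "\<pi> ` Q = P" using f(4) g unfolding bij_betw_def by (metis image_cong)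
  moreover have "\<pi> ` R = S" using f(5) h unfolding bij_betw_def by (metis image_cong)
  ultimately have "(\<lambda>B. \<pi> ` B) ` \<B> = \<C>" unfolding ab(9) cd(9) using f by simp
  then show ?thesis using perm f by blast
qed

text \<open>In the case of equality, \<open>card_D_ge_extremal\<close> determines the members that avoid \<open>v\<close> up to
isomorphism, and the members through \<open>v\<close> must then form the whole completion.\<close>

theorem bound_from_small_away:
  assumes F: "\<F> \<subseteq> nsets {1..n} k" "intersecting \<F>" "3 \<le> covering_number \<F>"
    and kn: "4 \<le> k" "2 * k < n" and v: "v \<in> {1..n}"
    and small: "card (away v \<F>) \<le> ((n - 1 - k - 3) choose (k - 4)) + 2"
  shows "card \<F> \<le> card (C3 n k)"
    and "card \<F> = card (C3 n k) \<Longrightarrow> isomorphic_families n \<F> (C3 n k)"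
proof -
  interpret uniform_family "{1..n} - {v}" "n - 1" k "away v \<F>"
    by (rule uniform_family_away[OF F(1) kn v])
  have nc: "\<exists>B\<in>away v \<F>. x \<notin> B" for x
  proof -
    have "card {v, x} \<le> 2" by (cases "v = x") auto
    then show ?thesis using covering_ge3_missed[OF F(3), of "{v, x}"] unfolding away_def by auto
  qed
  have ne: "away v \<F> \<noteq> {}" using nc by blast
  have int: "intersecting (away v \<F>)" using F(2) unfolding intersecting_def away_def by blast
  have fin: "finite \<F>" by (rule finite_uniform[OF F(1)])
  note low = card_D_ge_extremal[OF ne int nc small]
  have split: "card \<F> = degree \<F> {v} + card (away v \<F>)" by (rule card_split_degree[OF fin])
  have deg: "degree \<F> {v} + card D \<le> (n - 1) choose (k - 1)"
    using degree_plus_lost[OF F(1,2) v] kn by simp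
  note C = card_C3[OF kn]
  show "card \<F> \<le> card (C3 n k)" using split deg low(1) C by linarith
  assume eq: "card \<F> = card (C3 n k)"
  then have pat: "T2_pattern k (away v \<F>)" using split deg low C by linarith
  have degeq: "degree \<F> {v} + card D = (n - 1) choose (k - 1)"
    using eq split deg low(1) C by linarith
  have star: "{F \<in> \<F>. {v} \<subseteq> F} = completion n k v (away v \<F>)"
  proof (rule card_subset_eq[OF finite_completion star_subset_completion[OF F(1,2)]])
    show "card {F \<in> \<F>. {v} \<subseteq> F} = card (completion n k v (away v \<F>))"
      using degeq card_completion[OF v, of k \<F>] kn unfolding degree_def by simp
  qed
  have "\<F> = away v \<F> \<union> {F \<in> \<F>. {v} \<subseteq> F}" unfolding away_def by auto
  then have Feq: "\<F> = away v \<F> \<union> completion n k v (away v \<F>)" by (simp only: star)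
  have "\<exists>\<pi>. \<pi> permutes {1..n} \<and> \<pi> v = 1 \<and> (\<lambda>B. \<pi> ` B) ` away v \<F> = T2_shifted k"
  proof (rule T2_pattern_transport[OF pat T2_shifted_pattern[OF kn(1)]])
    show "\<Union> (away v \<F>) \<subseteq> {1..n} - {v}" using member by blast
    show "\<Union> (T2_shifted k) \<subseteq> {1..n} - {1}" using T2_shifted_unif[OF kn] unfolding nsets_def by blast
  qed (use v kn in auto)
  then obtain \<pi> where \<pi>: "\<pi> permutes {1..n}" "\<pi> v = 1" "(\<lambda>B. \<pi> ` B) ` away v \<F> = T2_shifted k" by blast
  have "(\<lambda>F. \<pi> ` F) ` \<F> = T2_shifted k \<union> completion n k 1 (T2_shifted k)"
    using completion_image[OF \<pi>(1), of k v "away v \<F>"] \<pi>(2,3) Feq by (metis image_Un)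
  then show "isomorphic_families n \<F> (C3 n k)"
    unfolding isomorphic_families_def C3_eq using \<pi>(1) by metis
qed



section \<open>Branching and shifting\<close>

text \<open>As long as \<open>R\<close> has fewer than \<open>s\<close> points, some \<open>G\<close> in \<open>\<G>\<close> is disjoint from \<open>R\<close>; every member of
\<open>\<E>\<close> containing \<open>R\<close> meets \<open>G\<close>, so it contains one of at most \<open>w\<close> one-point extensions of \<open>R\<close>.\<close>

lemma branching:
  assumes fin: "finite X" and unif: "\<E> \<subseteq> nsets X k" and sk: "s \<le> k"
    and G: "\<And>G. G \<in> \<G> \<Longrightarrow> finite G \<and> card G \<le> w"
    and cross: "\<And>F G. F \<in> \<E> \<Longrightarrow> G \<in> \<G> \<Longrightarrow> F \<inter> G \<noteq> {}"
    and miss: "\<And>R. finite R \<Longrightarrow> card R < s \<Longrightarrow> \<exists>G\<in>\<G>. R \<inter> G = {}"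
    and R: "finite R" "card R \<le> s"
  shows "card {F \<in> \<E>. R \<subseteq> F} \<le> w ^ (s - card R) * ((card X - s) choose (k - s))"
  using R
proof (induction "s - card R" arbitrary: R)
  case 0
  then have cR: "card R = s" by simp
  show ?case
  proof (cases "R \<subseteq> X")
    case True
    have "{F \<in> \<E>. R \<subseteq> F} \<subseteq> {F \<in> nsets X k. R \<subseteq> F \<and> F \<inter> {} = {}}" using unif by blast
    then have "card {F \<in> \<E>. R \<subseteq> F} \<le> card {F \<in> nsets X k. R \<subseteq> F \<and> F \<inter> {} = {}}"
      using finite_nsets[OF fin] by (intro card_mono) auto
    also have "\<dots> = (card X - s) choose (k - s)"
      using card_nsets_between[OF fin True, of "{}" k] cR sk by simp
    finally show ?thesis using cR by simp
  next
    case False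
    then have "{F \<in> \<E>. R \<subseteq> F} = {}" using unif by (auto simp: nsets_def)
    then have "card {F \<in> \<E>. R \<subseteq> F} = 0" by (simp only: card.empty)
    then show ?thesis by linarith
  qed
next
  case (Suc l)
  have finE: "finite \<E>" by (rule finite_subset[OF unif finite_nsets[OF fin]])
  have "card R < s" using Suc.hyps(2) by linarith
  then obtain G where Gm: "G \<in> \<G>" "R \<inter> G = {}" using miss[OF Suc.prems(1)] by blast
  have fG: "finite G" "card G \<le> w" using G[OF Gm(1)] by auto
  have "{F \<in> \<E>. R \<subseteq> F} \<subseteq> (\<Union>y\<in>G. {F \<in> \<E>. insert y R \<subseteq> F})"
  proof
    fix F assume F: "F \<in> {F \<in> \<E>. R \<subseteq> F}"
    then have "F \<inter> G \<noteq> {}" using cross Gm(1) by blast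
    then obtain y where y: "y \<in> F" "y \<in> G" by blast
    then have "F \<in> {F \<in> \<E>. insert y R \<subseteq> F}" using F by simp
    then show "F \<in> (\<Union>y\<in>G. {F \<in> \<E>. insert y R \<subseteq> F})" using y(2) by blast
  qed
  then have "card {F \<in> \<E>. R \<subseteq> F} \<le> card (\<Union>y\<in>G. {F \<in> \<E>. insert y R \<subseteq> F})"
    using finE fG by (intro card_mono) auto
  also have "\<dots> \<le> (\<Sum>y\<in>G. card {F \<in> \<E>. insert y R \<subseteq> F})"
    by (rule card_UN_le[OF fG(1)])
  also have "\<dots> \<le> (\<Sum>y\<in>G. w ^ l * ((card X - s) choose (k - s)))"
  proof (rule sum_mono)
    fix y assume "y \<in> G"
    then have "y \<notin> R" using Gm(2) by blast
    then have c: "card (insert y R) = Suc (card R)" using Suc.prems(1) by simp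
    then have l: "l = s - card (insert y R)" using Suc.hyps(2) by simp
    show "card {F \<in> \<E>. insert y R \<subseteq> F} \<le> w ^ l * ((card X - s) choose (k - s))"
      using Suc.hyps(1)[OF l] c Suc.prems Suc.hyps(2) l by auto
  qed
  also have "\<dots> = card G * (w ^ l * ((card X - s) choose (k - s)))" by simp
  also have "\<dots> \<le> w * (w ^ l * ((card X - s) choose (k - s)))" by (rule mult_right_mono[OF fG(2)]) simp
  also have "\<dots> = w ^ (s - card R) * ((card X - s) choose (k - s))"
    using Suc.hyps(2) by (metis mult.assoc power_Suc)
  finally show ?case .
qed

definition shift_set :: "'a \<Rightarrow> 'a \<Rightarrow> 'a set \<Rightarrow> 'a set" where
  "shift_set i j F = (if j \<in> F \<and> i \<notin> F then insert i (F - {j}) else F)"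

text \<open>The usual compression of a family is the image \<open>shift_in i j \<F> ` \<F>\<close>: a set moves only if its target is vacant.\<close>

definition shift_in :: "'a \<Rightarrow> 'a \<Rightarrow> 'a set set \<Rightarrow> 'a set \<Rightarrow> 'a set" where
  "shift_in i j \<F> F = (if shift_set i j F \<in> \<F> then F else shift_set i j F)"

lemma inj_on_shift_in:
  assumes "i \<noteq> j" shows "inj_on (shift_in i j \<F>) \<F>"
proof (rule inj_onI)
  fix F G assume FG: "F \<in> \<F>" "G \<in> \<F>" and eq: "shift_in i j \<F> F = shift_in i j \<F> G"
  have undo: "insert j (shift_set i j H - {i}) = H" if "j \<in> H" "i \<notin> H" for H
    using that assms unfolding shift_set_def by auto
  show "F = G"
  proof (cases "shift_set i j F \<in> \<F> \<or> shift_set i j G \<in> \<F>")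
    case True
    then show ?thesis using FG eq unfolding shift_in_def by metis
  next
    case False
    then have "shift_set i j F = shift_set i j G" using eq unfolding shift_in_def by simp
    moreover have "j \<in> F" "i \<notin> F" "j \<in> G" "i \<notin> G"
      using False FG unfolding shift_set_def by (auto split: if_splits)
    ultimately show ?thesis using undo by metis
  qed
qed

lemma shift_set_card:
  assumes "finite F" shows "card (shift_set i j F) = card F" "finite (shift_set i j F)"
proof -
  show "finite (shift_set i j F)" using assms unfolding shift_set_def by auto
  have "card (insert i (F - {j})) = card F" if "j \<in> F" "i \<notin> F"
  proof -
    have "card (insert i (F - {j})) = Suc (card (F - {j}))" using assms that by simp
    then show ?thesis using card_Suc_Diff1[OF assms that(1)] by simp
  qed
  then show "card (shift_set i j F) = card F" unfolding shift_set_def by simp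
qed

lemma shift_unif:
  assumes "\<F> \<subseteq> nsets X k" "i \<in> X"
  shows "shift_in i j \<F> ` \<F> \<subseteq> nsets X k"
proof
  fix G assume "G \<in> shift_in i j \<F> ` \<F>"
  then obtain F where F: "F \<in> \<F>" "G = shift_in i j \<F> F" by auto
  then have "F \<subseteq> X" "finite F" "card F = k" using assms by (auto simp: nsets_def)
  moreover have "shift_set i j F \<subseteq> X" using \<open>F \<subseteq> X\<close> assms(2) unfolding shift_set_def by auto
  ultimately show "G \<in> nsets X k" using F(2) shift_set_card[of F i j] unfolding shift_in_def nsets_def by auto
qed

text \<open>The only critical case is a moved set \<open>F\<close> against an unmoved set \<open>G\<close> whose target lies in the family: if they had become
disjoint, then \<open>F\<close> would be disjoint from the target of \<open>G\<close>.\<close>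

lemma shift_intersecting:
  assumes "intersecting \<F>" "i \<noteq> j"
  shows "intersecting (shift_in i j \<F> ` \<F>)"
proof -
  let ?s = "shift_in i j \<F>"
  have mixed: "shift_set i j F \<inter> G \<noteq> {}"
    if FG: "F \<in> \<F>" "G \<in> \<F>" "shift_set i j F \<notin> \<F>" "shift_set i j G \<in> \<F>" for F G
  proof
    assume emp: "shift_set i j F \<inter> G = {}"
    have F: "j \<in> F" "i \<notin> F" using FG unfolding shift_set_def by (auto split: if_splits)
    then have sF: "shift_set i j F = insert i (F - {j})" unfolding shift_set_def by simp
    have "F \<inter> G \<noteq> {}" using assms(1) FG unfolding intersecting_def by blast
    then have "j \<in> G" "i \<notin> G" using emp sF by auto
    then have "shift_set i j G = insert i (G - {j})" unfolding shift_set_def by simp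
    then have "F \<inter> shift_set i j G = {}" using emp sF F by auto
    then show False using assms(1) FG unfolding intersecting_def by blast
  qed
  have "?s F \<inter> ?s G \<noteq> {}" if FG: "F \<in> \<F>" "G \<in> \<F>" for F G
  proof -
    consider "shift_set i j F \<in> \<F>" "shift_set i j G \<in> \<F>" | "shift_set i j F \<in> \<F>" "shift_set i j G \<notin> \<F>"
      | "shift_set i j F \<notin> \<F>" "shift_set i j G \<in> \<F>" | "shift_set i j F \<notin> \<F>" "shift_set i j G \<notin> \<F>" by blast
    then show ?thesis
    proof cases
      case 1
      then show ?thesis using assms(1) FG unfolding shift_in_def intersecting_def by simp
    next
      case 2
      then show ?thesis using mixed[OF FG(2,1)] unfolding shift_in_def by (simp add: Int_commute)
    next
      case 3
      then show ?thesis using mixed[OF FG] unfolding shift_in_def by simp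
    next
      case 4
      then have "i \<in> shift_set i j F" "i \<in> shift_set i j G"
        using FG unfolding shift_set_def by (auto split: if_splits)
      then show ?thesis using 4 unfolding shift_in_def by auto
    qed
  qed
  then show ?thesis unfolding intersecting_def by blast
qed

text \<open>Only sets that contain \<open>i\<close> or \<open>j\<close> before the shift can contain \<open>i\<close> afterwards.\<close>

lemma shift_degree:
  assumes "finite \<F>" "i \<noteq> j"
  shows "x \<noteq> i \<Longrightarrow> degree (shift_in i j \<F> ` \<F>) {x} \<le> degree \<F> {x}"
    and "degree (shift_in i j \<F> ` \<F>) {i} \<le> degree \<F> {i} + degree \<F> {j}"
proof -
  let ?s = "shift_in i j \<F>"
  have sub: "{G \<in> ?s ` \<F>. {x} \<subseteq> G} = ?s ` {F \<in> \<F>. x \<in> ?s F}" for x by auto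
  have le: "card (?s ` A) \<le> card A" if "A \<subseteq> \<F>" for A
    using that assms(1) by (intro card_image_le) (rule finite_subset)
  show "degree (?s ` \<F>) {x} \<le> degree \<F> {x}" if "x \<noteq> i"
  proof -
    have "{F \<in> \<F>. x \<in> ?s F} \<subseteq> {F \<in> \<F>. {x} \<subseteq> F}"
      using that unfolding shift_in_def shift_set_def by (auto split: if_splits)
    then have "card {F \<in> \<F>. x \<in> ?s F} \<le> degree \<F> {x}" unfolding degree_def using assms(1) by (intro card_mono) auto
    moreover have "card (?s ` {F \<in> \<F>. x \<in> ?s F}) \<le> card {F \<in> \<F>. x \<in> ?s F}" by (rule le) auto
    ultimately show ?thesis unfolding degree_def sub by linarith
  qed
  have "{F \<in> \<F>. i \<in> ?s F} \<subseteq> {F \<in> \<F>. {i} \<subseteq> F} \<union> {F \<in> \<F>. {j} \<subseteq> F}"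
    unfolding shift_in_def shift_set_def by (auto split: if_splits)
  then have "card {F \<in> \<F>. i \<in> ?s F} \<le> card ({F \<in> \<F>. {i} \<subseteq> F} \<union> {F \<in> \<F>. {j} \<subseteq> F})"
    using assms(1) by (intro card_mono) auto
  also have "\<dots> \<le> degree \<F> {i} + degree \<F> {j}" unfolding degree_def by (rule card_Un_le)
  finally have "card {F \<in> \<F>. i \<in> ?s F} \<le> degree \<F> {i} + degree \<F> {j}" .
  moreover have "card (?s ` {F \<in> \<F>. i \<in> ?s F}) \<le> card {F \<in> \<F>. i \<in> ?s F}" by (rule le) auto
  ultimately show "degree (?s ` \<F>) {i} \<le> degree \<F> {i} + degree \<F> {j}" unfolding degree_def sub by linarith
qed

text \<open>The potential that decreases under proper shifts to the left.\<close>

definition weight :: "nat set set \<Rightarrow> nat" where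
  "weight \<F> = (\<Sum>F\<in>\<F>. \<Sum>F)"

lemma shift_weight:
  assumes "finite \<F>" "\<And>F. F \<in> \<F> \<Longrightarrow> finite F" "i < j" "F0 \<in> \<F>" "shift_set i j F0 \<notin> \<F>"
  shows "weight (shift_in i j \<F> ` \<F>) < weight \<F>"
proof -
  let ?s = "shift_in i j \<F>"
  have lt: "\<Sum>(shift_set i j F) < \<Sum>F" if F: "F \<in> \<F>" "shift_set i j F \<notin> \<F>" for F
  proof -
    have ij: "j \<in> F" "i \<notin> F" using F unfolding shift_set_def by (auto split: if_splits)
    have fF: "finite F" using assms(2) F by blast
    have "\<Sum>F = j + \<Sum>(F - {j})" using sum.remove[OF fF ij(1), of "\<lambda>x. x"] by simp
    moreover have "\<Sum>(insert i (F - {j})) = i + \<Sum>(F - {j})" using fF ij by simp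
    ultimately show ?thesis using ij assms(3) unfolding shift_set_def by simp
  qed
  have "weight (?s ` \<F>) = (\<Sum>F\<in>\<F>. \<Sum>(?s F))"
    unfolding weight_def using inj_on_shift_in[of i j \<F>] assms(3) by (simp add: sum.reindex)
  also have "\<dots> < (\<Sum>F\<in>\<F>. \<Sum>F)"
  proof (rule sum_strict_mono_ex1[OF assms(1)])
    show "\<forall>F\<in>\<F>. \<Sum>(?s F) \<le> \<Sum>F" using lt unfolding shift_in_def by (auto intro: less_imp_le)
    show "\<exists>F\<in>\<F>. \<Sum>(?s F) < \<Sum>F" using lt[OF assms(4,5)] assms(4,5) unfolding shift_in_def by auto
  qed
  finally show ?thesis unfolding weight_def .
qed

text \<open>A family of minimal weight among those of the given size with all degrees at most \<open>d\<close> is stable.  A shift keeps it in this class: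
the new degrees are at most \<open>2 d\<close>, and the hypothesis \<open>gap\<close> excludes degrees between \<open>d\<close> and \<open>2 d\<close>.\<close>

lemma exists_stable_family:
  fixes \<F> :: "nat set set"
  assumes F: "\<F> \<subseteq> nsets {1..n} k" "intersecting \<F>" "\<And>x. x \<in> {1..n} \<Longrightarrow> degree \<F> {x} \<le> d"
    and gap: "\<And>\<G> x. \<G> \<subseteq> nsets {1..n} k \<Longrightarrow> intersecting \<G> \<Longrightarrow> card \<G> = card \<F> \<Longrightarrow> x \<in> {1..n}
      \<Longrightarrow> degree \<G> {x} \<le> 2 * d \<Longrightarrow> degree \<G> {x} \<le> d"
  shows "\<exists>\<G>. \<G> \<subseteq> nsets {1..n} k \<and> intersecting \<G> \<and> card \<G> = card \<F> \<and> (\<forall>x\<in>{1..n}. degree \<G> {x} \<le> d)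
    \<and> (\<forall>i\<in>{1..n}. \<forall>j\<in>{1..n}. \<forall>G\<in>\<G>. i < j \<longrightarrow> shift_set i j G \<in> \<G>)"
proof -
  let ?P = "\<lambda>\<G>. \<G> \<subseteq> nsets {1..n} k \<and> intersecting \<G> \<and> card \<G> = card \<F> \<and> (\<forall>x\<in>{1..n}. degree \<G> {x} \<le> d)"
  have "?P \<F>" using F by blast
  then obtain \<G> where P: "?P \<G>" and least: "\<And>\<H>. ?P \<H> \<Longrightarrow> weight \<G> \<le> weight \<H>"
    using ex_has_least_nat[of ?P \<F> weight] by blast
  have fin: "finite \<G>" using P finite_uniform by blast
  have "shift_set i j G \<in> \<G>" if ij: "i \<in> {1..n}" "j \<in> {1..n}" "i < j" and G: "G \<in> \<G>" for i j G
  proof (rule ccontr)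
    assume not: "shift_set i j G \<notin> \<G>"
    let ?H = "shift_in i j \<G> ` \<G>"
    have H: "?H \<subseteq> nsets {1..n} k" "intersecting ?H" "card ?H = card \<F>"
      using shift_unif[of \<G> "{1..n}" k i j] shift_intersecting[of \<G> i j] P ij
        card_image[OF inj_on_shift_in[of i j \<G>]] by auto
    have "degree ?H {x} \<le> d" if x: "x \<in> {1..n}" for x
    proof (rule gap[OF H x])
      have "degree \<G> {x} \<le> d" "degree \<G> {i} \<le> d" "degree \<G> {j} \<le> d" using P x ij by auto
      then show "degree ?H {x} \<le> 2 * d"
        using shift_degree(1)[OF fin, of i j x] shift_degree(2)[OF fin, of i j] ij(3)
        by (cases "x = i") auto
    qed
    then have "weight \<G> \<le> weight ?H" using H by (intro least) blast
    moreover have "weight ?H < weight \<G>"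
      using P G not ij(3) fin by (intro shift_weight) (auto simp: nsets_def)
    ultimately show False by simp
  qed
  then show ?thesis using P by blast
qed

text \<open>If every prefix \<open>{1..t}\<close> were at most half filled by \<open>F\<close>, then the points of \<open>F\<close> could be replaced one by one, from left
to right, by smaller points outside \<open>F\<close>.  Stability keeps the sets in the family, and the last one is disjoint from \<open>F\<close>.\<close>

lemma stable_prefix:
  assumes G: "\<G> \<subseteq> nsets {1..n} k" "intersecting \<G>"
    and stable: "\<And>i j G. i \<in> {1..n} \<Longrightarrow> j \<in> {1..n} \<Longrightarrow> i < j \<Longrightarrow> G \<in> \<G> \<Longrightarrow> shift_set i j G \<in> \<G>"
    and F: "F \<in> \<G>"
  shows "\<exists>t. t < 2 * card (F \<inter> {1..t})"
proof (rule ccontr)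
  assume "\<not> ?thesis"
  then have half: "2 * card (F \<inter> {1..t}) \<le> t" for t by (simp add: not_less)
  have "\<exists>T. T \<subseteq> {1..t} - F \<and> card T = card (F \<inter> {1..t}) \<and> (F - {1..t}) \<union> T \<in> \<G>" if "t \<le> n" for t
    using that
  proof (induction t)
    case 0
    then show ?case using F by auto
  next
    case (Suc t)
    then obtain T where T: "T \<subseteq> {1..t} - F" "card T = card (F \<inter> {1..t})" "(F - {1..t}) \<union> T \<in> \<G>" by auto
    have fT: "finite T" using T(1) finite_subset by blast
    show ?case
    proof (cases "Suc t \<in> F")
      case False
      then have "F \<inter> {1..Suc t} = F \<inter> {1..t}" "F - {1..Suc t} = F - {1..t}"
        by (auto simp: atLeastAtMostSuc_conv)
      then show ?thesis using T by (intro exI[of _ T]) auto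
    next
      case True
      have e: "F \<inter> {1..Suc t} = insert (Suc t) (F \<inter> {1..t})" using True by (auto simp: atLeastAtMostSuc_conv)
      then have c: "card (F \<inter> {1..Suc t}) = Suc (card (F \<inter> {1..t}))" by simp
      have "card ({1..t} - F) + card (F \<inter> {1..t}) = t"
        using card_Diff_subset_Int[of "{1..t}" F] card_mono[of "{1..t}" "F \<inter> {1..t}"]
        by (simp add: Int_commute)
      then have "card T < card ({1..t} - F)" using half[of "Suc t"] c T(2) by linarith
      then obtain i where i: "i \<in> {1..t} - F" "i \<notin> T"
        by (metis fT card_mono finite_atLeastAtMost finite_Diff not_le subsetI)
      have "shift_set i (Suc t) ((F - {1..t}) \<union> T) \<in> \<G>"
        using i Suc.prems T(3) by (intro stable) auto
      moreover have "shift_set i (Suc t) ((F - {1..t}) \<union> T) = (F - {1..Suc t}) \<union> insert i T"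
        using i True T(1) unfolding shift_set_def by auto
      ultimately show ?thesis
        using i T c fT by (intro exI[of _ "insert i T"]) auto
    qed
  qed
  from this[of n] obtain T where T: "T \<subseteq> {1..n} - F" "(F - {1..n}) \<union> T \<in> \<G>" by auto
  have "F \<subseteq> {1..n}" using F G(1) by (auto simp: nsets_def)
  then have "T \<in> \<G>" using T(2) by (metis Diff_eq_empty_iff Un_empty_left)
  then show False using T(1) F G(2) unfolding intersecting_def by blast
qed

text \<open>By \<open>stable_prefix\<close> a member without 1 has, for some \<open>j \<ge> 2\<close>, at least \<open>j\<close> points among \<open>2, ..., 2 j - 1\<close>.\<close>

lemma stable_card_bound:
  assumes G: "\<G> \<subseteq> nsets {1..n} k" "intersecting \<G>"
    and stable: "\<And>i j G. i \<in> {1..n} \<Longrightarrow> j \<in> {1..n} \<Longrightarrow> i < j \<Longrightarrow> G \<in> \<G> \<Longrightarrow> shift_set i j G \<in> \<G>"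
    and kn: "2 * k \<le> n"
  shows "card \<G> \<le> degree \<G> {1} + (\<Sum>j = 2..k. ((2 * j - 2) choose j) * ((n - j) choose (k - j)))"
proof -
  have fin: "finite \<G>" using finite_uniform[OF G(1)] .
  let ?W = "\<lambda>j. \<Union>T\<in>nsets {2..2 * j - 1} j. {F \<in> nsets {1..n} k. T \<subseteq> F \<and> F \<inter> {} = {}}"
  have "away 1 \<G> \<subseteq> (\<Union>j\<in>{2..k}. ?W j)"
  proof
    fix F assume "F \<in> away 1 \<G>"
    then have F: "F \<in> \<G>" "1 \<notin> F" by (auto simp: away_def)
    have Fk: "F \<subseteq> {1..n}" "card F = k" "finite F" using F G(1) by (auto simp: nsets_def)
    obtain t where t: "t < 2 * card (F \<inter> {1..t})" using stable_prefix[OF G stable F(1)] by blast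
    define j where "j = card (F \<inter> {1..t})"
    have F2: "F \<inter> {1..t} \<subseteq> {2..2 * j - 1}"
    proof
      fix x assume x: "x \<in> F \<inter> {1..t}"
      then have "x \<noteq> 1" using F(2) by blast
      then show "x \<in> {2..2 * j - 1}" using x t unfolding j_def by auto
    qed
    have "card (F \<inter> {1..t}) \<le> card {2..2 * j - 1}" by (rule card_mono[OF _ F2]) simp
    then have j2: "2 \<le> j" using t unfolding j_def[symmetric] by simp
    have jk: "j \<le> k" using Fk card_mono[of F "F \<inter> {1..t}"] unfolding j_def by simp
    have "F \<inter> {1..t} \<in> nsets {2..2 * j - 1} j" using F2 j_def by (auto simp: nsets_def)
    moreover have "F \<in> {F \<in> nsets {1..n} k. F \<inter> {1..t} \<subseteq> F \<and> F \<inter> {} = {}}" using F G(1) by blast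
    ultimately have "F \<in> ?W j" using F G(1) by blast
    moreover have "j \<in> {2..k}" using j2 jk by simp
    ultimately show "F \<in> (\<Union>j\<in>{2..k}. ?W j)" by (rule UN_I[rotated])
  qed
  moreover have finW: "finite (?W j)" for j
    by (rule finite_UN_I) (simp_all add: finite_nsets)
  ultimately have "card (away 1 \<G>) \<le> card (\<Union>j\<in>{2..k}. ?W j)" by (intro card_mono) auto
  also have "\<dots> \<le> (\<Sum>j = 2..k. card (?W j))" by (rule card_UN_le) simp
  also have "\<dots> \<le> (\<Sum>j = 2..k. ((2 * j - 2) choose j) * ((n - j) choose (k - j)))"
  proof (rule sum_mono)
    fix j assume j: "j \<in> {2..k}"
    have "card (?W j) \<le> (\<Sum>T\<in>nsets {2..2 * j - 1} j. card {F \<in> nsets {1..n} k. T \<subseteq> F \<and> F \<inter> {} = {}})"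
      by (rule card_UN_le) (simp add: finite_nsets)
    also have "\<dots> = (\<Sum>T\<in>nsets {2..2 * j - 1} j. (n - j) choose (k - j))"
    proof (rule sum.cong[OF refl])
      fix T assume "T \<in> nsets {2..2 * j - 1} j"
      then have T: "T \<subseteq> {2..2 * j - 1}" "card T = j" by (auto simp: nsets_def)
      then have "T \<subseteq> {1..n}" using j kn by fastforce
      then show "card {F \<in> nsets {1..n} k. T \<subseteq> F \<and> F \<inter> {} = {}} = (n - j) choose (k - j)"
        using card_nsets_between[of "{1..n}" T "{}" k] T(2) j by simp
    qed
    also have "\<dots> = ((2 * j - 2) choose j) * ((n - j) choose (k - j))"
      using j by (simp add: card_nsets)
    finally show "card (?W j) \<le> ((2 * j - 2) choose j) * ((n - j) choose (k - j))" .
  qed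
  finally show ?thesis using card_split_degree[OF fin, of 1] by linarith
qed



section \<open>Estimates of binomial coefficients\<close>

abbreviation rc :: "nat \<Rightarrow> nat \<Rightarrow> real" where
  "rc a q \<equiv> real (a choose q)"

lemma rc_Suc_bot: "rc a (Suc q) * real (Suc q) = rc a q * (real a - real q)"
  using gchoose_Suc_real[of "real a" q] by (simp add: binomial_gbinomial field_simps)

lemma rc_ratio_lower:
  assumes "0 \<le> \<rho>" "\<And>i. i < q \<Longrightarrow> \<rho> * (real b - real i) \<le> real a - real i" "q \<le> Suc b"
  shows "\<rho> ^ q * rc b q \<le> rc a q"
  using assms(2,3)
proof (induction q)
  case (Suc q)
  have "\<rho> ^ Suc q * rc b (Suc q) * real (Suc q) = \<rho> ^ q * rc b q * (\<rho> * (real b - real q))"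
    using rc_Suc_bot[of b q] by (simp add: mult.assoc mult.left_commute)
  also have "\<dots> \<le> rc a q * (real a - real q)"
    using Suc assms(1) by (intro mult_mono) auto
  also have "\<dots> = rc a (Suc q) * real (Suc q)" using rc_Suc_bot[of a q] by simp
  finally show ?case by (simp add: mult_le_cancel_right)
qed simp

lemma rc_ratio_upper:
  assumes "0 \<le> \<tau>" "\<And>i. i < q \<Longrightarrow> real a - real i \<le> \<tau> * (real b - real i)" "q \<le> Suc a"
  shows "rc a q \<le> \<tau> ^ q * rc b q"
  using assms(2,3)
proof (induction q)
  case (Suc q)
  have "rc a (Suc q) * real (Suc q) = rc a q * (real a - real q)" using rc_Suc_bot[of a q] by simp
  also have "\<dots> \<le> (\<tau> ^ q * rc b q) * (\<tau> * (real b - real q))"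
    using Suc assms(1) by (intro mult_mono) auto
  also have "\<dots> = \<tau> ^ Suc q * rc b (Suc q) * real (Suc q)"
    using rc_Suc_bot[of b q] by (simp add: mult.assoc mult.left_commute)
  finally show ?case by (simp add: mult_le_cancel_right)
qed simp

lemma rc_grow_top:
  assumes "1 \<le> \<sigma>" "q \<le> a" "\<sigma> * (real a + real j - real q) \<le> real a + real j"
  shows "\<sigma> ^ j * rc a q \<le> rc (a + j) q"
  using assms(3)
proof (induction j)
  case (Suc j)
  have pos: "0 < real (Suc (a + j)) - real q" using assms(2) by simp
  have less: "\<sigma> * (real a + real j - real q) \<le> real a + real j"
    using Suc.prems assms(1) by (simp add: algebra_simps)
  have "real (Suc (a + j) - q) * rc (Suc (a + j)) q = real (Suc (a + j)) * rc (a + j) q"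
    using binomial_absorb_comp[of "Suc (a + j)" q] by (metis diff_Suc_1 of_nat_mult)
  then have e: "(real (Suc (a + j)) - real q) * rc (Suc (a + j)) q = real (Suc (a + j)) * rc (a + j) q"
    using assms(2) by (simp add: of_nat_diff)
  have "(real (Suc (a + j)) - real q) * (\<sigma> * rc (a + j) q) \<le> real (Suc (a + j)) * rc (a + j) q"
    using mult_right_mono[OF Suc.prems, of "rc (a + j) q"] by (simp add: algebra_simps)
  then have "\<sigma> * rc (a + j) q \<le> rc (Suc (a + j)) q"
    using e pos by (metis mult_le_cancel_left_pos)
  moreover have "\<sigma> * (\<sigma> ^ j * rc a q) \<le> \<sigma> * rc (a + j) q"
    using Suc.IH[OF less] assms(1) by (intro mult_left_mono) auto
  ultimately show ?case by (simp add: mult.assoc)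
qed simp

lemma rc_pred_pred:
  assumes "1 \<le> q" "1 \<le> a"
  shows "real a * rc (a - 1) (q - 1) = real q * rc a q"
proof -
  obtain b p where ab: "a = Suc b" "q = Suc p" using assms by (cases a; cases q) auto
  have "real (Suc b * (b choose p)) = real (Suc p * (Suc b choose Suc p))"
    by (simp only: Suc_times_binomial)
  then show ?thesis unfolding ab by (simp only: of_nat_mult diff_Suc_1)
qed

lemma rc_drop_top:
  assumes "1 \<le> a" "q \<le> a"
  shows "(real a - real q) * rc a q = real a * rc (a - 1) q"
proof -
  have "real ((a - q) * (a choose q)) = real (a * ((a - 1) choose q))"
    by (simp only: binomial_absorb_comp)
  then show ?thesis using assms(2) by (simp add: of_nat_diff)
qed

text \<open>Each step multiplies by a quotient \<open>(k - i) / (n - i)\<close>, and these quotients decrease in \<open>i\<close>.\<close>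

lemma rc_descend:
  assumes "s \<le> t" "t \<le> k" "k \<le> n" "0 \<le> \<gamma>" "real k - real s \<le> \<gamma> * (real n - real s)"
  shows "rc (n - t) (k - t) \<le> \<gamma> ^ (t - s) * rc (n - s) (k - s)"
  using assms(1,2)
proof (induction t rule: dec_induct)
  case (step t)
  show ?case
  proof (cases "n = t")
    case True
    then show ?thesis using step.prems assms(3) by simp
  next
    case False
    have lt: "t < k" "t < n" using step.prems assms(3) by auto
    have "real (n - t) * rc (n - Suc t) (k - Suc t) = real (k - t) * rc (n - t) (k - t)"
      using rc_pred_pred[of "k - t" "n - t"] lt by simp
    moreover have "real (k - t) \<le> \<gamma> * real (n - t)"
    proof (cases "\<gamma> \<le> 1")
      case True
      have "\<gamma> * (real t - real s) \<le> 1 * (real t - real s)" using True step.hyps by (intro mult_right_mono) auto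
      then show ?thesis using assms(5) lt by (simp add: of_nat_diff algebra_simps)
    next
      case False
      then have "1 * real (n - t) \<le> \<gamma> * real (n - t)" by (intro mult_right_mono) auto
      then show ?thesis using assms(3) by linarith
    qed
    ultimately have "real (n - t) * rc (n - Suc t) (k - Suc t) \<le> (\<gamma> * real (n - t)) * rc (n - t) (k - t)"
      by (simp add: mult_right_mono)
    then have "rc (n - Suc t) (k - Suc t) \<le> \<gamma> * rc (n - t) (k - t)"
      using lt by (simp add: mult.assoc mult.left_commute)
    also have "\<dots> \<le> \<gamma> * (\<gamma> ^ (t - s) * rc (n - s) (k - s))"
      using step assms(4) by (intro mult_left_mono) auto
    finally show ?thesis using step.hyps by (simp add: Suc_diff_le)
  qed
qed simp

lemma rc_pascal: "1 \<le> a \<Longrightarrow> 1 \<le> q \<Longrightarrow> rc a q = rc (a - 1) q + rc (a - 1) (q - 1)"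
  using choose_pascal_pred[of a q] by simp

text \<open>A second difference of \<open>C(a, q + 2)\<close> is a sum of \<open>J k\<close> binomials with lower index \<open>q\<close> and upper index at least \<open>a\<close>.\<close>

lemma choose_second_difference:
  "((a + k) choose Suc (Suc q)) + ((a + J) choose Suc (Suc q)) + J * k * (a choose q)
    \<le> ((a + J + k) choose Suc (Suc q)) + (a choose Suc (Suc q))"
proof -
  have first: "(b choose Suc q) + t * (b choose q) \<le> (b + t) choose Suc q" for b t
  proof (induction t)
    case (Suc t)
    have "b choose q \<le> (b + t) choose q" by (intro choose_mono_left) simp
    then show ?case using Suc by simp
  qed simp
  show ?thesis
  proof (induction J)
    case (Suc J)
    have "k * (a choose q) \<le> k * ((a + J) choose q)" by (intro mult_left_mono choose_mono_left) auto
    then have "((a + J) choose Suc q) + k * (a choose q) \<le> (a + J + k) choose Suc q"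
      using first[of "a + J" k] by linarith
    then show ?case using Suc by (simp add: add.commute add.left_commute distrib_right)
  qed simp
qed

lemma choose_ge_between:
  assumes "i \<le> l" "i + l \<le> (x :: nat)"
  shows "x choose i \<le> x choose l"
proof (cases "2 * l \<le> x")
  case True
  then show ?thesis using binomial_mono[OF assms(1), of x] by simp
next
  case False
  have "l \<le> x \<Longrightarrow> x choose l = x choose (x - l)" by (rule binomial_symmetric)
  moreover have "i \<le> x - l" "2 * (x - l) \<le> x" "l \<le> x" using False assms by auto
  ultimately show ?thesis using binomial_mono[of i "x - l" x] by simp
qed

section \<open>Families at least as large as the extremal one\<close>

lemma prod_gchoose:
  fixes x :: real
  assumes "a \<le> b"
  shows "(x gchoose a) * (\<Prod>q = a..<b. (x - real q) / real (Suc q)) = (x gchoose b)"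
  using assms
proof (induction b rule: dec_induct)
  case (step b)
  then show ?case using gchoose_Suc_real[of x b] by (simp add: mult.assoc[symmetric])
qed simp

locale large_family =
  fixes n k :: nat and \<F> :: "nat set set"
  assumes k100: "100 \<le> k" and n_gt: "2 * k < n"
    and unif_F: "\<F> \<subseteq> nsets {1..n} k" and int_F: "intersecting \<F>"
    and large: "card (C3 n k) \<le> card \<F>"
begin

definition "m = n - 1"

lemma m_ge: "2 * k \<le> m" and n_eq: "n = Suc m"
  using n_gt unfolding m_def by auto

abbreviation "N \<equiv> rc m (k - 1)"
abbreviation "c0 \<equiv> rc (m - k) (k - 1)"
text \<open>The number of \<open>(k - 1)\<close>-sets lost to a copy of \<open>T2\<close>; the full star has \<open>N\<close> members, and a single set forbids \<open>c0\<close>.\<close>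

definition "d = 3 * c0 - rc (m - k - 1) (k - 1) - rc (m - 2 * k + 1) (k - 1)"

lemma card_C3_real: "real (card (C3 n k)) = N - d + 3"
proof -
  have "real (card (C3 n k) + 3 * ((n - 1 - k) choose (k - 1))) =
    real (((n - 1) choose (k - 1)) + ((n - 1 - k - 1) choose (k - 1)) + ((n - 1 - 2 * k + 1) choose (k - 1)) + 3)"
    using card_C3[of k n] k100 n_gt by simp
  then show ?thesis unfolding d_def m_def by simp
qed

lemma c0_pos: "0 < c0"
  using m_ge k100 by simp

lemma c0_le_N:
  assumes "0 \<le> \<tau>" "real m - real k \<le> \<tau> * real m" "\<tau> \<le> 1"
  shows "c0 \<le> \<tau> ^ (k - 1) * N"
proof (rule rc_ratio_upper[OF assms(1)])
  fix i assume "i < k - 1"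
  have "\<tau> * real i \<le> real i" using assms by (simp add: mult_left_le_one_le)
  then show "real (m - k) - real i \<le> \<tau> * (real m - real i)"
    using assms(2) m_ge by (simp add: of_nat_diff algebra_simps)
qed (use m_ge in simp)

lemma d_le3: "d \<le> 3 * c0"
  unfolding d_def by simp

lemma d_le: "d \<le> (2 + real (k - 1) / real (m - k)) * c0"
proof -
  have "rc (m - k) (k - 1) = rc (m - k - 1) (k - 1) + rc (m - k - 1) (k - 1 - 1)"
    using m_ge k100 by (intro rc_pascal) auto
  moreover have "real (m - k) * rc (m - k - 1) (k - 1 - 1) = real (k - 1) * c0"
    using m_ge k100 by (intro rc_pred_pred) auto
  then have "rc (m - k - 1) (k - 1 - 1) = real (k - 1) / real (m - k) * c0"
    using m_ge k100 by (simp add: field_simps)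
  ultimately show ?thesis unfolding d_def by (simp add: distrib_right)
qed

text \<open>How far the degree falls short of a full star.  This bounds the number of lost sets from above.\<close>

definition "deficit \<G> v = N - real (degree \<G> {v})"

lemma cross_real:
  fixes x :: real
  assumes "\<G> \<subseteq> nsets {1..n} k" "intersecting \<G>" "v \<in> {1..n}"
    and "real (m - k) \<le> x" "deficit \<G> v \<le> (x gchoose (k - 1))"
  shows "real (card (away v \<G>)) \<le> deficit \<G> v * (\<Prod>q = k - 1..<m - k. (x - real q) / real (Suc q))"
proof (rule cross_intersecting_bound)
  have "real (degree \<G> {v} + card (lost n k v \<G>)) \<le> real ((n - 1) choose (k - 1))"
    using degree_plus_lost[OF assms(1-3)] k100 by linarith
  then show "real (card (lost n k v \<G>)) \<le> deficit \<G> v" unfolding deficit_def m_def by simp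
  show "away v \<G> \<subseteq> nsets ({1..n} - {v}) k" using assms(1) unfolding away_def nsets_def by blast
  show "card ({1..n} - {v}) = m" using assms(3) m_def by simp
qed (use assms m_ge k100 in auto)

lemma cross_nat:
  assumes "\<G> \<subseteq> nsets {1..n} k" "intersecting \<G>" "v \<in> {1..n}"
    and "m - k \<le> x" "deficit \<G> v \<le> rc x (k - 1)"
  shows "real (card (away v \<G>)) * rc x (k - 1) \<le> deficit \<G> v * rc x (m - k)"
    and "real (card (away v \<G>)) \<le> rc x (m - k)"
proof -
  let ?P = "\<Prod>q = k - 1..<m - k. (real x - real q) / real (Suc q)"
  have g: "(real x gchoose q) = rc x q" for q by (simp add: binomial_gbinomial)
  have P: "rc x (k - 1) * ?P = rc x (m - k)"
    using prod_gchoose[of "k - 1" "m - k" "real x"] m_ge g by simp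
  have P0: "0 \<le> ?P" using assms(4) by (intro prod_nonneg) auto
  have b: "real (card (away v \<G>)) \<le> deficit \<G> v * ?P"
    using cross_real[OF assms(1-3), of "real x"] assms(4,5) g by simp
  then have "real (card (away v \<G>)) * rc x (k - 1) \<le> deficit \<G> v * ?P * rc x (k - 1)"
    by (rule mult_right_mono) simp
  also have "\<dots> = deficit \<G> v * rc x (m - k)" using P by (simp add: mult.assoc mult.commute)
  finally show "real (card (away v \<G>)) * rc x (k - 1) \<le> deficit \<G> v * rc x (m - k)" .
  have "deficit \<G> v * ?P \<le> rc x (k - 1) * ?P" by (rule mult_right_mono[OF assms(5) P0])
  then show "real (card (away v \<G>)) \<le> rc x (m - k)" using b P by linarith
qed

lemma fin_F: "finite \<F>" by (rule finite_uniform[OF unif_F])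

lemma card_F_eq: "real (card \<F>) = N - deficit \<F> v + real (card (away v \<F>))"
  using card_split_degree[OF fin_F, of v] unfolding deficit_def by simp

text \<open>This is the inequality \<open>h - |B| \<le> d\<close> that lets bounds on the deficit improve themselves.\<close>

lemma deficit_le: "deficit \<F> v \<le> d + real (card (away v \<F>))"
  using card_F_eq[of v] card_C3_real large by (simp add: of_nat_mono)

text \<open>The quotient \<open>C(x, m - k) / C(x, k - 1)\<close> at \<open>x = m - k + j\<close>.  Since \<open>C(x, m - k) = C(x, j)\<close>, one compares \<open>C(x, j)\<close> with
\<open>C(x, j + r)\<close> explicitly and uses that \<open>C(x, j + r) \<le> C(x, k - 1)\<close> because \<open>k - 1\<close> is closer to the middle.\<close>

lemma contraction_factor_le:
  assumes "j + r < k" "r \<le> m - 2 * k + 1" "1 \<le> r"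
  shows "rc (m - k + j) (m - k) * (\<Prod>i<r. real (m - k) - real i) \<le> (\<Prod>i<r. real (j + i + 1)) * rc (m - k + j) (k - 1)"
proof -
  let ?x = "m - k + j"
  have sym: "?x choose (m - k) = ?x choose j" using binomial_symmetric[of "m - k" ?x] by simp
  have up: "rc ?x j * (\<Prod>i<r. real (m - k) - real i) = (\<Prod>i<r. real (j + i + 1)) * rc ?x (j + r)" for r
  proof (induction r)
    case (Suc r)
    have "rc ?x (Suc (j + r)) * real (Suc (j + r)) = rc ?x (j + r) * (real (m - k) - real r)"
      using rc_Suc_bot[of ?x "j + r"] by simp
    then have s: "rc ?x (j + r) * (real (m - k) - real r) = real (j + r + 1) * rc ?x (j + Suc r)" by (simp add: mult.commute)
    have "rc ?x j * (\<Prod>i<Suc r. real (m - k) - real i)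
        = rc ?x j * (\<Prod>i<r. real (m - k) - real i) * (real (m - k) - real r)"
      by (simp only: prod.lessThan_Suc mult.assoc)
    also have "\<dots> = (\<Prod>i<r. real (j + i + 1)) * (rc ?x (j + r) * (real (m - k) - real r))"
      by (simp only: Suc.IH mult.assoc)
    also have "\<dots> = (\<Prod>i<Suc r. real (j + i + 1)) * rc ?x (j + Suc r)"
      unfolding s by (simp only: prod.lessThan_Suc mult.assoc)
    finally show ?case .
  qed simp
  have "?x choose (j + r) \<le> ?x choose (k - 1)"
    using assms m_ge by (intro choose_ge_between) auto
  then have "(\<Prod>i<r. real (j + i + 1)) * rc ?x (j + r) \<le> (\<Prod>i<r. real (j + i + 1)) * rc ?x (k - 1)"
    by (intro mult_left_mono prod_nonneg) auto
  then show ?thesis using up[of r] sym by simp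
qed

lemma contraction:
  assumes "v \<in> {1..n}" "j + r < k" "r \<le> m - 2 * k + 1" "1 \<le> r" "deficit \<F> v \<le> rc (m - k + j) (k - 1)"
  shows "real (card (away v \<F>)) * (\<Prod>i<r. real (m - k) - real i) \<le> deficit \<F> v * (\<Prod>i<r. real (j + i + 1))"
proof -
  let ?x = "m - k + j" and ?A = "\<Prod>i<r. real (m - k) - real i" and ?B = "\<Prod>i<r. real (j + i + 1)"
  have pos: "0 < rc ?x (k - 1)" using assms(2) m_ge by simp
  have dn: "0 \<le> deficit \<F> v"
    using degree_plus_lost[OF unif_F int_F assms(1)] k100 unfolding deficit_def m_def by simp
  have An: "0 \<le> ?A" using assms(2,3) m_ge by (intro prod_nonneg) auto
  have b: "real (card (away v \<F>)) * rc ?x (k - 1) \<le> deficit \<F> v * rc ?x (m - k)"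
    using cross_nat(1)[OF unif_F int_F assms(1) _ assms(5)] by simp
  have r: "rc ?x (m - k) * ?A \<le> ?B * rc ?x (k - 1)"
    by (rule contraction_factor_le[OF assms(2-4)])
  have "real (card (away v \<F>)) * ?A * rc ?x (k - 1) \<le> deficit \<F> v * rc ?x (m - k) * ?A"
    using mult_right_mono[OF b An] by (simp add: mult_ac)
  also have "\<dots> \<le> deficit \<F> v * (?B * rc ?x (k - 1))"
    using mult_left_mono[OF r dn] by (simp add: mult_ac)
  finally have "(real (card (away v \<F>)) * ?A) * rc ?x (k - 1) \<le> (deficit \<F> v * ?B) * rc ?x (k - 1)"
    by (simp add: mult_ac)
  then show ?thesis using pos by (simp only: mult_le_cancel_right_pos)
qed

lemma contraction_one_step:
  assumes "v \<in> {1..n}" "j + 1 < k" "deficit \<F> v \<le> rc (m - k + j) (k - 1)"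
  shows "real (card (away v \<F>)) * real (m - k) \<le> deficit \<F> v * real (j + 1)"
  using contraction[of v j 1] assms by simp

lemma deficit_nonneg: "v \<in> {1..n} \<Longrightarrow> 0 \<le> deficit \<F> v"
  using degree_plus_lost[OF unif_F int_F, of v] k100 unfolding deficit_def m_def by simp

text \<open>Up to smaller terms, \<open>N - d\<close> counts the \<open>(k - 1)\<close>-sets that meet two disjoint blocks of sizes \<open>k\<close> and \<open>k - 1\<close>, a second
difference of \<open>C(a, k - 1)\<close>.\<close>

lemma card_C3_ge_product: "real k * real (k - 1) * rc (n - 2 * k) (k - 3) \<le> N - d"
proof -
  obtain l where k: "k = l + 3" using k100 le_iff_add[of 3 k] by (auto simp: add.commute)
  define a where "a = n - 2 * k"
  have a: "m = a + (k - 1) + k" "m - k = a + (k - 1)" "m - 2 * k + 1 = a"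
    using n_gt k100 unfolding a_def m_def by auto
  have "((a + k) choose (k - 1)) + ((a + (k - 1)) choose (k - 1)) + (k - 1) * k * (a choose (k - 3))
    \<le> ((a + (k - 1) + k) choose (k - 1)) + (a choose (k - 1))"
    using choose_second_difference[of a k l "k - 1"] k by simp
  then have 1: "rc (a + k) (k - 1) + c0 + real (k - 1) * real k * rc a (k - 3) \<le> N + rc (m - 2 * k + 1) (k - 1)"
    using m_ge unfolding a(3) a(2)[symmetric]
    by (simp only: of_nat_add[symmetric] of_nat_mult[symmetric] of_nat_le_iff) simp
  have "a + k = Suc (m - k)" using a k by simp
  moreover have "k - 1 = Suc (l + 1)" "k - 2 = l + 1" using k by auto
  ultimately have "rc (a + k) (k - 1) = c0 + rc (m - k) (k - 2)" by simp
  moreover have "c0 = rc (m - k - 1) (k - 1) + rc (m - k - 1) (k - 2)"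
    using rc_pascal[of "m - k" "k - 1"] m_ge k100 by (simp add: numeral_2_eq_2)
  moreover have "rc (m - k - 1) (k - 2) \<le> rc (m - k) (k - 2)"
    by (simp add: choose_mono_left)
  ultimately show ?thesis using 1 unfolding d_def a_def[symmetric] by (simp add: mult.commute)
qed

text \<open>The bound on the number of members avoiding a vertex that all ranges of \<open>n\<close> aim at.\<close>

definition "slack_real = rc (m - k - 3) (k - 4)"

lemma slack_real_eq: "slack_real * (real (m - k) * real (m - k - 1) * real (m - k - 2)) = real (k - 1) * real (k - 2) * real (k - 3) * c0"
proof -
  have 1: "real (m - k) * rc (m - k - 1) (k - 2) = real (k - 1) * c0"
    using rc_pred_pred[of "k - 1" "m - k"] m_ge k100 by (simp add: numeral_2_eq_2)
  have 2: "real (m - k - 1) * rc (m - k - 2) (k - 3) = real (k - 2) * rc (m - k - 1) (k - 2)"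
    using rc_pred_pred[of "k - 2" "m - k - 1"] m_ge k100 by (simp add: numeral_2_eq_2 numeral_3_eq_3)
  have 3: "real (m - k - 2) * slack_real = real (k - 3) * rc (m - k - 2) (k - 3)" unfolding slack_real_def
    using rc_pred_pred[of "k - 3" "m - k - 2"] m_ge k100 by (simp add: numeral_eq_Suc)
  have "slack_real * (real (m - k) * real (m - k - 1) * real (m - k - 2))
      = real (m - k) * real (m - k - 1) * (real (m - k - 2) * slack_real)" by (simp only: mult_ac)
  also have "\<dots> = real (k - 3) * real (m - k) * (real (m - k - 1) * rc (m - k - 2) (k - 3))"
    unfolding 3 by (simp only: mult_ac)
  also have "\<dots> = real (k - 3) * real (k - 2) * (real (m - k) * rc (m - k - 1) (k - 2))"
    unfolding 2 by (simp only: mult_ac)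
  also have "\<dots> = real (k - 1) * real (k - 2) * real (k - 3) * c0"
    unfolding 1 by (simp only: mult_ac)
  finally show ?thesis .
qed

end



section \<open>Ground sets of medium length\<close>

lemma central_choose_le: "rc (2 * i + 2) (i + 2) \<le> 4 ^ i"
proof (induction i)
  case (Suc i)
  let ?a = "(2 * i + 2) choose (i + 2)" and ?b = "(2 * i + 3) choose (i + 2)" and ?c = "(2 * i + 4) choose (i + 3)"
  have e: "Suc (i + 2) = i + 3" "Suc (2 * i + 3) = 2 * i + 4" "2 * i + 3 - (i + 2) = i + 1" "2 * i + 3 - 1 = 2 * i + 2"
    by auto
  have "(i + 3) * ?c = (2 * i + 4) * ?b" using Suc_times_binomial[of "i + 2" "2 * i + 3"] unfolding e .
  then have 1: "real (i + 3) * real ?c = real (2 * i + 4) * real ?b" by (metis of_nat_mult)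
  have "(i + 1) * ?b = (2 * i + 3) * ?a" using binomial_absorb_comp[of "2 * i + 3" "i + 2"] unfolding e .
  then have 2: "real (i + 1) * real ?b = real (2 * i + 3) * real ?a" by (metis of_nat_mult)
  have "(real (i + 3) * real (i + 1)) * real ?c = real (i + 1) * (real (i + 3) * real ?c)" by (simp only: mult_ac)
  also have "\<dots> = real (2 * i + 4) * (real (i + 1) * real ?b)" unfolding 1 by (simp only: mult_ac)
  also have "\<dots> = (real (2 * i + 4) * real (2 * i + 3)) * real ?a" unfolding 2 by (simp only: mult.assoc)
  also have "\<dots> \<le> (4 * (real (i + 3) * real (i + 1))) * 4 ^ i"
  proof (rule mult_mono)
    show "real (2 * i + 4) * real (2 * i + 3) \<le> 4 * (real (i + 3) * real (i + 1))" by (simp add: algebra_simps)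
    show "real ?a \<le> 4 ^ i" using Suc by simp
  qed auto
  also have "\<dots> = (real (i + 3) * real (i + 1)) * 4 ^ Suc i" by simp
  finally have "real ?c \<le> 4 ^ Suc i" by (subst (asm) mult_le_cancel_left_pos) auto
  moreover have "2 * Suc i + 2 = 2 * i + 4" "Suc i + 2 = i + 3" by auto
  ultimately show ?case by metis
qed simp

lemma geometric_two_thirds: "2 \<le> k \<Longrightarrow> (\<Sum>j = 2..k. (2 / 3 :: real) ^ (j - 2)) = 3 - 3 * (2 / 3) ^ (k - 1)"
proof (induction k rule: dec_induct)
  case (step k)
  have "(2 / 3 :: real) ^ (Suc k - 1) = 2 / 3 * (2 / 3) ^ (k - 1)" "(2 / 3 :: real) ^ (Suc k - 2) = (2 / 3) ^ (k - 1)"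
    using step.hyps by (cases k; simp add: numeral_2_eq_2)+
  then show ?case using step by (simp add: sum.cl_ivl_Suc)
qed simp

text \<open>The two factors are at most \<open>4 ^ (j - 2)\<close> and \<open>(1 / 6) ^ (j - 2) C(n - 2, k - 2)\<close>, so the sum is dominated by a geometric series
with quotient \<open>2 / 3\<close>.\<close>

lemma prefix_sum_bound:
  assumes "2 \<le> k" "6 * k \<le> n"
  shows "(\<Sum>j = 2..k. rc (2 * j - 2) j * rc (n - j) (k - j)) \<le> 3 * rc (n - 2) (k - 2)"
proof -
  have "(\<Sum>j = 2..k. rc (2 * j - 2) j * rc (n - j) (k - j)) \<le> (\<Sum>j = 2..k. (2 / 3) ^ (j - 2) * rc (n - 2) (k - 2))"
  proof (rule sum_mono)
    fix j assume j: "j \<in> {2..k}"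
    then obtain i where i: "j = i + 2" using le_iff_add[of 2 j] by (auto simp: add.commute)
    have "rc (2 * j - 2) j \<le> 4 ^ i" using central_choose_le[of i] i by simp
    moreover have "rc (n - j) (k - j) \<le> (1 / 6) ^ (j - 2) * rc (n - 2) (k - 2)"
      using j assms by (intro rc_descend) auto
    ultimately have "rc (2 * j - 2) j * rc (n - j) (k - j) \<le> 4 ^ i * ((1 / 6) ^ i * rc (n - 2) (k - 2))"
      using i by (intro mult_mono) auto
    also have "\<dots> = (4 * (1 / 6)) ^ i * rc (n - 2) (k - 2)" by (simp only: power_mult_distrib mult.assoc)
    finally show "rc (2 * j - 2) j * rc (n - j) (k - j) \<le> (2 / 3) ^ (j - 2) * rc (n - 2) (k - 2)" using i by simp
  qed
  also have "\<dots> = (3 - 3 * (2 / 3) ^ (k - 1)) * rc (n - 2) (k - 2)"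
    using geometric_two_thirds[OF assms(1)] by (simp only: sum_distrib_right[symmetric])
  also have "\<dots> \<le> 3 * rc (n - 2) (k - 2)" by (intro mult_right_mono) auto
  finally show ?thesis .
qed

text \<open>Bernoulli's inequality applied to blocks of \<open>L\<close> factors.  It replaces exponential estimates where a plain
application of Bernoulli's inequality would become negative.\<close>

lemma power_ge_chunk:
  fixes \<rho> :: real
  assumes "0 \<le> \<rho>" "\<rho> \<le> 1" "e \<le> c * L" "1 - \<rho> \<le> \<eta>" "real L * \<eta> \<le> \<beta>" "\<beta> \<le> 1"
  shows "(1 - \<beta>) ^ c \<le> \<rho> ^ e"
proof -
  have "1 - \<beta> \<le> 1 + real L * (\<rho> - 1)"
    using mult_left_mono[OF assms(4), of "real L"] assms(5) by (simp add: algebra_simps)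
  also have "\<dots> \<le> (1 + (\<rho> - 1)) ^ L" using assms(1) by (intro Bernoulli_inequality) simp
  finally have "(1 - \<beta>) ^ c \<le> (\<rho> ^ L) ^ c" using assms(6) by (intro power_mono) auto
  also have "\<dots> = \<rho> ^ (c * L)" by (simp add: power_mult[symmetric] mult.commute)
  also have "\<dots> \<le> \<rho> ^ e" by (rule power_decreasing[OF assms(3,1,2)])
  finally show ?thesis .
qed

lemma exp_minus_le: "0 \<le> y \<Longrightarrow> 0 < c \<Longrightarrow> exp (- y) \<le> 1 / (1 + y / real c) ^ c"
proof -
  assume y: "0 \<le> y" and c: "0 < c"
  have pos: "0 < (1 + y / real c) ^ c" using y by (intro zero_less_power add_pos_nonneg) auto
  have "(1 + y / real c) ^ c \<le> exp (y / real c) ^ c" using y by (intro power_mono) auto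
  also have "\<dots> = exp y" using c by (simp add: exp_of_nat_mult[symmetric])
  finally have "1 / exp y \<le> 1 / (1 + y / real c) ^ c" by (rule divide_left_mono) (auto intro: mult_pos_pos pos)
  then show "exp (- y) \<le> 1 / (1 + y / real c) ^ c" by (simp add: exp_minus inverse_eq_divide)
qed

lemma cubic_lower:
  fixes y :: real assumes "1 / 10 \<le> y" "y \<le> 1 / 2" shows "8 / 100 \<le> y * (1 - y)\<^sup>2"
proof -
  have "0 \<le> (10 * y - 1) * (100 * y\<^sup>2 - 190 * y + 81)"
  proof (rule mult_nonneg_nonneg)
    have "45\<^sup>2 \<le> (95 - 100 * y)\<^sup>2" using assms by (intro power_mono) auto
    then show "0 \<le> 100 * y\<^sup>2 - 190 * y + 81" by (simp add: power2_eq_square algebra_simps)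
  qed (use assms in simp)
  moreover have "(10 * y - 1) * (100 * y\<^sup>2 - 190 * y + 81) = 1000 * (y * (1 - y)\<^sup>2) - 81"
    by (simp add: power2_eq_square algebra_simps)
  ultimately show ?thesis by simp
qed

lemma real_div_le: "real (a div c) \<le> real a / real c"
  by (rule of_nat_div_le_of_nat)

lemma chunk_numerics1:
  fixes u k n :: real
  assumes "100 * k \<le> u" "100 \<le> k" "4 / 3 * u \<le> n"
  shows "(2 * u + 5 * k - 12) / 8 \<le> 1 / 5 * (n - k + 1)"
  using assms by (simp add: field_simps)

lemma chunk_numerics2:
  fixes u k n :: real
  assumes "100 * k \<le> u" "100 \<le> k" "u \<le> n"
  shows "(2 * u + 5 * k - 12) / 8 \<le> 26 / 100 * (n - k + 1)"
  using assms by (simp add: field_simps)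

lemma chunk_numerics3:
  fixes u k n :: real
  assumes "100 * k \<le> u" "100 \<le> k" "u \<le> 2 * n + 2"
  shows "(u - 2 * k + 1) / 4 \<le> 51 / 100 * (n - k + 1)"
  using assms by (simp add: field_simps)

context large_family
begin

abbreviation "N' \<equiv> rc (m - 1) (k - 2)"

lemma N'_pos: "0 < N'" using m_ge k100 by simp

lemma N'_eq: "real m * N' = real (k - 1) * N"
  using rc_pred_pred[of "k - 1" m] m_ge k100 by (simp add: numeral_2_eq_2)

lemma star_ladder: "N \<le> rc (m - t) (k - 1) + real t * N'" if "t \<le> k"
  using that
proof (induction t)
  case (Suc t)
  have "rc (m - t) (k - 1) = rc (m - t - 1) (k - 1) + rc (m - t - 1) (k - 1 - 1)"
    using Suc.prems m_ge k100 by (intro rc_pascal) auto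
  moreover have "rc (m - t - 1) (k - 1 - 1) \<le> N'" using choose_mono_left[of "m - t - 1" "m - 1" "k - 2"]
    by (simp add: numeral_2_eq_2)
  ultimately show ?case using Suc by (simp add: distrib_right)
qed simp

text \<open>Here and below \<open>N'\<close> is \<open>C(n - 2, k - 2)\<close>, the trivial bound for the degree of a pair.\<close>

lemma away_le_N':
  assumes "\<G> \<subseteq> nsets {1..n} k" "intersecting \<G>" "v \<in> {1..n}" "deficit \<G> v \<le> rc (m - 2) (k - 1)"
  shows "real (card (away v \<G>)) \<le> N'"
proof -
  have "real (card (away v \<G>)) \<le> rc (m - 2) (m - k)"
    by (rule cross_nat(2)[OF assms(1-3) _ assms(4)]) (use k100 m_ge in simp)
  also have "(m - 2) choose (m - k) = (m - 2) choose (k - 2)"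
  proof -
    have "m - 2 - (m - k) = k - 2" using m_ge k100 by arith
    then show ?thesis using binomial_symmetric[of "m - k" "m - 2"] k100 by simp
  qed
  also have "real \<dots> \<le> N'" by (simp add: choose_mono_left)
  finally show ?thesis .
qed

text \<open>The gap comes from \<open>away_le_N'\<close>: a vertex with deficit at most \<open>C(m - 2, k - 1)\<close> is avoided by at most \<open>N'\<close> members, so its
degree exceeds \<open>4 N'\<close>, while any other vertex has degree at most \<open>2 N'\<close>.  If all vertices were of the second kind, then
\<open>exists_stable_family\<close> would give a stable family of the same size with the same property, which by
\<open>stable_card_bound\<close> has at most \<open>2 N' + 3 N'\<close> members.\<close>

theorem exists_heavy_vertex:
  assumes n6: "6 * k \<le> n" and big: "5 * N' < real (card \<F>)"
  shows "\<exists>v\<in>{1..n}. deficit \<F> v \<le> rc (m - 2) (k - 1)"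
proof (rule ccontr)
  assume "\<not> ?thesis"
  then have light: "\<And>v. v \<in> {1..n} \<Longrightarrow> rc (m - 2) (k - 1) < deficit \<F> v" by (meson not_le)
  define d2 where "d2 = 2 * ((m - 1) choose (k - 2))"
  have d2: "real d2 = 2 * N'" unfolding d2_def by simp
  have lad: "N \<le> rc (m - 2) (k - 1) + 2 * N'" using star_ladder[of 2] k100 by simp
  have deg: "degree \<F> {x} \<le> d2" if "x \<in> {1..n}" for x
  proof -
    have "real (degree \<F> {x}) \<le> real d2" using light[OF that] lad unfolding deficit_def d2 by linarith
    then show ?thesis by simp
  qed
  have gap: "degree \<G> {x} \<le> d2"
    if G: "\<G> \<subseteq> nsets {1..n} k" "intersecting \<G>" "card \<G> = card \<F>" "x \<in> {1..n}" "degree \<G> {x} \<le> 2 * d2" for \<G> x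
  proof (rule ccontr)
    assume "\<not> degree \<G> {x} \<le> d2"
    then have "real d2 < real (degree \<G> {x})" by simp
    then have "deficit \<G> x \<le> rc (m - 2) (k - 1)" using lad unfolding deficit_def d2 by linarith
    then have "real (card (away x \<G>)) \<le> N'" by (rule away_le_N'[OF G(1,2,4)])
    moreover have "real (card \<G>) = real (degree \<G> {x}) + real (card (away x \<G>))"
      using card_split_degree[OF finite_uniform[OF G(1)], of x] by simp
    moreover have "real (degree \<G> {x}) \<le> 2 * real d2" using G(5) by (metis of_nat_le_iff of_nat_mult of_nat_numeral)
    ultimately show False using big G(3) unfolding d2 by simp
  qed
  obtain \<G> where G: "\<G> \<subseteq> nsets {1..n} k" "intersecting \<G>" "card \<G> = card \<F>" "\<forall>x\<in>{1..n}. degree \<G> {x} \<le> d2"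
    and st: "\<forall>i\<in>{1..n}. \<forall>j\<in>{1..n}. \<forall>G\<in>\<G>. i < j \<longrightarrow> shift_set i j G \<in> \<G>"
    using exists_stable_family[OF unif_F int_F deg gap] by blast
  have "card \<G> \<le> degree \<G> {1} + (\<Sum>j = 2..k. ((2 * j - 2) choose j) * ((n - j) choose (k - j)))"
    by (rule stable_card_bound[OF G(1,2)]) (use st n6 in auto)
  then have "real (card \<G>) \<le> real (degree \<G> {1} + (\<Sum>j = 2..k. ((2 * j - 2) choose j) * ((n - j) choose (k - j))))"
    by (simp only: of_nat_le_iff)
  also have "\<dots> = real (degree \<G> {1}) + (\<Sum>j = 2..k. rc (2 * j - 2) j * rc (n - j) (k - j))" by simp
  also have "\<dots> \<le> 2 * N' + 3 * rc (n - 2) (k - 2)"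
  proof (rule add_mono)
    have "degree \<G> {1} \<le> d2" using G(4) n6 k100 by auto
    then have "real (degree \<G> {1}) \<le> real d2" by (simp only: of_nat_le_iff)
    then show "real (degree \<G> {1}) \<le> 2 * N'" using d2 by simp
    show "(\<Sum>j = 2..k. rc (2 * j - 2) j * rc (n - j) (k - j)) \<le> 3 * rc (n - 2) (k - 2)"
      using n6 k100 by (intro prefix_sum_bound) auto
  qed
  also have "n - 2 = m - 1" using m_def by simp
  finally show False using big G(3) by simp
qed

text \<open>All quotients \<open>(n - 2 k - i) / (n - 3 - i)\<close> are at least the one at the end of the range.\<close>

lemma choose_spread_lower:
  assumes "0 \<le> 1 - (2 * real k - 3) / (real n - real k + 1)"
  shows "(1 - (2 * real k - 3) / (real n - real k + 1)) ^ (k - 3) * rc (n - 3) (k - 3) \<le> rc (n - 2 * k) (k - 3)"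
proof (rule rc_ratio_lower[OF assms])
  fix i assume i: "i < k - 3"
  have den: "0 < real n - real k + 1" using n_gt by simp
  have n3: "3 \<le> n" "2 * k \<le> n" using n_gt k100 by auto
  have "real n - real k + 1 \<le> real n - 3 - real i" using i k100 by (simp add: of_nat_diff)
  then have "(2 * real k - 3) / (real n - real k + 1) * (real n - real k + 1) \<le> (2 * real k - 3) / (real n - real k + 1) * (real n - 3 - real i)"
    using den k100 by (intro mult_left_mono) auto
  then have "2 * real k - 3 \<le> (2 * real k - 3) / (real n - real k + 1) * (real n - 3 - real i)" using den by simp
  then show "(1 - (2 * real k - 3) / (real n - real k + 1)) * (real (n - 3) - real i) \<le> real (n - 2 * k) - real i"
    using n3 by (simp add: of_nat_diff left_diff_distrib)
qed (use n_gt in simp)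

lemma slack_real_lower:
  assumes "0 \<le> 1 - (real k - 1) / (real m - real k + 1)"
  shows "(1 - (real k - 1) / (real m - real k + 1)) ^ (k - 4) * rc (m - 4) (k - 4) \<le> slack_real"
  unfolding slack_real_def
proof (rule rc_ratio_lower[OF assms])
  fix i assume i: "i < k - 4"
  have den: "0 < real m - real k + 1" using m_ge by simp
  have "real m - real k + 1 \<le> real m - 4 - real i" using i k100 by (simp add: of_nat_diff)
  then have "(real k - 1) / (real m - real k + 1) * (real m - real k + 1) \<le> (real k - 1) / (real m - real k + 1) * (real m - 4 - real i)"
    using den k100 by (intro mult_left_mono) auto
  then have "real k - 1 \<le> (real k - 1) / (real m - real k + 1) * (real m - 4 - real i)" using den by simp
  moreover have "real (m - 4) = real m - 4" "real (m - k - 3) = real m - real k - 3"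
    using m_ge k100 by (auto simp: of_nat_diff)
  ultimately show "(1 - (real k - 1) / (real m - real k + 1)) * (real (m - 4) - real i) \<le> real (m - k - 3) - real i"
    by (simp add: left_diff_distrib)
qed (use m_ge k100 in simp)

text \<open>With \<open>y = k\<^sup>2 / n\<close>, \<open>card_C3_ge_product\<close> makes \<open>(N - d) / N'\<close> at least about \<open>k y exp (-2 y)\<close>.  This exceeds 6 for
\<open>k \<ge> 100\<close> and \<open>1 / 10 \<le> y \<le> 1\<close>; the exponential is replaced by Bernoulli bounds with 2 or 8 blocks, depending on \<open>y\<close>.\<close>

lemma N_minus_d_sparse:
  assumes "k\<^sup>2 \<le> n" "n \<le> 10 * k\<^sup>2"
  shows "6 * N' \<le> N - d"
proof -
  define \<rho> where "\<rho> = 1 - (2 * real k - 3) / (real n - real k + 1)"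
  have K: "100 \<le> real k" using k100 by simp
  have KK: "100 * real k \<le> (real k)\<^sup>2" using K by (simp add: power2_eq_square)
  have nn: "(real k)\<^sup>2 \<le> real n" "real n \<le> 10 * (real k)\<^sup>2"
  proof -
    have "real (k\<^sup>2) \<le> real n" using assms(1) by (simp only: of_nat_le_iff)
    then show "(real k)\<^sup>2 \<le> real n" by simp
    have "real n \<le> real (10 * k\<^sup>2)" using assms(2) by (simp only: of_nat_le_iff)
    then show "real n \<le> 10 * (real k)\<^sup>2" by simp
  qed
  have den: "0 < real n - real k + 1" using nn KK K by linarith
  have \<rho>: "0 \<le> \<rho>" "\<rho> \<le> 1"
  proof -
    have "2 * real k - 3 \<le> real n - real k + 1" using nn KK K by linarith
    then show "0 \<le> \<rho>" unfolding \<rho>_def using den by simp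
    show "\<rho> \<le> 1" unfolding \<rho>_def using den K by simp
  qed
  have A: "\<rho> ^ (k - 3) * rc (n - 3) (k - 3) \<le> rc (n - 2 * k) (k - 3)"
    unfolding \<rho>_def by (rule choose_spread_lower) (use \<rho>(1) \<rho>_def in simp)
  have B: "(real n - 2) * rc (n - 3) (k - 3) = (real k - 2) * N'"
    using rc_pred_pred[of "k - 2" "n - 2"] n_gt k100 by (simp add: m_def of_nat_diff numeral_3_eq_3 numeral_2_eq_2)
  define y where "y = (real k)\<^sup>2 / real n"
  have n0: "0 < real n" using n_gt by simp
  have y: "1 / 10 \<le> y" "y \<le> 1" unfolding y_def using nn n0 by (auto simp: field_simps)
  have "6 \<le> (real k - 3) * y * \<rho> ^ (k - 3)"
  proof -
    have \<eta>: "1 - \<rho> \<le> (2 * real k - 3) / (real n - real k + 1)" unfolding \<rho>_def by simp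
    consider "1 / 10 \<le> y" "y \<le> 1 / 2" | "1 / 2 \<le> y" "y \<le> 3 / 4" | "3 / 4 \<le> y" "y \<le> 1" using y by linarith
    then have "6 / 97 \<le> y * \<rho> ^ (k - 3)"
    proof cases
      case 1
      have n2: "2 * (real k)\<^sup>2 \<le> real n" using 1 n0 unfolding y_def by (simp add: field_simps)
      have "(1 - y) ^ 2 \<le> \<rho> ^ (k - 3)"
      proof (rule power_ge_chunk[OF \<rho> _ \<eta>, of _ _ "(k - 2) div 2"])
        show "k - 3 \<le> 2 * ((k - 2) div 2)" by simp
        have "real ((k - 2) div 2) \<le> (real k - 2) / 2" using real_div_le[of "k - 2" 2] k100 by simp
        then have "real ((k - 2) div 2) * (2 * real k - 3) \<le> (real k - 2) / 2 * (2 * real k - 3)"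
          using K by (intro mult_right_mono) auto
        also have "\<dots> = (real k)\<^sup>2 - 7 / 2 * real k + 3" by (simp add: power2_eq_square field_simps)
        also have "\<dots> \<le> y * (real n - real k + 1)"
        proof -
          have "y * (real n - real k + 1) = y * real n - y * (real k - 1)" by (simp add: algebra_simps)
          also have "y * real n = (real k)\<^sup>2" unfolding y_def using n0 by simp
          finally have e: "y * (real n - real k + 1) = (real k)\<^sup>2 - y * (real k - 1)" .
          define w where "w = y * (real k - 1)"
          have "w \<le> 1 * (real k - 1)" unfolding w_def using y K by (intro mult_right_mono) auto
          then have "w \<le> 7 / 2 * real k - 3" using K by simp
          then show ?thesis unfolding e w_def[symmetric] by simp
        qed
        finally show "real ((k - 2) div 2) * ((2 * real k - 3) / (real n - real k + 1)) \<le> y"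
          using den by (simp add: pos_divide_le_eq)
      qed (use y in simp)
      then have "y * (1 - y)\<^sup>2 \<le> y * \<rho> ^ (k - 3)" using y by (intro mult_left_mono) auto
      then show ?thesis using cubic_lower[OF 1] by linarith
    next
      case 2
      have n2: "4 / 3 * (real k)\<^sup>2 \<le> real n" using 2 n0 unfolding y_def by (simp add: field_simps)
      have "(1 - 1 / 5) ^ 8 \<le> \<rho> ^ (k - 3)"
      proof (rule power_ge_chunk[OF \<rho> _ \<eta>, of _ _ "(k + 4) div 8"])
        show "k - 3 \<le> 8 * ((k + 4) div 8)" by simp
        have "real ((k + 4) div 8) \<le> (real k + 4) / 8" using real_div_le[of "k + 4" 8] by simp
        then have "real ((k + 4) div 8) * (2 * real k - 3) \<le> (real k + 4) / 8 * (2 * real k - 3)"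
          using K by (intro mult_right_mono) auto
        also have "\<dots> = (2 * (real k)\<^sup>2 + 5 * real k - 12) / 8" by (simp add: power2_eq_square field_simps)
        also have "\<dots> \<le> 1 / 5 * (real n - real k + 1)" by (rule chunk_numerics1[OF KK K n2])
        finally show "real ((k + 4) div 8) * ((2 * real k - 3) / (real n - real k + 1)) \<le> 1 / 5"
          using den by (simp add: pos_divide_le_eq)
      qed simp
      then have "1 / 2 * (1 - 1 / 5) ^ 8 \<le> y * \<rho> ^ (k - 3)" using 2 by (intro mult_mono) auto
      then show ?thesis by (simp add: power_divide)
    next
      case 3
      have "(1 - 26 / 100) ^ 8 \<le> \<rho> ^ (k - 3)"
      proof (rule power_ge_chunk[OF \<rho> _ \<eta>, of _ _ "(k + 4) div 8"])
        show "k - 3 \<le> 8 * ((k + 4) div 8)" by simp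
        have "real ((k + 4) div 8) \<le> (real k + 4) / 8" using real_div_le[of "k + 4" 8] by simp
        then have "real ((k + 4) div 8) * (2 * real k - 3) \<le> (real k + 4) / 8 * (2 * real k - 3)"
          using K by (intro mult_right_mono) auto
        also have "\<dots> = (2 * (real k)\<^sup>2 + 5 * real k - 12) / 8" by (simp add: power2_eq_square field_simps)
        also have "\<dots> \<le> 26 / 100 * (real n - real k + 1)" by (rule chunk_numerics2[OF KK K nn(1)])
        finally show "real ((k + 4) div 8) * ((2 * real k - 3) / (real n - real k + 1)) \<le> 26 / 100"
          using den by (simp add: pos_divide_le_eq)
      qed simp
      then have "3 / 4 * (1 - 26 / 100) ^ 8 \<le> y * \<rho> ^ (k - 3)" using 3 by (intro mult_mono) auto
      then show ?thesis by (simp add: power_divide)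
    qed
    then have "97 * (6 / 97) \<le> (real k - 3) * (y * \<rho> ^ (k - 3))" using K by (intro mult_mono) auto
    then show ?thesis by (simp add: mult.assoc)
  qed
  then have "6 * N' \<le> (real k - 3) * y * \<rho> ^ (k - 3) * N'" by (intro mult_right_mono) auto
  also have "\<dots> \<le> real k * (real k - 1) * (\<rho> ^ (k - 3) * rc (n - 3) (k - 3))"
  proof -
    have r: "rc (n - 3) (k - 3) = (real k - 2) / (real n - 2) * N'"
      using B n_gt k100 by (simp add: field_simps)
    have "(real k - 3) * y \<le> real k * (real k - 1) * ((real k - 2) / (real n - 2))"
    proof -
      have "(real k - 3) * (real k)\<^sup>2 \<le> real k * (real k - 1) * (real k - 2)"
        using K by (simp add: power2_eq_square algebra_simps)
      then have "(real k - 3) * (real k)\<^sup>2 / real n \<le> real k * (real k - 1) * (real k - 2) / real n"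
        using n0 by (intro divide_right_mono) auto
      also have "\<dots> \<le> real k * (real k - 1) * (real k - 2) / (real n - 2)"
        using K n_gt k100 by (intro divide_left_mono mult_nonneg_nonneg mult_pos_pos) auto
      finally show ?thesis unfolding y_def by simp
    qed
    then have "(real k - 3) * y * (\<rho> ^ (k - 3) * N') \<le> real k * (real k - 1) * ((real k - 2) / (real n - 2)) * (\<rho> ^ (k - 3) * N')"
      using \<rho> by (intro mult_right_mono) auto
    then show ?thesis unfolding r by (simp only: mult_ac)
  qed
  also have "\<dots> \<le> real k * (real k - 1) * rc (n - 2 * k) (k - 3)"
    using A K by (intro mult_left_mono) auto
  also have "\<dots> \<le> N - d" using card_C3_ge_product k100 by (simp add: of_nat_diff)
  finally show ?thesis .
qed

lemma c0_le_exp: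
  assumes "y * real m \<le> real k * (real k - 1)"
  shows "c0 \<le> exp (- y) * N"
proof -
  have m0: "0 < real m" using m_ge k100 by simp
  have "c0 \<le> (1 - real k / real m) ^ (k - 1) * N"
    using m0 m_ge by (intro c0_le_N) (auto simp: field_simps)
  also have "\<dots> \<le> exp (- (real k / real m)) ^ (k - 1) * N"
  proof (intro mult_right_mono power_mono)
    show "1 - real k / real m \<le> exp (- (real k / real m))"
      using exp_ge_add_one_self[of "- (real k / real m)"] by simp
    show "0 \<le> 1 - real k / real m" using m0 m_ge by simp
  qed simp
  also have "exp (- (real k / real m)) ^ (k - 1) = exp (- (real (k - 1) * (real k / real m)))"
    by (simp add: exp_of_nat_mult[symmetric])
  also have "\<dots> * N \<le> exp (- y) * N"
  proof (rule mult_right_mono)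
    have "y \<le> real (k - 1) * (real k / real m)" using assms m0 k100 by (simp add: field_simps of_nat_diff)
    then show "exp (- (real (k - 1) * (real k / real m))) \<le> exp (- y)" by simp
  qed simp
  finally show ?thesis .
qed

text \<open>The loss \<open>d\<close> is at most \<open>(2 + (k - 1) / (m - k)) c0\<close>, and \<open>c0 / N\<close> is at most \<open>exp (- k (k - 1) / m)\<close>, while \<open>N' / N = (k - 1) / m\<close>.  For
\<open>m \<ge> 25 k\<close> the exponent is only known to be at least about 1, but \<open>N'\<close> is tiny; for smaller \<open>m\<close> the exponent
is at least about 4.\<close>

lemma N_minus_d_dense:
  assumes "n < k\<^sup>2" "6 * k \<le> n"
  shows "5 * N' \<le> N - d" "k\<^sup>2 \<le> 2 * n \<Longrightarrow> 6 * N' \<le> N - d"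
proof -
  have K: "100 \<le> real k" using k100 by simp
  have KK: "100 * real k \<le> (real k)\<^sup>2" using K by (simp add: power2_eq_square)
  have m0: "0 < real m" using m_ge k100 by simp
  have mm: "real m \<le> (real k)\<^sup>2 - 2" "6 * real k - 1 \<le> real m"
  proof -
    have "m + 2 \<le> k\<^sup>2" using assms(1) n_eq by simp
    then have "real (m + 2) \<le> real (k\<^sup>2)" by (simp only: of_nat_le_iff)
    then show "real m \<le> (real k)\<^sup>2 - 2" by simp
    show "6 * real k - 1 \<le> real m" using assms(2) n_eq by simp
  qed
  have mk: "real (m - k) = real m - real k" "real (k - 1) = real k - 1" using m_ge k100 by (auto simp: of_nat_diff)
  have N'N: "real m * N' = (real k - 1) * N" using N'_eq mk by simp
  have Nn: "0 \<le> N" by simp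
  have N'_le: "N' \<le> g * N" if "real k - 1 \<le> g * real m" for g
  proof -
    have "real m * N' \<le> (g * real m) * N" unfolding N'N using that by (intro mult_right_mono) auto
    then have "real m * N' \<le> real m * (g * N)" by (simp only: mult_ac)
    then show ?thesis using m0 by (simp only: mult_le_cancel_left_pos)
  qed
  have d_le_g: "d \<le> (2 + g) * c0" if "real k - 1 \<le> g * (real m - real k)" for g
  proof -
    have "real (k - 1) / real (m - k) \<le> g" using that mm K mk by (simp add: field_simps)
    then have "(2 + real (k - 1) / real (m - k)) * c0 \<le> (2 + g) * c0" by (intro mult_right_mono) auto
    then show ?thesis using d_le by linarith
  qed
  have wide: "d \<le> (79 / 100) * N" if w: "25 * real k \<le> real m"
  proof -
    have "c0 \<le> exp (- (99 / 100)) * N"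
    proof (rule c0_le_exp)
      have "(99 / 100) * real m \<le> (99 / 100) * (real k)\<^sup>2" using mm by linarith
      then show "(99 / 100) * real m \<le> real k * (real k - 1)" using KK by (simp add: power2_eq_square algebra_simps)
    qed
    also have "\<dots> \<le> (383 / 1000) * N"
    proof (rule mult_right_mono)
      have "exp (- (99 / 100)) \<le> 1 / (1 + (99 / 100) / real 16) ^ (16 :: nat)" by (rule exp_minus_le) auto
      also have "\<dots> \<le> ((383 / 1000) :: real)" by (simp add: power_divide)
      finally show "exp (- (99 / 100)) \<le> ((383 / 1000) :: real)" .
    qed simp
    finally have c: "c0 \<le> (383 / 1000) * N" .
    have "d \<le> (2 + 1 / 24) * c0" using w K by (intro d_le_g) simp
    then show ?thesis using c Nn by simp
  qed
  show "5 * N' \<le> N - d"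
  proof (cases "25 * real k \<le> real m")
    case True
    have "N' \<le> (1 / 25) * N" using True by (intro N'_le) simp
    then show ?thesis using wide[OF True] Nn by simp
  next
    case False
    have "c0 \<le> exp (- (396 / 100)) * N"
    proof (rule c0_le_exp)
      have "(396 / 100) * real m \<le> (396 / 100) * (25 * real k)" using False by simp
      then show "(396 / 100) * real m \<le> real k * (real k - 1)" using KK by (simp add: power2_eq_square algebra_simps)
    qed
    also have "\<dots> \<le> (64 / 1000) * N"
    proof (rule mult_right_mono)
      have "exp (- (396 / 100)) \<le> 1 / (1 + (396 / 100) / real 4) ^ (4 :: nat)" by (rule exp_minus_le) auto
      also have "\<dots> \<le> ((64 / 1000) :: real)" by (simp add: power_divide)
      finally show "exp (- (396 / 100)) \<le> ((64 / 1000) :: real)" .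
    qed simp
    finally have c: "c0 \<le> (64 / 1000) * N" .
    have "d \<le> (2 + 1 / 5) * c0" using mm K by (intro d_le_g) simp
    moreover have "N' \<le> (1 / 6) * N" using mm by (intro N'_le) simp
    ultimately show ?thesis using c Nn by simp
  qed
  assume "k\<^sup>2 \<le> 2 * n"
  then have "real (k\<^sup>2) \<le> real (2 * n)" by (simp only: of_nat_le_iff)
  then have "(real k)\<^sup>2 \<le> 2 * real m + 2" using n_eq by simp
  then have w: "40 * real k \<le> real m" using KK K by linarith
  have "N' \<le> (1 / 40) * N" using w by (intro N'_le) simp
  then show "6 * N' \<le> N - d" using wide w K Nn by simp
qed

text \<open>A heavy vertex exists because \<open>|F| > 6 N'\<close>.  Its deficit is at most \<open>C(m - 5, k - 1)\<close>, since otherwise its degree would be below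
\<open>5 N'\<close>.  Hence at most \<open>C(m - 5, k - 5)\<close> members avoid it.  Compared with \<open>C(m - 4, k - 4)\<close>, this is smaller by
the factor \<open>(k - 4) / (m - 4)\<close>, whereas the slack is smaller only by a constant factor.\<close>

theorem regime_middle_sparse:
  assumes "k\<^sup>2 \<le> 2 * n" "n \<le> 10 * k\<^sup>2"
  shows "\<exists>v\<in>{1..n}. real (card (away v \<F>)) \<le> slack_real"
proof -
  have K: "100 \<le> real k" using k100 by simp
  have KK: "100 * real k \<le> (real k)\<^sup>2" using K by (simp add: power2_eq_square)
  have "100 * k \<le> k\<^sup>2" using k100 by (simp add: power2_eq_square)
  then have n6: "6 * k \<le> n" using assms(1) by linarith
  have six: "6 * N' \<le> N - d"
    using N_minus_d_sparse[OF _ assms(2)] N_minus_d_dense(2)[OF _ n6 assms(1)] by (meson not_le)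
  have big: "6 * N' + 3 \<le> real (card \<F>)" using six card_C3_real large by linarith
  then obtain v where v: "v \<in> {1..n}" "deficit \<F> v \<le> rc (m - 2) (k - 1)"
    using exists_heavy_vertex[OF n6] N'_pos by auto
  have bN: "real (card (away v \<F>)) \<le> N'" by (rule away_le_N'[OF unif_F int_F v])
  have D5: "deficit \<F> v \<le> rc (m - 5) (k - 1)"
    using star_ladder[of 5] k100 card_F_eq[of v] bN big by simp
  have "real (card (away v \<F>)) \<le> rc (m - 5) (m - k)"
    by (rule cross_nat(2)[OF unif_F int_F v(1) _ D5]) (use k100 m_ge in simp)
  also have "(m - 5) choose (m - k) = (m - 5) choose (k - 5)"
  proof -
    have "m - 5 - (m - k) = k - 5" using m_ge k100 by arith
    then show ?thesis using binomial_symmetric[of "m - k" "m - 5"] k100 by simp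
  qed
  also have "rc (m - 5) (k - 5) \<le> slack_real"
  proof -
    have "real (k\<^sup>2) \<le> real (2 * n)" using assms(1) by (simp only: of_nat_le_iff)
    then have mm: "(real k)\<^sup>2 \<le> 2 * real m + 2" using n_eq by simp
    define \<rho> where "\<rho> = 1 - (real k - 1) / (real m - real k + 1)"
    have den: "0 < real m - real k + 1" using mm KK K by linarith
    have \<rho>: "0 \<le> \<rho>" "\<rho> \<le> 1"
    proof -
      have "real k - 1 \<le> real m - real k + 1" using mm KK K by linarith
      then show "0 \<le> \<rho>" unfolding \<rho>_def using den by simp
      show "\<rho> \<le> 1" unfolding \<rho>_def using den K by simp
    qed
    have A: "\<rho> ^ (k - 4) * rc (m - 4) (k - 4) \<le> slack_real"
      unfolding \<rho>_def by (rule slack_real_lower) (use \<rho>(1) \<rho>_def in simp)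
    have "(1 - 51 / 100) ^ 4 \<le> \<rho> ^ (k - 4)"
    proof (rule power_ge_chunk[OF \<rho>, of _ _ "(k - 1) div 4" "(real k - 1) / (real m - real k + 1)"])
      show "k - 4 \<le> 4 * ((k - 1) div 4)" by simp
      show "1 - \<rho> \<le> (real k - 1) / (real m - real k + 1)" unfolding \<rho>_def by simp
      have "real ((k - 1) div 4) \<le> (real k - 1) / 4" using real_div_le[of "k - 1" 4] k100 by simp
      then have "real ((k - 1) div 4) * (real k - 1) \<le> (real k - 1) / 4 * (real k - 1)"
        using K by (intro mult_right_mono) auto
      also have "\<dots> = ((real k)\<^sup>2 - 2 * real k + 1) / 4" by (simp add: power2_eq_square field_simps)
      also have "\<dots> \<le> 51 / 100 * (real m - real k + 1)" by (rule chunk_numerics3[OF KK K mm])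
      finally show "real ((k - 1) div 4) * ((real k - 1) / (real m - real k + 1)) \<le> 51 / 100"
        using den by (simp add: pos_divide_le_eq)
    qed simp
    then have p: "5 / 100 \<le> \<rho> ^ (k - 4)" by (simp add: power_divide)
    have "(real m - 4) * rc (m - 5) (k - 5) = (real k - 4) * rc (m - 4) (k - 4)"
      using rc_pred_pred[of "k - 4" "m - 4"] m_ge k100 by (simp add: of_nat_diff)
    also have "\<dots> \<le> (5 / 100 * (real m - 4)) * rc (m - 4) (k - 4)"
      using mm KK K by (intro mult_right_mono) auto
    finally have "(real m - 4) * rc (m - 5) (k - 5) \<le> (real m - 4) * (5 / 100 * rc (m - 4) (k - 4))"
      by (simp only: mult_ac)
    then have "rc (m - 5) (k - 5) \<le> 5 / 100 * rc (m - 4) (k - 4)"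
      using mm KK K by (subst (asm) mult_le_cancel_left_pos) auto
    also have "\<dots> \<le> \<rho> ^ (k - 4) * rc (m - 4) (k - 4)" using p by (intro mult_right_mono) auto
    finally show ?thesis using A by linarith
  qed
  finally show ?thesis using v(1) by blast
qed

lemma power_six_fifths_le_power_four: "25 \<le> s \<Longrightarrow> (6 / 5 :: real) ^ (3 * s + 3) \<le> 4 ^ (s - 4)"
proof (induction s rule: dec_induct)
  case base
  show ?case by (simp add: power_divide)
next
  case (step s)
  have "(6 / 5 :: real) ^ (3 * Suc s + 3) = (6 / 5) ^ 3 * (6 / 5) ^ (3 * s + 3)"
    by (simp only: power_add[symmetric]) simp
  also have "\<dots> \<le> 4 * 4 ^ (s - 4)" by (intro mult_mono step.IH) (auto simp: power_divide)
  also have "4 * 4 ^ (s - 4) = (4 :: real) ^ (Suc s - 4)"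
  proof -
    have e: "Suc s - 4 = Suc (s - 4)" using step.hyps by arith
    show ?thesis unfolding e by simp
  qed
  finally show ?case .
qed

text \<open>One bootstrap step from \<open>C(m - 2, k - 1)\<close> already pushes the deficit below \<open>11 / 4 c0\<close>, hence below \<open>C(m - s, k - 1)\<close> with \<open>s\<close>
about \<open>k / 4\<close>.  So at most \<open>C(m - s, k - s)\<close> members avoid the vertex, exponentially fewer than the slack.\<close>

theorem regime_middle_dense:
  assumes "2 * n < k\<^sup>2" "6 * k \<le> n"
  shows "\<exists>v\<in>{1..n}. real (card (away v \<F>)) \<le> slack_real"
proof -
  have K: "100 \<le> real k" using k100 by simp
  have KK: "100 * real k \<le> (real k)\<^sup>2" using K by (simp add: power2_eq_square)
  have "n < k\<^sup>2" using assms(1) by linarith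
  then have "5 * N' + 3 \<le> real (card \<F>)"
    using N_minus_d_dense(1)[OF _ assms(2)] card_C3_real large by linarith
  then obtain v where v: "v \<in> {1..n}" "deficit \<F> v \<le> rc (m - 2) (k - 1)"
    using exists_heavy_vertex[OF assms(2)] by auto
  define D where "D = deficit \<F> v"
  define b where "b = real (card (away v \<F>))"
  define M where "M = real (m - k)"
  have D0: "0 \<le> D" unfolding D_def by (rule deficit_nonneg[OF v(1)])
  have c00: "0 < c0" by (rule c0_pos)
  have "real (2 * n) \<le> real (k\<^sup>2)" using assms(1) by (simp only: of_nat_le_iff)
  then have mm: "2 * real m + 2 \<le> (real k)\<^sup>2" "6 * real k - 1 \<le> real m" "M = real m - real k"
    using n_eq assms(2) m_ge unfolding M_def by (auto simp: of_nat_diff)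
  have M5: "5 * (real k - 1) \<le> M" "0 < M" using mm K by auto
  have D275: "D \<le> (11 / 4) * c0"
  proof -
    have e: "m - 2 = m - k + (k - 2)" "real (k - 2 + 1) = real k - 1" "k - 2 + 1 < k" using m_ge k100 by auto
    have "b * M \<le> D * (real k - 1)"
      using contraction_one_step[OF v(1) e(3) v(2)[unfolded e(1)]] unfolding e(2) b_def D_def M_def .
    also have "\<dots> \<le> D * (M / 5)" using M5 D0 by (intro mult_left_mono) auto
    finally have "b * M \<le> (D / 5) * M" by simp
    then have b5: "b \<le> D / 5" using M5(2) by (simp only: mult_le_cancel_right_pos)
    have "real (k - 1) / real (m - k) \<le> 1 / 5" using M5 k100 unfolding M_def by (simp add: field_simps of_nat_diff)
    then have "(2 + real (k - 1) / real (m - k)) * c0 \<le> (2 + 1 / 5) * c0" by (intro mult_right_mono) auto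
    then have "d \<le> (2 + 1 / 5) * c0" using d_le by (rule order_trans[rotated])
    then have "d \<le> (11 / 5) * c0" by simp
    then show ?thesis using deficit_le[of v] b5 unfolding D_def b_def by simp
  qed
  define s where "s = k div 4"
  define j where "j = k - s"
  have s: "real k - 3 \<le> 4 * real s" "4 * real s \<le> real k" "25 \<le> s" using k100 unfolding s_def by auto
  have j: "3 * s \<le> j" "j \<le> 3 * s + 3" "real j = real k - real s" "m - k + j = m - s"
    using k100 m_ge unfolding j_def s_def by auto
  have "D \<le> rc (m - k + j) (k - 1)"
  proof -
    have "(1 + 2 / real k) ^ j * c0 \<le> rc (m - k + j) (k - 1)"
    proof (rule rc_grow_top)
      have "real (m - k) + real j - real (k - 1) \<le> real k * (real k - 1) / 2"
        using mm j(3) s K k100 unfolding M_def[symmetric] by (simp add: power2_eq_square of_nat_diff algebra_simps)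
      then have "2 / real k * (real (m - k) + real j - real (k - 1)) \<le> 2 / real k * (real k * (real k - 1) / 2)"
        using K by (intro mult_left_mono) auto
      also have "\<dots> = real k - 1" using K by simp
      finally have "2 / real k * (real (m - k) + real j - real (k - 1)) \<le> real k - 1" .
      moreover have "(1 + 2 / real k) * (real (m - k) + real j - real (k - 1))
        = (real (m - k) + real j - real (k - 1)) + 2 / real k * (real (m - k) + real j - real (k - 1))"
        by (simp only: distrib_right mult_1)
      moreover have "real (k - 1) = real k - 1" using k100 by simp
      ultimately show "(1 + 2 / real k) * (real (m - k) + real j - real (k - 1)) \<le> real (m - k) + real j"
        by linarith
    qed (use m_ge in auto)
    moreover have "(11 / 4) \<le> (1 + 2 / real k) ^ j"
    proof -
      have "(1485 / 1000) \<le> 1 + real s * (2 / real k)" using s K by (simp add: field_simps)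
      also have "\<dots> \<le> (1 + 2 / real k) ^ s" by (intro Bernoulli_inequality) (use K in \<open>simp add: field_simps\<close>)
      finally have "(1485 / 1000) ^ 3 \<le> ((1 + 2 / real k) ^ s) ^ 3" by (intro power_mono) auto
      also have "\<dots> = (1 + 2 / real k) ^ (3 * s)" by (simp only: power_mult[symmetric] mult.commute)
      also have "\<dots> \<le> (1 + 2 / real k) ^ j" using j(1) by (intro power_increasing) auto
      finally show ?thesis by (simp add: power3_eq_cube)
    qed
    then have "(11 / 4) * c0 \<le> (1 + 2 / real k) ^ j * c0" using c00 by (intro mult_right_mono) auto
    ultimately show ?thesis using D275 by linarith
  qed
  then have "b \<le> rc (m - k + j) (m - k)" unfolding b_def D_def
    by (intro cross_nat(2)[OF unif_F int_F v(1)]) auto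
  also have "(m - k + j) choose (m - k) = (m - k + j) choose j"
    using binomial_symmetric[of "m - k" "m - k + j"] by simp
  also have "rc (m - k + j) j \<le> slack_real"
  proof -
    have jM: "real j \<le> 3 / 4 * real k + 1" using j(3) s by linarith
    have "rc (m - k + j) j \<le> (6 / 5) ^ j * rc (m - k - 3) j"
    proof (rule rc_ratio_upper)
      fix i assume i: "i < j"
      have "real (m - k - 3) = M - 3" using M5 K m_ge k100 unfolding M_def by (simp add: of_nat_diff)
      moreover have "real i \<le> real j - 1" using i by simp
      ultimately show "real (m - k + j) - real i \<le> 6 / 5 * (real (m - k - 3) - real i)"
        using M5 jM K unfolding of_nat_add M_def[symmetric] by simp
    qed auto
    also have "(6 / 5) ^ j * rc (m - k - 3) j \<le> 4 ^ (s - 4) * rc (m - k - 3) j"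
    proof (rule mult_right_mono)
      have "(6 / 5 :: real) ^ j \<le> (6 / 5) ^ (3 * s + 3)" using j(2) by (intro power_increasing) auto
      then show "(6 / 5 :: real) ^ j \<le> 4 ^ (s - 4)" using power_six_fifths_le_power_four[OF s(3)] by linarith
    qed simp
    also have "\<dots> \<le> rc (m - k - 3) (j + (s - 4))"
    proof -
      have "4 ^ t * rc (m - k - 3) j \<le> rc (m - k - 3) (j + t)" if "t \<le> s - 4" for t
        using that
      proof (induction t)
        case (Suc t)
        have "real (j + Suc t) \<le> real k - 4" using Suc.prems j(3) s by linarith
        then have f: "4 * real (Suc (j + t)) \<le> real (m - k - 3) - real (j + t)"
          using M5 K m_ge k100 unfolding M_def by (simp add: of_nat_diff)
        have "(4 * rc (m - k - 3) (j + t)) * real (Suc (j + t)) = rc (m - k - 3) (j + t) * (4 * real (Suc (j + t)))" by simp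
        also have "\<dots> \<le> rc (m - k - 3) (j + t) * (real (m - k - 3) - real (j + t))"
          using f by (intro mult_left_mono) auto
        also have "\<dots> = rc (m - k - 3) (Suc (j + t)) * real (Suc (j + t))" by (rule rc_Suc_bot[symmetric])
        finally have "4 * rc (m - k - 3) (j + t) \<le> rc (m - k - 3) (Suc (j + t))"
          by (subst (asm) mult_le_cancel_right_pos) auto
        then show ?case using Suc by simp
      qed simp
      then show ?thesis by simp
    qed
    also have "j + (s - 4) = k - 4" using s(3) s(2) unfolding j_def s_def by simp
    finally show ?thesis unfolding slack_real_def .
  qed
  finally show ?thesis using v(1) unfolding b_def by blast
qed

end



section \<open>Short ground sets\<close>

lemma gchoose_lower_shift:
  assumes "0 \<le> \<delta>" "0 \<le> e" "q \<le> M" "\<And>i. i < q \<Longrightarrow> \<delta> \<le> e * (real M - real i)" "real q * e \<le> 1"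
  shows "rc M q * (1 - real q * e) \<le> ((real M - \<delta>) gchoose q)"
  using assms(3-5)
proof (induction q)
  case (Suc q)
  let ?x = "real M - \<delta>"
  have qe: "real q * e \<le> 1" using Suc.prems(3) assms(2) by (simp add: algebra_simps)
  have "1 * e \<le> real (Suc q) * e" using assms(2) by (intro mult_right_mono) auto
  then have e1: "e \<le> 1" using Suc.prems(3) by linarith
  have IH: "rc M q * (1 - real q * e) \<le> (?x gchoose q)" using Suc qe by simp
  have f: "(real M - real q) * (1 - e) \<le> ?x - real q" using Suc.prems(2)[of q] by (simp add: algebra_simps)
  have Mq: "0 \<le> real M - real q" using Suc.prems(1) by simp
  have f0: "0 \<le> (real M - real q) * (1 - e)" using Mq e1 by simp
  have "rc M (Suc q) * (1 - real (Suc q) * e) * real (Suc q) = (rc M (Suc q) * real (Suc q)) * (1 - real (Suc q) * e)"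
    by (simp only: mult_ac)
  also have "\<dots> = rc M q * ((real M - real q) * (1 - real (Suc q) * e))"
    unfolding rc_Suc_bot by (simp only: mult_ac)
  also have "\<dots> \<le> rc M q * ((real M - real q) * ((1 - real q * e) * (1 - e)))"
    using Mq assms(2) by (intro mult_left_mono) (auto simp: algebra_simps)
  also have "\<dots> = (rc M q * (1 - real q * e)) * ((real M - real q) * (1 - e))" by (simp only: mult_ac)
  also have "\<dots> \<le> (?x gchoose q) * (?x - real q)"
  proof (rule mult_mono[OF IH f])
    show "0 \<le> ?x gchoose q" using IH qe mult_nonneg_nonneg[of "rc M q" "1 - real q * e"] by linarith
    show "0 \<le> (real M - real q) * (1 - e)" by (rule f0)
  qed
  also have "\<dots> = (?x gchoose Suc q) * real (Suc q)" using gchoose_Suc_real[of ?x q] by simp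
  finally show ?case by (simp only: mult_le_cancel_right of_nat_less_0_iff of_nat_0_less_iff zero_less_Suc simp_thms)
qed simp

lemma power_five_sixths_bound:
  "100 \<le> k \<Longrightarrow> 240 * (real k)\<^sup>2 * (5 / 6) ^ (k - 1) \<le> (1 :: real)"
proof (induction k rule: dec_induct)
  case base
  show ?case by (simp add: power_divide)
next
  case (step k)
  have "(real (Suc k))\<^sup>2 \<le> 6 / 5 * (real k)\<^sup>2"
  proof -
    have "100 * real k \<le> real k * real k" using step.hyps by (intro mult_right_mono) auto
    moreover have "(real (Suc k))\<^sup>2 = real k * real k + 2 * real k + 1"
      by (simp add: power2_eq_square algebra_simps)
    moreover have "100 \<le> real k" using step.hyps by simp
    ultimately show ?thesis unfolding power2_eq_square[of "real k"] by linarith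
  qed
  moreover have "(5 / 6 :: real) ^ (Suc k - 1) = 5 / 6 * (5 / 6) ^ (k - 1)"
    using step.hyps by (cases k) auto
  ultimately have "240 * (real (Suc k))\<^sup>2 * (5 / 6) ^ (Suc k - 1) \<le> 240 * (6 / 5 * (real k)\<^sup>2) * (5 / 6 * (5 / 6) ^ (k - 1))"
    by (intro mult_mono) auto
  also have "\<dots> = 240 * (real k)\<^sup>2 * (5 / 6) ^ (k - 1)" by simp
  finally show ?case using step.IH by linarith
qed

lemma power_six_fifths_bound:
  "50 \<le> u \<Longrightarrow> 3 * (2 * real u + 1) \<le> (6 / 5 :: real) ^ u"
proof (induction u rule: dec_induct)
  case base
  show ?case by (simp add: power_divide)
next
  case (step u)
  then show ?case by simp
qed

context large_family
begin

lemma max_degree: "\<exists>v\<in>{1..n}. k * card \<F> \<le> n * degree \<F> {v}"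
proof (rule ccontr)
  assume "\<not> ?thesis"
  then have "\<And>v. v \<in> {1..n} \<Longrightarrow> n * degree \<F> {v} < k * card \<F>" by (meson not_le)
  then have "(\<Sum>v\<in>{1..n}. n * degree \<F> {v}) < (\<Sum>v\<in>{1..n}. k * card \<F>)"
    using n_gt by (intro sum_strict_mono) auto
  moreover have "(\<Sum>v\<in>{1..n}. card {S \<in> \<F>. v \<in> S}) = k * card \<F>"
    by (rule sum_card_incidence[OF _ fin_F]) (use unif_F in \<open>auto simp: nsets_def\<close>)
  then have "(\<Sum>v\<in>{1..n}. n * degree \<F> {v}) = n * (k * card \<F>)"
    unfolding degree_def by (simp add: sum_distrib_left[symmetric])
  ultimately show False by simp
qed

text \<open>A vertex of maximum degree has degree at least \<open>k |F| / n\<close>, so its deficit \<open>D\<close> is below \<open>C(m - 1, k - 1)\<close>, the deficit of a vertex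
other than the centre of a full star, by a relative amount of order \<open>1 / k\<close>.  That makes the real parameter
\<open>x = m - 1 - 1 / (4 k)\<close> admissible, and the quotient of the Kruskal-Katona bound is then \<open>1 - g\<close> with \<open>g\<close> of order
\<open>1 / k\<^sup>2\<close>.  As \<open>c0\<close> is exponentially small compared with \<open>N\<close>, this tiny gain suffices to start the bootstrap.\<close>

theorem regime_near:
  assumes n6: "n \<le> 6 * k"
  shows "\<exists>v\<in>{1..n}. real (card (away v \<F>)) \<le> slack_real"
proof -
  obtain v where v: "v \<in> {1..n}" and maxd: "k * card \<F> \<le> n * degree \<F> {v}" using max_degree by blast
  define D where "D = deficit \<F> v"
  define b where "b = real (card (away v \<F>))"
  define M where "M = real (m - k)"
  have K: "100 \<le> real k" using k100 by simp
  have mk: "2 * real k \<le> real m" "real m \<le> 6 * real k - 1" "M = real m - real k"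
    using m_ge n6 n_eq unfolding M_def by auto
  have Npos: "0 < N" using m_ge k100 by simp
  have c00: "0 < c0" by (rule c0_pos)
  have D0: "0 \<le> D" unfolding D_def by (rule deficit_nonneg[OF v])
  have b0: "0 \<le> b" unfolding b_def by simp
  have Db: "D \<le> 3 * c0 + b" using deficit_le[of v] d_le3 unfolding D_def b_def by linarith
  have c0N: "240 * (real k)\<^sup>2 * c0 \<le> N"
  proof -
    have "c0 \<le> (5 / 6) ^ (k - 1) * N" by (rule c0_le_N) (use mk in auto)
    then have "240 * (real k)\<^sup>2 * c0 \<le> 240 * (real k)\<^sup>2 * ((5 / 6) ^ (k - 1) * N)" by (intro mult_left_mono) auto
    also have "\<dots> = (240 * (real k)\<^sup>2 * (5 / 6) ^ (k - 1)) * N" by simp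
    also have "\<dots> \<le> 1 * N" by (intro mult_right_mono power_five_sixths_bound[OF k100]) simp
    finally show ?thesis by simp
  qed
  have drop1: "(M + 1) * N = real m * rc (m - 1) (k - 1)"
  proof -
    have e: "real m - real (k - 1) = M + 1" using mk k100 by (simp add: of_nat_diff)
    have "(real m - real (k - 1)) * N = real m * rc (m - 1) (k - 1)"
      by (rule rc_drop_top) (use m_ge k100 in auto)
    then show ?thesis unfolding e .
  qed
  have drop2: "M * rc (m - 1) (k - 1) = (real m - 1) * rc (m - 2) (k - 1)"
  proof -
    have e: "real (m - 1) - real (k - 1) = M" "real (m - 1) = real m - 1" "m - 1 - 1 = m - 2"
      using mk m_ge k100 by (auto simp: of_nat_diff)
    have "(real (m - 1) - real (k - 1)) * rc (m - 1) (k - 1) = real (m - 1) * rc (m - 1 - 1) (k - 1)"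
      by (rule rc_drop_top) (use m_ge k100 in auto)
    then have "M * rc (m - 1) (k - 1) = real (m - 1) * rc (m - 2) (k - 1)" unfolding e(1,3) .
    then show ?thesis unfolding e(2) .
  qed
  have start: "D \<le> N * (1 - real k / (real m + 1)) + 3 * c0"
  proof -
    have "real (k * card \<F>) \<le> real (n * degree \<F> {v})" using maxd by (simp only: of_nat_le_iff)
    moreover have "real n = real m + 1" using n_eq by simp
    ultimately have "real k * real (card \<F>) \<le> (real m + 1) * real (degree \<F> {v})"
      by (simp only: of_nat_mult)
    moreover have "N - d \<le> real (card \<F>)" using card_C3_real large by linarith
    then have "real k * (N - d) \<le> real k * real (card \<F>)" by (intro mult_left_mono) auto
    ultimately have "real k * (N - d) / (real m + 1) \<le> real (degree \<F> {v})"
      by (simp add: divide_le_eq mult.commute)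
    moreover have "real k * (N - d) / (real m + 1) = (N - d) * (real k / (real m + 1))" by simp
    then have "real k * (N - d) / (real m + 1) = N * (real k / (real m + 1)) - d * (real k / (real m + 1))"
      by (simp only: left_diff_distrib)
    moreover have "d * (real k / (real m + 1)) \<le> 3 * c0 * (real k / (real m + 1))"
      by (intro mult_right_mono d_le3) auto
    moreover have "3 * c0 * (real k / (real m + 1)) \<le> 3 * c0 * 1"
      using mk c00 by (intro mult_left_mono) auto
    ultimately show ?thesis unfolding D_def deficit_def by (simp add: algebra_simps)
  qed
  \<comment> \<open>The average gains at least N / (2 m) over C(m - 1, k - 1); half of it is spent on delta and half on 3 c0.\<close>
  define \<delta> where "\<delta> = 1 / (4 * real k)"
  define x where "x = real (m - 1) - \<delta>"
  have \<delta>: "0 < \<delta>" "\<delta> \<le> 1" "\<delta> * real k = 1 / 4" using K unfolding \<delta>_def by (auto simp: field_simps)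
  have x_ge: "real (m - k) \<le> x" using \<delta> K mk m_ge unfolding x_def M_def by (simp add: of_nat_diff)
  have Dx: "D \<le> (x gchoose (k - 1))"
  proof -
    let ?e = "\<delta> / (M + 1)"
    have M1: "0 < M + 1" "real k \<le> M" using mk K by auto
    have "rc (m - 1) (k - 1) * (1 - real (k - 1) * ?e) \<le> (x gchoose (k - 1))" unfolding x_def
    proof (rule gchoose_lower_shift)
      show "\<delta> \<le> ?e * (real (m - 1) - real i)" if "i < k - 1" for i
      proof -
        have "M + 1 \<le> real (m - 1) - real i" using that mk m_ge k100 by (simp add: of_nat_diff)
        then have "?e * (M + 1) \<le> ?e * (real (m - 1) - real i)" using \<delta> M1 by (intro mult_left_mono) auto
        then show ?thesis using M1 by simp
      qed
      have "real (k - 1) * ?e = (real (k - 1) * \<delta>) / (M + 1)" by simp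
      also have "\<dots> \<le> (real k * \<delta>) / (M + 1)" using \<delta> M1 by (intro divide_right_mono mult_right_mono) auto
      also have "\<dots> \<le> 1" using \<delta> M1 K by (simp add: mult.commute)
      finally show "real (k - 1) * ?e \<le> 1" .
    qed (use \<delta> M1 m_ge in auto)
    moreover have "N * ((M + 1) / real m - 1 / (4 * real m)) \<le> rc (m - 1) (k - 1) * (1 - real (k - 1) * ?e)"
    proof -
      have m0: "real m \<noteq> 0" using mk K by linarith
      have alg: "a * p / u * (1 - c * (e / p)) = a * (p / u - c * e / u)" if "u \<noteq> 0" "p \<noteq> 0" for a p u c e :: real
        using that by (simp add: field_simps)
      have r1: "rc (m - 1) (k - 1) = N * (M + 1) / real m"
        using drop1 by (simp only: nonzero_eq_divide_eq[OF m0] mult.commute)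
      have "rc (m - 1) (k - 1) * (1 - real (k - 1) * ?e) = N * ((M + 1) / real m - real (k - 1) * \<delta> / real m)"
        unfolding r1 using M1 by (intro alg m0) simp
      moreover have "real (k - 1) * \<delta> / real m \<le> (1 / 4) / real m"
        using \<delta> K mk by (intro divide_right_mono) (auto simp: of_nat_diff algebra_simps)
      ultimately show ?thesis using Npos by (simp add: mult_left_mono)
    qed
    moreover have "N * (1 - real k / (real m + 1)) + 3 * c0 \<le> N * ((M + 1) / real m - 1 / (4 * real m))"
    proof -
      have "1 - real k / (real m + 1) = (M + 1) / (real m + 1)" using mk K by (simp add: field_simps)
      moreover have "(M + 1) / real m - (M + 1) / (real m + 1) = ((M + 1) / (real m + 1)) / real m"
        using mk K by (simp add: field_simps)
      moreover have "(1 / 2) / real m \<le> ((M + 1) / (real m + 1)) / real m"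
        using mk K by (intro divide_right_mono) (auto simp: field_simps)
      moreover have "(1 / 2) / real m = 1 / (4 * real m) + 1 / (4 * real m)" by simp
      ultimately have "1 - real k / (real m + 1) + 1 / (4 * real m) \<le> (M + 1) / real m - 1 / (4 * real m)"
        by linarith
      then have "N * (1 - real k / (real m + 1) + 1 / (4 * real m)) \<le> N * ((M + 1) / real m - 1 / (4 * real m))"
        using Npos by (intro mult_left_mono) auto
      moreover have "3 * c0 \<le> N * (1 / (4 * real m))"
      proof -
        have "100 * real k \<le> (real k)\<^sup>2" using K by (simp add: power2_eq_square)
        then have "12 * real m \<le> 240 * (real k)\<^sup>2" using mk K by linarith
        then have "12 * real m * c0 \<le> 240 * (real k)\<^sup>2 * c0" using c00 by (intro mult_right_mono) auto
        then have "12 * real m * c0 \<le> N" using c0N by linarith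
        then show ?thesis using mk K by (simp add: field_simps)
      qed
      ultimately show ?thesis by (simp add: algebra_simps)
    qed
    ultimately show ?thesis using start by linarith
  qed
  define g where "g = \<delta> / M"
  have Mpos: "0 < M" "real k \<le> M" "M \<le> 5 * real k" using mk K by auto
  have g: "0 < g" "g \<le> 1" unfolding g_def using \<delta> Mpos K by auto
  have bg: "b \<le> D * (1 - g)"
  proof -
    let ?f = "\<lambda>q. (x - real q) / real (Suc q)" and ?h = "\<lambda>q. (real (m - 1) - real q) / real (Suc q)"
    have "b \<le> D * (\<Prod>q = k - 1..<m - k. ?f q)"
      unfolding b_def D_def by (rule cross_real[OF unif_F int_F v x_ge Dx[unfolded D_def]])
    also have "\<dots> \<le> D * (1 - g)"
    proof (rule mult_left_mono[OF _ D0])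
      have "(\<Prod>q = k - 1..<m - k. ?f q) \<le> (\<Prod>q = k - 1..<m - k. (1 - g) * ?h q)"
      proof (rule prod_mono)
        fix q assume q: "q \<in> {k - 1..<m - k}"
        have "real (m - 1) - real q \<le> M" "1 \<le> real (m - 1) - real q"
          using q m_ge k100 unfolding M_def by (auto simp: of_nat_diff)
        then have "g * (real (m - 1) - real q) \<le> g * M" using g by (intro mult_left_mono) auto
        also have "g * M = \<delta>" unfolding g_def using Mpos by simp
        finally have "g * (real (m - 1) - real q) \<le> \<delta>" .
        then have "x - real q \<le> (1 - g) * (real (m - 1) - real q)" unfolding x_def by (simp add: algebra_simps)
        then have "?f q \<le> (1 - g) * (real (m - 1) - real q) / real (Suc q)" by (rule divide_right_mono) simp
        moreover have "0 \<le> ?f q" using x_ge q by simp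
        ultimately show "0 \<le> ?f q \<and> ?f q \<le> (1 - g) * ?h q" by simp
      qed
      also have "\<dots> = (1 - g) ^ (m - k - (k - 1)) * (\<Prod>q = k - 1..<m - k. ?h q)"
        by (simp only: prod.distrib prod_constant card_atLeastLessThan)
      also have "(\<Prod>q = k - 1..<m - k. ?h q) = 1"
      proof -
        have "rc (m - 1) (k - 1) * (\<Prod>q = k - 1..<m - k. ?h q) = rc (m - 1) (m - k)"
          using prod_gchoose[of "k - 1" "m - k" "real (m - 1)"] m_ge by (simp add: binomial_gbinomial)
        moreover have "(m - 1) choose (m - k) = (m - 1) choose (k - 1)"
          using binomial_symmetric[of "m - k" "m - 1"] m_ge k100 by simp
        moreover have "0 < rc (m - 1) (k - 1)" using m_ge k100 by simp
        ultimately show ?thesis by simp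
      qed
      also have "(1 - g) ^ (m - k - (k - 1)) * 1 \<le> 1 - g"
      proof -
        have e: "m - k - (k - 1) = Suc (m - 2 * k)" using m_ge k100 by arith
        show ?thesis unfolding e power_Suc mult_1_right
          by (rule mult_left_le) (use g in \<open>auto intro: power_le_one\<close>)
      qed
      finally show "(\<Prod>q = k - 1..<m - k. ?f q) \<le> 1 - g" .
    qed
    finally show ?thesis .
  qed
  \<comment> \<open>From here on, b <= (1 - g) D together with D <= 3 c0 + b gives D <= 3 c0 / g with better and better g.\<close>
  have D60: "D \<le> 60 * (real k)\<^sup>2 * c0"
  proof -
    have "D * g \<le> 3 * c0" using bg Db by (simp add: algebra_simps)
    moreover have "D * (1 / (20 * (real k)\<^sup>2)) \<le> D * g"
    proof (rule mult_left_mono[OF _ D0])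
      have "4 * real k * M \<le> 20 * (real k)\<^sup>2" using Mpos K by (simp add: power2_eq_square)
      then have "1 / (20 * (real k)\<^sup>2) \<le> 1 / (4 * real k * M)" using Mpos K by (intro divide_left_mono) auto
      then show "1 / (20 * (real k)\<^sup>2) \<le> g" unfolding g_def \<delta>_def by simp
    qed
    ultimately have "D * (1 / (20 * (real k)\<^sup>2)) \<le> 3 * c0" by linarith
    then show ?thesis using K by (simp add: field_simps)
  qed
  have D_m2: "D \<le> rc (m - k + (k - 2)) (k - 1)"
  proof -
    have "N \<le> 2 * rc (m - 1) (k - 1)"
    proof -
      have "real m * N \<le> (2 * (M + 1)) * N" using mk Npos by (intro mult_right_mono) auto
      also have "(2 * (M + 1)) * N = real m * (2 * rc (m - 1) (k - 1))"
        by (simp only: mult.assoc drop1 mult.left_commute)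
      finally have "real m * N \<le> real m * (2 * rc (m - 1) (k - 1))" .
      then show ?thesis using mk K by simp
    qed
    moreover have "rc (m - 1) (k - 1) \<le> 2 * rc (m - 2) (k - 1)"
    proof -
      have "(real m - 1) * rc (m - 1) (k - 1) \<le> (2 * M) * rc (m - 1) (k - 1)" using mk by (intro mult_right_mono) auto
      also have "(2 * M) * rc (m - 1) (k - 1) = (real m - 1) * (2 * rc (m - 2) (k - 1))"
        by (simp only: mult.assoc drop2 mult.left_commute)
      finally have "(real m - 1) * rc (m - 1) (k - 1) \<le> (real m - 1) * (2 * rc (m - 2) (k - 1))" .
      then show ?thesis using mk K by simp
    qed
    moreover have "m - k + (k - 2) = m - 2" using m_ge k100 by simp
    ultimately show ?thesis using D60 c0N by simp
  qed
  have D3k: "D \<le> 3 * real k * c0"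
  proof -
    have "b * M \<le> D * (real k - 1)"
      using contraction_one_step[OF v, of "k - 2"] D_m2 k100 unfolding b_def D_def M_def by (simp add: of_nat_diff)
    moreover have "D * M \<le> (3 * c0 + b) * M" using Db Mpos by (intro mult_right_mono) auto
    ultimately have 1: "D * (M - real k + 1) \<le> 3 * c0 * M" by (simp add: algebra_simps)
    have "M \<le> real k * (M - real k + 1)"
    proof -
      have "0 \<le> (real k - 1) * (M - real k)" using Mpos K by simp
      then show ?thesis by (simp add: algebra_simps)
    qed
    then have "3 * c0 * M \<le> 3 * c0 * (real k * (M - real k + 1))" using c00 by (intro mult_left_mono) auto
    then have "D * (M - real k + 1) \<le> (3 * real k * c0) * (M - real k + 1)" using 1 by (simp add: mult_ac)
    then show ?thesis using Mpos by (simp only: mult_le_cancel_right_pos)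
  qed
  have grow: "(6 / 5) ^ j * c0 \<le> rc (m - k + j) (k - 1)" if "real j \<le> real k / 2" for j
  proof (rule rc_grow_top)
    show "6 / 5 * (real (m - k) + real j - real (k - 1)) \<le> real (m - k) + real j"
      using that Mpos K mk k100 by (simp add: of_nat_diff M_def[symmetric])
  qed (use m_ge in auto)
  have D62: "D \<le> 6.2 * c0"
  proof -
    let ?j = "k div 2"
    have "3 * real k \<le> 3 * (2 * real ?j + 1)" by simp
    also have "\<dots> \<le> (6 / 5) ^ ?j" using k100 by (intro power_six_fifths_bound) simp
    finally have "3 * real k * c0 \<le> (6 / 5) ^ ?j * c0" using c00 by (intro mult_right_mono) auto
    moreover have "2 * ?j \<le> k" by simp
    then have "real (2 * ?j) \<le> real k" by (simp only: of_nat_le_iff)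
    then have "real ?j \<le> real k / 2" by simp
    ultimately have "D \<le> rc (m - k + ?j) (k - 1)" using D3k grow[of ?j] by linarith
    then have 1: "b * M \<le> D * real (?j + 1)"
      using contraction_one_step[OF v, of ?j] k100 unfolding b_def D_def M_def by simp
    have "real (?j + 1) \<le> 0.51 * M" using Mpos K by simp
    then have "D * real (?j + 1) \<le> D * (0.51 * M)" using D0 by (intro mult_left_mono) auto
    then have "b * M \<le> (0.51 * D) * M" using 1 by simp
    then have "b \<le> 0.51 * D" using Mpos by (simp only: mult_le_cancel_right_pos)
    then show ?thesis using Db c00 by simp
  qed
  \<comment> \<open>With 12 in place of k / 2 the quotient is at most 13 / k, which is needed when m - k is k or k + 1.\<close>
  have D12: "D \<le> rc (m - k + 12) (k - 1)"
  proof -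
    have "6.2 * c0 \<le> (6 / 5) ^ 12 * c0" using c00 by (intro mult_right_mono) (auto simp: power_divide)
    then show ?thesis using D62 grow[of 12] K by simp
  qed
  have b13: "b \<le> 0.13 * D"
  proof -
    have "b * M \<le> D * 13"
      using contraction_one_step[OF v, of 12] D12 k100 unfolding b_def D_def M_def by simp
    also have "\<dots> \<le> D * (0.13 * M)" using Mpos K D0 by (intro mult_left_mono) auto
    finally have "b * M \<le> (0.13 * D) * M" by simp
    then show ?thesis using Mpos by (simp only: mult_le_cancel_right_pos)
  qed
  have D345: "D \<le> 3.45 * c0" using b13 Db c00 by simp
  have sl: "slack_real * (M * (M - 1) * (M - 2)) = (real k - 1) * (real k - 2) * (real k - 3) * c0"
  proof -
    have e: "real (m - k - 1) = M - 1" "real (m - k - 2) = M - 2" "real (k - 1) = real k - 1"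
      "real (k - 2) = real k - 2" "real (k - 3) = real k - 3"
      using m_ge k100 unfolding M_def by (auto simp: of_nat_diff)
    show ?thesis using slack_real_eq unfolding e M_def[symmetric] .
  qed
  have M3: "0 < M * (M - 1) * (M - 2)" using Mpos K by simp
  have "b \<le> slack_real"
  proof (cases "m - k \<le> k + 1")
    case True
    then have M1: "M \<le> real k + 1" unfolding M_def by simp
    have "M * (M - 1) * (M - 2) \<le> (real k + 1) * real k * (real k - 1)"
      using M1 Mpos K by (intro mult_mono) auto
    also have "\<dots> \<le> (2 * ((real k - 2) * (real k - 3))) * (real k - 1)"
    proof (rule mult_right_mono)
      define u where "u = real k * real k"
      have h: "100 * real k \<le> u" unfolding u_def using K by (intro mult_right_mono) auto
      have h1: "2 * ((real k - 2) * (real k - 3)) = 2 * u - 10 * real k + 12" unfolding u_def by (simp add: algebra_simps)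
      have h2: "(real k + 1) * real k = u + real k" unfolding u_def by (simp add: algebra_simps)
      show "(real k + 1) * real k \<le> 2 * ((real k - 2) * (real k - 3))" unfolding h1 h2 using K h by linarith
    qed (use K in simp)
    finally have "(c0 / 2) * (M * (M - 1) * (M - 2)) \<le> (c0 / 2) * ((2 * ((real k - 2) * (real k - 3))) * (real k - 1))"
      using c00 by (intro mult_left_mono) auto
    also have "\<dots> = slack_real * (M * (M - 1) * (M - 2))" unfolding sl by simp
    finally have "c0 / 2 \<le> slack_real" using M3 by (simp only: mult_le_cancel_right_pos)
    then show ?thesis using b13 D345 c00 by simp
  next
    case False
    have p3: "(\<Prod>i<3. f i) = f 0 * f 1 * f (2::nat)" for f :: "nat \<Rightarrow> real"
      by (simp add: numeral_3_eq_3 numeral_2_eq_2)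
    \<comment> \<open>Three factors of the quotient cancel the three factors M (M - 1) (M - 2) by which the slack is smaller than c0.\<close>
    have "real (card (away v \<F>)) * (\<Prod>i<3. real (m - k) - real i) \<le> deficit \<F> v * (\<Prod>i<3. real (12 + i + 1))"
      by (rule contraction[OF v]) (use False k100 m_ge D12 D_def in auto)
    then have "b * (M * (M - 1) * (M - 2)) \<le> D * 2730" unfolding p3 b_def D_def M_def by simp
    also have "\<dots> \<le> (3.45 * c0) * 2730" using D345 by simp
    also have "\<dots> \<le> ((real k - 1) * (real k - 2) * (real k - 3)) * c0"
    proof -
      have "97 * 97 * 97 \<le> (real k - 1) * (real k - 2) * (real k - 3)" using K by (intro mult_mono) auto
      then have "9418.5 * c0 \<le> ((real k - 1) * (real k - 2) * (real k - 3)) * c0"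
        using c00 by (intro mult_right_mono) auto
      then show ?thesis by simp
    qed
    finally have "b * (M * (M - 1) * (M - 2)) \<le> slack_real * (M * (M - 1) * (M - 2))" unfolding sl .
    then show ?thesis using M3 by (simp only: mult_le_cancel_right_pos)
  qed
  then show ?thesis using v unfolding b_def by blast
qed

end



section \<open>Long ground sets\<close>

lemma exists_floor_sqrt: "\<exists>r. r * r \<le> k \<and> k < (r + 1) * (r + 1)" for k :: nat
proof (induction k)
  case (Suc k)
  then obtain r where r: "r * r \<le> k" "k < (r + 1) * (r + 1)" by blast
  show ?case
  proof (cases "Suc k < (r + 1) * (r + 1)")
    case True
    then show ?thesis using r by (intro exI[of _ r]) auto
  next
    case False
    then have "Suc k = (r + 1) * (r + 1)" using r by linarith
    then show ?thesis by (intro exI[of _ "r + 1"]) auto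
  qed
qed auto

lemma chunk_numerics4:
  fixes u k :: real
  assumes "100 * k \<le> u" "100 \<le> k"
  shows "3 / 4 * u \<le> 4 / 5 * u - 4 / 5 * k"
  using assms by (simp add: field_simps)

lemma square_le_power_ten: "5 \<le> u \<Longrightarrow> 4 * (2 * real u + 2)\<^sup>2 \<le> 3 * 10 ^ (u - 2)"
proof (induction u rule: dec_induct)
  case (step u)
  have "(2 * real (Suc u) + 2)\<^sup>2 \<le> (2 * (2 * real u + 2))\<^sup>2" by (intro power_mono) auto
  also have "\<dots> = 4 * (2 * real u + 2)\<^sup>2" by (simp only: power_mult_distrib) simp
  finally have "4 * (2 * real (Suc u) + 2)\<^sup>2 \<le> 10 * (4 * (2 * real u + 2)\<^sup>2)"
    using zero_le_power2[of "2 * real u + 2"] by linarith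
  also have "\<dots> \<le> 10 * (3 * 10 ^ (u - 2))" using step.IH by linarith
  also have "\<dots> = 3 * 10 ^ (Suc u - 2)"
  proof -
    have e: "Suc u - 2 = Suc (u - 2)" using step.hyps by arith
    show ?thesis unfolding e by simp
  qed
  finally show ?case .
qed simp

lemma eighth_power_le_power_ten: "10 \<le> r \<Longrightarrow> 5 * (real r + 1) ^ 8 \<le> 4 * 10 ^ (r + 1)"
proof (induction r rule: dec_induct)
  case (step r)
  have "(real (Suc r) + 1) ^ 8 \<le> (12 / 11 * (real r + 1)) ^ 8" using step.hyps by (intro power_mono) auto
  also have "\<dots> = (12 / 11) ^ 8 * (real r + 1) ^ 8" by (simp only: power_mult_distrib)
  also have "\<dots> \<le> 10 * (real r + 1) ^ 8" by (intro mult_right_mono) (auto simp: power_divide)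
  finally have "5 * (real (Suc r) + 1) ^ 8 \<le> 10 * (5 * (real r + 1) ^ 8)" by simp
  also have "\<dots> \<le> 10 * (4 * 10 ^ (r + 1))" using step.IH by linarith
  finally show ?case by simp
qed simp

text \<open>Branching multiplies by \<open>k\<close> and the binomial shrinks by \<open>10 k\<close> at every level after the first \<open>s\<close>.\<close>

lemma power_cancel_tail:
  fixes k :: real
  assumes "0 < k" "s \<le> t"
  shows "k ^ t * (1 / (10 * k)) ^ (t - s) = k ^ s * (1 / 10) ^ (t - s)"
proof -
  obtain l where t: "t = s + l" using assms(2) le_Suc_ex by blast
  have "k ^ l * (1 / (10 * k)) ^ l = (k * (1 / (10 * k))) ^ l" by (simp only: power_mult_distrib)
  also have "k * (1 / (10 * k)) = 1 / 10" using assms(1) by simp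
  finally have "k ^ s * (k ^ l * (1 / (10 * k)) ^ l) = k ^ s * (1 / 10) ^ l" by simp
  then show ?thesis unfolding t by (simp only: power_add mult.assoc add_diff_cancel_left')
qed

lemma exists_heavy_in_cover:
  assumes "finite \<F>" "finite R" "\<And>F. F \<in> \<F> \<Longrightarrow> R \<inter> F \<noteq> {}" "\<F> \<noteq> {}"
  shows "\<exists>v\<in>R. card \<F> \<le> card R * degree \<F> {v}"
proof (rule ccontr)
  assume "\<not> ?thesis"
  then have lt: "\<And>v. v \<in> R \<Longrightarrow> card R * degree \<F> {v} < card \<F>" by (meson not_le)
  have "R \<noteq> {}" using assms(3,4) by blast
  then have "(\<Sum>v\<in>R. card R * degree \<F> {v}) < (\<Sum>v\<in>R. card \<F>)"
    using lt assms(2) by (intro sum_strict_mono) auto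
  then have "card R * (\<Sum>v\<in>R. degree \<F> {v}) < card R * card \<F>" by (simp only: sum_distrib_left[symmetric] sum_constant of_nat_id)
  then have small: "(\<Sum>v\<in>R. degree \<F> {v}) < card \<F>" by simp
  have "\<F> \<subseteq> (\<Union>v\<in>R. {F \<in> \<F>. {v} \<subseteq> F})"
  proof
    fix F assume F: "F \<in> \<F>"
    then obtain v where "v \<in> R" "v \<in> F" using assms(3) by blast
    then show "F \<in> (\<Union>v\<in>R. {F \<in> \<F>. {v} \<subseteq> F})" using F by auto
  qed
  then have "card \<F> \<le> card (\<Union>v\<in>R. {F \<in> \<F>. {v} \<subseteq> F})" using assms(1,2) by (intro card_mono) auto
  also have "\<dots> \<le> (\<Sum>v\<in>R. degree \<F> {v})" unfolding degree_def by (rule card_UN_le[OF assms(2)])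
  finally show False using small by simp
qed

context large_family
begin

text \<open>Let \<open>P = C(n - 3, k - 3)\<close>.  Branching to depth 3 bounds pair degrees by \<open>k P\<close>, and the family has at least \<open>3/4 k\<^sup>2 P\<close>
members.  Each further level of branching gains a factor \<open>k\<^sup>2 / n \<le> 1 / 10\<close>, so the family has a cover of fewer than about
\<open>log k\<close> points; the bound \<open>r / 2\<close> with \<open>r\<close> about \<open>sqrt k\<close> is simpler and still strong enough.  Some point \<open>v\<close> of
this cover has degree at least \<open>3/2 r k P\<close>.  By the bound on pair degrees, no \<open>r + 4\<close> points cover its link, so that branching
over the link to depth \<open>r + 5\<close> leaves a negligible number of members that avoid \<open>v\<close>.\<close>

theorem regime_far:
  assumes cov: "3 \<le> covering_number \<F>" and far: "10 * k\<^sup>2 \<le> n"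
  shows "\<exists>v\<in>{1..n}. real (card (away v \<F>)) \<le> slack_real"
proof -
  have K: "100 \<le> real k" using k100 by simp
  have KK: "100 * real k \<le> (real k)\<^sup>2" using K by (simp add: power2_eq_square)
  have "real (10 * k\<^sup>2) \<le> real n" using far by (simp only: of_nat_le_iff)
  then have nn: "10 * (real k)\<^sup>2 \<le> real n" by simp
  have mn: "real m = real n - 1" using n_eq by simp
  define P where "P = rc (n - 3) (k - 3)"
  have Ppos: "0 < P" unfolding P_def using n_gt k100 by simp
  have member: "finite F \<and> card F = k \<and> F \<subseteq> {1..n}" if "F \<in> \<F>" for F using that unif_F by (auto simp: nsets_def)
  have meet: "F \<inter> G \<noteq> {}" if "F \<in> \<F>" "G \<in> \<F>" for F G using that int_F unfolding intersecting_def by blast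
  have pair: "real (degree \<F> {x, y}) \<le> real k * P" if "x \<noteq> y" for x y
  proof -
    have "card {F \<in> \<F>. {x, y} \<subseteq> F} \<le> k ^ (3 - card {x, y}) * ((card {1..n} - 3) choose (k - 3))"
    proof (rule branching[OF _ unif_F, where \<G> = \<F>])
      show "\<exists>G\<in>\<F>. R \<inter> G = {}" if "finite R" "card R < 3" for R
        using covering_ge3_missed[OF cov that(1)] that(2) by simp
    qed (use k100 member meet that in auto)
    then have "degree \<F> {x, y} \<le> k * ((n - 3) choose (k - 3))" unfolding degree_def using that by simp
    then have "real (degree \<F> {x, y}) \<le> real (k * ((n - 3) choose (k - 3)))" by (simp only: of_nat_le_iff)
    then show ?thesis unfolding P_def by simp
  qed
  have size: "3 / 4 * (real k)\<^sup>2 * P \<le> real (card \<F>)"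
  proof -
    define \<rho> where "\<rho> = 1 - (2 * real k - 3) / (real n - real k + 1)"
    have den: "0 < real n - real k + 1" "2 * real k - 3 \<le> real n - real k + 1" using nn KK K by linarith+
    have \<rho>: "0 \<le> \<rho>" "\<rho> \<le> 1" unfolding \<rho>_def using den K by auto
    have "(1 - 1 / 5) ^ 1 \<le> \<rho> ^ (k - 3)"
    proof (rule power_ge_chunk[OF \<rho>, of _ _ "k - 3" "(2 * real k - 3) / (real n - real k + 1)"])
      have "real (k - 3) * (2 * real k - 3) = 2 * (real k)\<^sup>2 - 9 * real k + 9"
        using k100 by (simp add: of_nat_diff power2_eq_square algebra_simps)
      also have "\<dots> \<le> 1 / 5 * (real n - real k + 1)" using nn K by (simp add: field_simps)
      finally show "real (k - 3) * ((2 * real k - 3) / (real n - real k + 1)) \<le> 1 / 5"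
        using den by (simp add: pos_divide_le_eq)
    qed (auto simp: \<rho>_def)
    then have "4 / 5 * P \<le> \<rho> ^ (k - 3) * P" using Ppos by (intro mult_right_mono) auto
    also have "\<dots> \<le> rc (n - 2 * k) (k - 3)" unfolding P_def \<rho>_def
      by (rule choose_spread_lower) (use \<rho>(1) \<rho>_def in simp)
    finally have "real k * real (k - 1) * (4 / 5 * P) \<le> real k * real (k - 1) * rc (n - 2 * k) (k - 3)"
      by (intro mult_left_mono) auto
    also have "\<dots> \<le> N - d" by (rule card_C3_ge_product)
    also have "\<dots> \<le> real (card \<F>)" using card_C3_real large by linarith
    finally have 1: "real k * real (k - 1) * (4 / 5 * P) \<le> real (card \<F>)" .
    have "3 / 4 * (real k)\<^sup>2 \<le> real k * real (k - 1) * (4 / 5)"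
    proof -
      have "real k * real (k - 1) * (4 / 5) = 4 / 5 * (real k)\<^sup>2 - 4 / 5 * real k"
        using k100 by (simp add: of_nat_diff power2_eq_square field_simps)
      then show ?thesis using chunk_numerics4[OF KK K] by simp
    qed
    then have "3 / 4 * (real k)\<^sup>2 * P \<le> real k * real (k - 1) * (4 / 5) * P" using Ppos by (intro mult_right_mono) auto
    then show ?thesis using 1 by (simp add: mult.assoc)
  qed
  obtain r where r: "r * r \<le> k" "k < (r + 1) * (r + 1)" using exists_floor_sqrt by blast
  have r10: "10 \<le> r"
  proof (rule ccontr)
    assume "\<not> 10 \<le> r"
    then have "(r + 1) * (r + 1) \<le> 10 * 10" by (intro mult_le_mono) auto
    then show False using r(2) k100 by simp
  qed
  have rk: "real r * real r \<le> real k" "real k \<le> (real r + 1)\<^sup>2"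
  proof -
    show "real r * real r \<le> real k" using r(1) by (metis of_nat_le_iff of_nat_mult)
    have "real k \<le> real ((r + 1) * (r + 1))" using r(2) by (simp only: of_nat_le_iff)
    then show "real k \<le> (real r + 1)\<^sup>2" by (simp add: power2_eq_square algebra_simps)
  qed
  have rk5: "r + 5 \<le> k"
  proof -
    have "10 * r \<le> r * r" using r10 by simp
    then show ?thesis using r(1) r10 by linarith
  qed
  define u where "u = r div 2"
  have u: "5 \<le> u" "2 * u \<le> r" "r \<le> 2 * u + 1" using r10 unfolding u_def by auto
  have "\<exists>R. finite R \<and> card R < u + 1 \<and> (\<forall>F\<in>\<F>. R \<inter> F \<noteq> {})"
  proof (rule ccontr)
    assume none: "\<not> ?thesis"
    have "card {F \<in> \<F>. {} \<subseteq> F} \<le> k ^ (u + 1 - card ({} :: nat set)) * ((card {1..n} - (u + 1)) choose (k - (u + 1)))"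
    proof (rule branching[OF _ unif_F, where \<G> = \<F>])
      show "\<exists>G\<in>\<F>. R \<inter> G = {}" if "finite R" "card R < u + 1" for R using none that by blast
      show "u + 1 \<le> k" using u rk5 by linarith
    qed (use member meet in auto)
    then have "real (card \<F>) \<le> real (k ^ (u + 1) * ((n - (u + 1)) choose (k - (u + 1))))"
      by (simp only: of_nat_le_iff) simp
    also have "\<dots> = real k ^ (u + 1) * rc (n - (u + 1)) (k - (u + 1))" by simp
    also have "\<dots> \<le> real k ^ (u + 1) * ((1 / (10 * real k)) ^ (u + 1 - 3) * P)" unfolding P_def
    proof (intro mult_left_mono rc_descend)
      have "(real k - 3) * (10 * real k) \<le> real n - 3"
        using nn K by (simp add: power2_eq_square algebra_simps)
      then show "real k - real 3 \<le> 1 / (10 * real k) * (real n - real 3)" using K by (simp add: field_simps)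
    qed (use u rk5 n_gt in auto)
    also have "\<dots> = (real k ^ (u + 1) * (1 / (10 * real k)) ^ (u + 1 - 3)) * P" by simp
    also have "\<dots> = (real k ^ 3 * (1 / 10) ^ (u + 1 - 3)) * P"
      using power_cancel_tail[of "real k" 3 "u + 1"] K u by simp
    finally have "3 / 4 * (real k)\<^sup>2 * P \<le> (real k ^ 3 * (1 / 10) ^ (u - 2)) * P" using size by simp
    then have "3 / 4 * (real k)\<^sup>2 \<le> real k ^ 3 * (1 / 10) ^ (u - 2)" using Ppos by (simp only: mult_le_cancel_right_pos)
    also have "\<dots> = (real k)\<^sup>2 * (real k * (1 / 10) ^ (u - 2))" by (simp only: power2_eq_square power3_eq_cube mult.assoc)
    finally have "(real k)\<^sup>2 * (3 / 4) \<le> (real k)\<^sup>2 * (real k * (1 / 10) ^ (u - 2))" by (simp only: mult.commute)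
    then have "3 / 4 \<le> real k * (1 / 10) ^ (u - 2)" using K by (subst (asm) mult_le_cancel_left_pos) auto
    then have "3 * 10 ^ (u - 2) \<le> 4 * real k" by (simp add: power_divide field_simps)
    moreover have "real k < (2 * real u + 2)\<^sup>2"
    proof -
      have "(r + 1) * (r + 1) \<le> (2 * u + 2) * (2 * u + 2)" using u by (intro mult_le_mono) auto
      then have "k < (2 * u + 2) * (2 * u + 2)" using r(2) by linarith
      then have "real k < real ((2 * u + 2) * (2 * u + 2))" by (simp only: of_nat_less_iff)
      then show ?thesis by (simp add: power2_eq_square algebra_simps)
    qed
    ultimately show False using square_le_power_ten[OF u(1)] by linarith
  qed
  then obtain R where R: "finite R" "card R \<le> u" "\<And>F. F \<in> \<F> \<Longrightarrow> R \<inter> F \<noteq> {}" by auto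
  have "0 < 3 / 4 * (real k)\<^sup>2 * P" using Ppos K by simp
  then have cF: "0 < real (card \<F>)" using size by linarith
  then have "\<F> \<noteq> {}" by auto
  then obtain v where v: "v \<in> R" "card \<F> \<le> card R * degree \<F> {v}"
    using exists_heavy_in_cover[OF fin_F R(1) R(3)] by blast
  have heavy: "3 / 2 * real r * (real k * P) \<le> real (degree \<F> {v})"
  proof -
    have "card R * degree \<F> {v} \<le> u * degree \<F> {v}" using R(2) by (rule mult_le_mono1)
    then have "2 * card \<F> \<le> r * degree \<F> {v}" using v(2) mult_le_mono1[OF u(2), of "degree \<F> {v}"] by linarith
    then have "real (2 * card \<F>) \<le> real (r * degree \<F> {v})" by (simp only: of_nat_le_iff)
    then have 1: "2 * real (card \<F>) \<le> real r * real (degree \<F> {v})" by simp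
    have "real r * (3 / 2 * real r * (real k * P)) = 3 / 2 * (real k * P) * (real r * real r)" by simp
    also have "\<dots> \<le> 3 / 2 * (real k * P) * real k" using rk(1) Ppos by (intro mult_left_mono) auto
    also have "\<dots> = 2 * (3 / 4 * (real k)\<^sup>2 * P)" by (simp add: power2_eq_square)
    also have "\<dots> \<le> real r * real (degree \<F> {v})" using size 1 by linarith
    finally show ?thesis using r10 by (subst (asm) mult_le_cancel_left_pos) auto
  qed
  have vn: "v \<in> {1..n}"
  proof -
    have "0 < 3 / 2 * real r * (real k * P)" using r10 K Ppos by simp
    then have "degree \<F> {v} \<noteq> 0" using heavy by (metis not_less of_nat_0)
    then obtain F where "F \<in> \<F>" "v \<in> F" unfolding degree_def by (metis (no_types, lifting) card.empty empty_Collect_eq insert_subset)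
    then show ?thesis using member by blast
  qed
  let ?L = "(\<lambda>F. F - {v}) ` {F \<in> \<F>. {v} \<subseteq> F}"
  have "card {F \<in> away v \<F>. {} \<subseteq> F} \<le> k ^ (r + 5 - card ({} :: nat set)) * ((card ({1..n} - {v}) - (r + 5)) choose (k - (r + 5)))"
  proof (rule branching[where \<G> = ?L])
    show "away v \<F> \<subseteq> nsets ({1..n} - {v}) k" using unif_F unfolding away_def nsets_def by blast
    show "finite G \<and> card G \<le> k" if GL: "G \<in> ?L" for G
    proof -
      obtain F where F: "F \<in> \<F>" "G = F - {v}" using GL by blast
      then show ?thesis using member[OF F(1)] card_mono[of F "F - {v}"] by auto
    qed
    show "F \<inter> G \<noteq> {}" if FG: "F \<in> away v \<F>" "G \<in> ?L" for F G
    proof -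
      obtain H where H: "H \<in> \<F>" "G = H - {v}" using FG(2) by blast
      have "F \<in> \<F>" "v \<notin> F" using FG(1) unfolding away_def by auto
      then show ?thesis using meet[OF \<open>F \<in> \<F>\<close> H(1)] H(2) by blast
    qed
    show "\<exists>G\<in>?L. S \<inter> G = {}" if S: "finite S" "card S < r + 5" for S
    proof (rule ccontr)
      assume no: "\<not> ?thesis"
      have "{F \<in> \<F>. {v} \<subseteq> F} \<subseteq> (\<Union>y\<in>S - {v}. {F \<in> \<F>. {v, y} \<subseteq> F})"
      proof
        fix F assume F: "F \<in> {F \<in> \<F>. {v} \<subseteq> F}"
        then have "S \<inter> (F - {v}) \<noteq> {}" using no by blast
        then obtain y where "y \<in> S - {v}" "y \<in> F" by blast
        then show "F \<in> (\<Union>y\<in>S - {v}. {F \<in> \<F>. {v, y} \<subseteq> F})" using F by auto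
      qed
      then have "degree \<F> {v} \<le> card (\<Union>y\<in>S - {v}. {F \<in> \<F>. {v, y} \<subseteq> F})"
        unfolding degree_def using S(1) fin_F by (intro card_mono) auto
      also have "\<dots> \<le> (\<Sum>y\<in>S - {v}. degree \<F> {v, y})" unfolding degree_def by (rule card_UN_le) (use S(1) in simp)
      finally have "real (degree \<F> {v}) \<le> real (\<Sum>y\<in>S - {v}. degree \<F> {v, y})" by (simp only: of_nat_le_iff)
      also have "\<dots> = (\<Sum>y\<in>S - {v}. real (degree \<F> {v, y}))" by simp
      also have "\<dots> \<le> (\<Sum>y\<in>S - {v}. real k * P)" by (intro sum_mono pair) auto
      also have "\<dots> = real (card (S - {v})) * (real k * P)" by simp
      also have "\<dots> \<le> real (r + 4) * (real k * P)"
      proof (rule mult_right_mono)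
        have "card (S - {v}) \<le> card S" using S(1) by (intro card_mono) auto
        then show "real (card (S - {v})) \<le> real (r + 4)" using S(2) by simp
      qed (use Ppos in simp)
      finally have "3 / 2 * real r * (real k * P) \<le> real (r + 4) * (real k * P)" using heavy by linarith
      then have "3 / 2 * real r \<le> real (r + 4)" using Ppos K by (subst (asm) mult_le_cancel_right_pos) auto
      then show False using r10 by simp
    qed
  qed (use rk5 in auto)
  moreover have "card ({1..n} - {v}) = m" using vn m_def by simp
  ultimately have "card (away v \<F>) \<le> k ^ (r + 5) * ((m - (r + 5)) choose (k - (r + 5)))" by simp
  then have "real (card (away v \<F>)) \<le> real (k ^ (r + 5) * ((m - (r + 5)) choose (k - (r + 5))))"
    by (simp only: of_nat_le_iff)
  also have "\<dots> = real k ^ (r + 5) * rc (m - (r + 5)) (k - (r + 5))" by simp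
  also have "\<dots> \<le> real k ^ (r + 5) * ((1 / (10 * real k)) ^ (r + 5 - 4) * rc (m - 4) (k - 4))"
  proof (intro mult_left_mono rc_descend)
    have "(real k - 4) * (10 * real k) \<le> real m - 4"
      using nn mn K by (simp add: power2_eq_square algebra_simps)
    then show "real k - real 4 \<le> 1 / (10 * real k) * (real m - real 4)" using K by (simp add: field_simps)
  qed (use rk5 m_ge in auto)
  also have "\<dots> = (real k ^ (r + 5) * (1 / (10 * real k)) ^ (r + 5 - 4)) * rc (m - 4) (k - 4)" by simp
  also have "\<dots> = (real k ^ 4 * (1 / 10) ^ (r + 5 - 4)) * rc (m - 4) (k - 4)"
    by (subst power_cancel_tail) (use K in auto)
  also have "\<dots> \<le> 4 / 5 * rc (m - 4) (k - 4)"
  proof (rule mult_right_mono)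
    have "real k ^ 4 \<le> ((real r + 1)\<^sup>2) ^ 4" using rk(2) by (intro power_mono) auto
    also have "\<dots> = (real r + 1) ^ 8" by (simp only: power_mult[symmetric]) simp
    finally have "5 * real k ^ 4 \<le> 4 * 10 ^ (r + 1)" using eighth_power_le_power_ten[OF r10] by linarith
    moreover have "r + 5 - 4 = r + 1" by simp
    ultimately show "real k ^ 4 * (1 / 10) ^ (r + 5 - 4) \<le> 4 / 5" by (simp add: power_divide field_simps)
  qed simp
  also have "\<dots> \<le> slack_real"
  proof -
    define \<rho> where "\<rho> = 1 - (real k - 1) / (real m - real k + 1)"
    have den: "0 < real m - real k + 1" "real k - 1 \<le> real m - real k + 1" using nn mn KK K by linarith+
    have \<rho>: "0 \<le> \<rho>" "\<rho> \<le> 1" unfolding \<rho>_def using den K by auto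
    have "(1 - 1 / 5) ^ 1 \<le> \<rho> ^ (k - 4)"
    proof (rule power_ge_chunk[OF \<rho>, of _ _ "k - 4" "(real k - 1) / (real m - real k + 1)"])
      have "real (k - 4) * (real k - 1) = (real k)\<^sup>2 - 5 * real k + 4"
        using k100 by (simp add: of_nat_diff power2_eq_square algebra_simps)
      also have "\<dots> \<le> 1 / 5 * (real m - real k + 1)" using nn mn KK K by (simp add: field_simps)
      finally show "real (k - 4) * ((real k - 1) / (real m - real k + 1)) \<le> 1 / 5"
        using den by (simp add: pos_divide_le_eq)
    qed (auto simp: \<rho>_def)
    then have "4 / 5 * rc (m - 4) (k - 4) \<le> \<rho> ^ (k - 4) * rc (m - 4) (k - 4)" by (intro mult_right_mono) auto
    also have "\<dots> \<le> slack_real" unfolding \<rho>_def by (rule slack_real_lower) (use \<rho>(1) \<rho>_def in simp)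
    finally show ?thesis .
  qed
  finally show ?thesis using vn by blast
qed

theorem exists_small_away:
  assumes "3 \<le> covering_number \<F>"
  shows "\<exists>v\<in>{1..n}. card (away v \<F>) \<le> ((n - 1 - k - 3) choose (k - 4)) + 2"
proof -
  have "\<exists>v\<in>{1..n}. real (card (away v \<F>)) \<le> slack_real"
  proof -
    consider "n \<le> 6 * k" | "6 * k \<le> n" "2 * n < k\<^sup>2" | "k\<^sup>2 \<le> 2 * n" "n \<le> 10 * k\<^sup>2" | "10 * k\<^sup>2 \<le> n" by linarith
    then show ?thesis
      using regime_near regime_middle_dense regime_middle_sparse regime_far[OF assms] by cases auto
  qed
  then obtain v where v: "v \<in> {1..n}" "real (card (away v \<F>)) \<le> slack_real" by blast
  then have "card (away v \<F>) \<le> (n - 1 - k - 3) choose (k - 4)"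
    unfolding slack_real_def m_def by (simp only: of_nat_le_iff)
  then show ?thesis using v(1) by (intro bexI[of _ v]) auto
qed

end

theorem theorem1p3:
  fixes n k :: nat
  assumes "k \<ge> 100" and "n > 2 * k"
  shows "max_size n k 3 = card (C3 n k)
    \<and> (\<forall>\<F>. \<F> \<subseteq> nsets {1..n} k \<and> intersecting \<F> \<and> covering_number \<F> \<ge> 3
           \<longrightarrow> card \<F> \<le> card (C3 n k))
    \<and> (C3 n k \<subseteq> nsets {1..n} k \<and> intersecting (C3 n k) \<and> covering_number (C3 n k) \<ge> 3)
    \<and> (\<forall>\<F>. \<F> \<subseteq> nsets {1..n} k \<and> intersecting \<F> \<and> covering_number \<F> \<ge> 3
           \<and> card \<F> = card (C3 n k)
           \<longrightarrow> isomorphic_families n \<F> (C3 n k))"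
proof -
  have k4: "4 \<le> k" using assms(1) by simp
  note C3 = C3_unif[OF k4 assms(2)] C3_intersecting[OF k4 assms(2)] C3_covering[OF k4 assms(2)]
  have main: "card \<F> \<le> card (C3 n k) \<and> (card \<F> = card (C3 n k) \<longrightarrow> isomorphic_families n \<F> (C3 n k))"
    if F: "\<F> \<subseteq> nsets {1..n} k" "intersecting \<F>" "3 \<le> covering_number \<F>" for \<F>
  proof (cases "card (C3 n k) \<le> card \<F>")
    case True
    interpret large_family n k \<F> using assms F(1,2) True by unfold_locales
    obtain v where "v \<in> {1..n}" "card (away v \<F>) \<le> ((n - 1 - k - 3) choose (k - 4)) + 2"
      using exists_small_away[OF F(3)] by blast
    then show ?thesis using bound_from_small_away[OF F k4 assms(2)] by blast
  next
    case False
    then show ?thesis by simp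
  qed
  have adm: "admissible n k 3 \<F> \<longleftrightarrow> \<F> \<subseteq> nsets {1..n} k \<and> intersecting \<F> \<and> 3 \<le> covering_number \<F>" for \<F>
    unfolding admissible_def by (simp add: numeral_eq_enat)
  have "max_size n k 3 = card (C3 n k)" unfolding max_size_def
  proof (rule Max_eqI)
    have "{card \<F> |\<F>. admissible n k 3 \<F>} \<subseteq> card ` Pow (nsets {1..n} k)" unfolding adm by blast
    then show "finite {card \<F> |\<F>. admissible n k 3 \<F>}"
      by (rule finite_subset) (simp add: finite_nsets)
    show "y \<le> card (C3 n k)" if "y \<in> {card \<F> |\<F>. admissible n k 3 \<F>}" for y
      using that main unfolding adm by blast
    show "card (C3 n k) \<in> {card \<F> |\<F>. admissible n k 3 \<F>}" unfolding adm using C3 by blast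
  qed
  then show ?thesis using main C3 by blast
qed



end
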